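(* Let $X$ be a compact complex manifold, $L$ a big line bundle on $X$ and $\phi$ a smooth positive metric on $L$. Let $F$ be a line bundle on $X$ and let $\psi_\lambda$, $\lambda\in(0,c)$, be a test curve on $F$, with Legendre transform $\widehat\phi_t$. Let $B\subset\mathbb C$ be the closed unit disc with coordinate $w$ and put $t=-\ln|w|^2$. Set $$\psi'=\Big(\sup_{\lambda\in(0,c)}\{\psi_\lambda+\lambda t\}\Big)^*,\qquad \phi'=\phi+ct.$$ Then the Legendre transform of $\psi_\lambda$ is given by the maximal envelope $$\widehat\phi_t=\phi'_{[\psi']}$$ over $X\times B$.
   Context: Metrics are written additively: a (possibly singular) hermitian metric $e^{-\phi}$ on $L$ is identified with its local weights $\phi_f=-\ln|f|^2$, $f$ a local holomorphic frame. $PSH(L)$ is the set of positive singular metrics on $L$, i.e. metrics whose local weights are plurisubharmonic (upper semicontinuous; $\equiv-\infty$ is allowed). A smooth metric is positive if it lies in $PSH(L)$. $(\cdot)^*$ denotes upper semicontinuous regularisation of a function or metric. Fix a smooth reference metric $\sigma$ on $F$. For real $\lambda>0$, a metric $\psi_\lambda$ on the formal multiple $\lambda F$ is one for which $\psi_\lambda-\lambda\sigma$ is a function on $X$, and $\psi_\lambda\in PSH(\lambda F)$ means that locally $\psi_\lambda$ (i.e. $\lambda$ times a local weight of $\sigma$ plus this function) is plurisubharmonic. Test curve on $F$: a map $\lambda\mapsto\psi_\lambda\in PSH(\lambda F)$ for $\lambda\in(0,c)$, for some $c$, such that (1) $\psi_\lambda$ is concave in $\lambda$; (2) $\lambda^{-1}\psi_\lambda$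 is decreasing in $\lambda$; (3) there is a metric $\phi_F$ on $F$ with $\lambda^{-1}\psi_\lambda\le\phi_F$ for all $\lambda\in(0,c)$. Set $\phi_\lambda:=\phi_{[\psi_\lambda]}:=\big(\sup\{\gamma\in PSH(L):\gamma\le\phi,\ \gamma\le\phi+(\psi_\lambda-\lambda\sigma)+C\text{ for some constant }C\}\big)^*$ for $\lambda\in(0,c)$ (independent of $\sigma$), $\phi_\lambda:=\phi$ for $\lambda\le0$ and $\phi_\lambda:=-\infty$ for $\lambda\ge c$. The Legendre transform of the test curve is $\widehat\phi_t:=\big(\sup_{\lambda\in\mathbb R}\{\phi_\lambda+t\lambda\}\big)^*$, $t\in[0,\infty)$. On the product: let $\pi:X\times B\to X$ be the projection; pullbacks by $\pi$ are suppressed, and $\widehat\phi_t$ with $t=-\ln|w|^2$ is regarded as a metric on $\pi^*L$ over $X\times B$. Only the singularity type of $\psi'$ matters; relative to the reference metrics it is represented by the function $g=\big(\sup_{\lambda\in(0,c)}\{(\psi_\lambda-\lambda\sigma)+\lambda t\}\big)^*$. The maximal envelope is $$\phi'_{[\psi']}:=\Big(\sup\{\gamma\in PSH(\pi^*L):\ \gamma\le\phi',\ \gamma\le\psi'+O(1)\}\Big)^*,$$ where $PSH(\pi^*L)$ is the set of positive singular metrics on $\pi^*L$ over $X\times B$, and $\gamma\le\psi'+O(1)$ means $\gamma\le\phi+g+C$ for some constant $C$.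
   Formalization: The identity is stated and the envelope taken over X×(B∖{0}), since t is infinite at w=0 and requiring positivity across w=0 makes it false (F=L, ψ_λ=λφ); the test curve must have some ψ_λ not identically −∞, else the right side is −∞. X is connected of dimension ≥1. *)

theory Defs
  imports "HOL-Analysis.Analysis" "HOL-Library.Function_Algebras"
begin

section \<open>Complex normed spaces\<close>

class complex_normed = real_normed_vector +
  fixes scaleC :: "complex \<Rightarrow> 'a \<Rightarrow> 'a"  (infixr "*\<^sub>C" 75)
  assumes scaleC_add_right: "a *\<^sub>C (x + y) = a *\<^sub>C x + a *\<^sub>C y"
    and scaleC_add_left: "(a + b) *\<^sub>C x = a *\<^sub>C x + b *\<^sub>C x"
    and scaleC_scaleC: "a *\<^sub>C b *\<^sub>C x = (a * b) *\<^sub>C x"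
    and scaleC_of_real: "complex_of_real r *\<^sub>C x = r *\<^sub>R x"
    and norm_scaleC: "norm (a *\<^sub>C x) = cmod a * norm x"

instantiation complex :: complex_normed
begin
definition scaleC_complex :: "complex \<Rightarrow> complex \<Rightarrow> complex" where
  "scaleC_complex a x = a * x"
instance
  by standard (simp_all add: scaleC_complex_def algebra_simps norm_mult scaleR_conv_of_real)
end

instantiation prod :: (complex_normed, complex_normed) complex_normed
begin
definition scaleC_prod :: "complex \<Rightarrow> 'a \<times> 'b \<Rightarrow> 'a \<times> 'b" where
  "scaleC_prod a p = (a *\<^sub>C fst p, a *\<^sub>C snd p)"
instance
proof
  fix a :: complex and x :: "'a \<times> 'b"
  have "norm (a *\<^sub>C x) = sqrt ((cmod a)\<^sup>2 * ((norm (fst x))\<^sup>2 + (norm (snd x))\<^sup>2))"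
    by (simp add: scaleC_prod_def norm_prod_def norm_scaleC power_mult_distrib distrib_left)
  then show "norm (a *\<^sub>C x) = cmod a * norm x"
    by (simp add: real_sqrt_mult norm_prod_def)
qed (simp_all add: scaleC_prod_def scaleC_add_right scaleC_add_left scaleC_scaleC
      scaleC_of_real scaleR_prod_def)
end

instantiation vec :: (complex_normed, finite) complex_normed
begin
definition scaleC_vec :: "complex \<Rightarrow> ('a, 'b) vec \<Rightarrow> ('a, 'b) vec" where
  "scaleC_vec a v = (\<chi> i. a *\<^sub>C (v $ i))"
instance
proof
  fix a :: complex and x :: "('a, 'b) vec"
  show "norm (a *\<^sub>C x) = cmod a * norm x"
    by (simp add: scaleC_vec_def norm_vec_def norm_scaleC L2_set_right_distrib)
qed (simp_all add: scaleC_vec_def vec_eq_iff scaleC_add_right scaleC_add_left scaleC_scaleC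
      scaleC_of_real)
end


section \<open>Holomorphic, smooth and plurisubharmonic functions on open sets\<close>

definition cholomorphic_on ::
  "('a::complex_normed \<Rightarrow> 'b::complex_normed) \<Rightarrow> 'a set \<Rightarrow> bool" where
  "cholomorphic_on f U \<longleftrightarrow>
     (\<forall>z\<in>U. \<exists>D. (f has_derivative D) (at z) \<and> (\<forall>c v. D (c *\<^sub>C v) = c *\<^sub>C D v))"

primrec Ck_on :: "nat \<Rightarrow> ('a::real_normed_vector \<Rightarrow> real) \<Rightarrow> 'a set \<Rightarrow> bool" where
  "Ck_on 0 f U \<longleftrightarrow> continuous_on U f"
| "Ck_on (Suc k) f U \<longleftrightarrow>
     (\<forall>x\<in>U. f differentiable (at x)) \<and> (\<forall>v. Ck_on k (\<lambda>x. frechet_derivative f (at x) v) U)"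

definition smooth_on :: "('a::real_normed_vector \<Rightarrow> real) \<Rightarrow> 'a set \<Rightarrow> bool" where
  "smooth_on f U \<longleftrightarrow> (\<forall>k. Ck_on k f U)"

text \<open>The upper semicontinuous regularisation of \<open>f\<close> as a function on the subspace \<open>S\<close>.
  The filter \<open>nhds x \<sqinter> principal S\<close> contains the point \<open>x\<close> itself, so for \<open>x \<in> S\<close> this is the
  usual limsup including the value at \<open>x\<close>. Values of \<open>f\<close> outside \<open>S\<close> are irrelevant.\<close>
definition usc_reg :: "'a::topological_space set \<Rightarrow> ('a \<Rightarrow> ereal) \<Rightarrow> 'a \<Rightarrow> ereal" where
  "usc_reg S f x = Limsup (inf (nhds x) (principal S)) f"

definition usc_on :: "'a::topological_space set \<Rightarrow> ('a \<Rightarrow> ereal) \<Rightarrow> bool" where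
  "usc_on S f \<longleftrightarrow> (\<forall>a. openin (top_of_set S) {x \<in> S. f x < a})"

text \<open>The mean over the circle \<open>z + e\<^sup>2\<^sup>\<pi>\<^sup>i\<^sup>\<theta> v\<close>, as the difference of the integrals of the positive
  and negative parts (\<open>e2ennreal\<close> truncates negative values to \<open>0\<close>). It is only used where \<open>f\<close> is
  upper semicontinuous and \<open>< \<infinity>\<close>, so the first integral is finite.\<close>
definition circle_mean :: "('a::complex_normed \<Rightarrow> ereal) \<Rightarrow> 'a \<Rightarrow> 'a \<Rightarrow> ereal" where
  "circle_mean f z v =
     enn2ereal (\<integral>\<^sup>+\<theta>\<in>{0..1}. e2ennreal (f (z + cis (2 * pi * \<theta>) *\<^sub>C v)) \<partial>lborel)
     - enn2ereal (\<integral>\<^sup>+\<theta>\<in>{0..1}. e2ennreal (- f (z + cis (2 * pi * \<theta>) *\<^sub>C v)) \<partial>lborel)"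

text \<open>The function \<open>-\<infinity>\<close> is allowed.\<close>
definition psh_on :: "('a::complex_normed \<Rightarrow> ereal) \<Rightarrow> 'a set \<Rightarrow> bool" where
  "psh_on f U \<longleftrightarrow> usc_on U f \<and> (\<forall>z\<in>U. f z \<noteq> \<infinity>) \<and>
     (\<forall>z v. (\<forall>\<zeta>\<in>cball 0 1. z + \<zeta> *\<^sub>C v \<in> U) \<longrightarrow> f z \<le> circle_mean f z v)"


section \<open>Complex manifolds\<close>

text \<open>The manifold is a whole topological space \<open>'x\<close>, and \<open>'e\<close> is the model space. An atlas is a
  set of charts \<open>(W, \<kappa>)\<close>; only the values of \<open>\<kappa>\<close> on \<open>W\<close> matter.\<close>

type_synonym ('x, 'e) atlas = "('x set \<times> ('x \<Rightarrow> 'e)) set"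

definition complex_atlas :: "('x::topological_space, 'e::complex_normed) atlas \<Rightarrow> bool" where
  "complex_atlas A \<longleftrightarrow>
     (\<Union>(W, \<kappa>)\<in>A. W) = UNIV \<and>
     (\<forall>(W, \<kappa>)\<in>A. open W \<and> open (\<kappa> ` W) \<and> homeomorphism W (\<kappa> ` W) \<kappa> (inv_into W \<kappa>)) \<and>
     (\<forall>(W, \<kappa>)\<in>A. \<forall>(W', \<kappa>')\<in>A. cholomorphic_on (\<kappa>' \<circ> inv_into W \<kappa>) (\<kappa> ` (W \<inter> W')))"

text \<open>Manifolds are connected. Second countability is automatic for compact spaces.\<close>
definition compact_complex_manifold :: "('x::t2_space, complex^'n) atlas \<Rightarrow> bool" where
  "compact_complex_manifold A \<longleftrightarrow>
     complex_atlas A \<and> compact (UNIV :: 'x set) \<and> connected (UNIV :: 'x set)"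

definition holomorphic_fun ::
  "('x::topological_space, 'e::complex_normed) atlas \<Rightarrow> 'x set \<Rightarrow> ('x \<Rightarrow> complex) \<Rightarrow> bool" where
  "holomorphic_fun A U f \<longleftrightarrow> (\<forall>(W, \<kappa>)\<in>A. cholomorphic_on (f \<circ> inv_into W \<kappa>) (\<kappa> ` (W \<inter> U)))"

definition smooth_fun ::
  "('x::topological_space, 'e::complex_normed) atlas \<Rightarrow> 'x set \<Rightarrow> ('x \<Rightarrow> real) \<Rightarrow> bool" where
  "smooth_fun A U f \<longleftrightarrow> (\<forall>(W, \<kappa>)\<in>A. smooth_on (f \<circ> inv_into W \<kappa>) (\<kappa> ` (W \<inter> U)))"

definition psh_fun ::
  "('x::topological_space, 'e::complex_normed) atlas \<Rightarrow> 'x set \<Rightarrow> ('x \<Rightarrow> ereal) \<Rightarrow> bool" where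
  "psh_fun A U f \<longleftrightarrow> (\<forall>(W, \<kappa>)\<in>A. psh_on (f \<circ> inv_into W \<kappa>) (\<kappa> ` (W \<inter> U)))"

definition times_plane :: "('x, 'e) atlas \<Rightarrow> ('x \<times> complex, 'e \<times> complex) atlas" where
  "times_plane A = (\<lambda>(W, \<kappa>). (W \<times> UNIV, map_prod \<kappa> id)) ` A"


section \<open>Line bundles\<close>

text \<open>A line bundle is given by frames \<open>f\<^sub>i\<close> over the sets \<open>lb_dom L i\<close> of an open cover and the
  transition functions \<open>g\<^sub>i\<^sub>j = lb_trans L i j\<close> with \<open>f\<^sub>j = g\<^sub>i\<^sub>j f\<^sub>i\<close>.\<close>

record ('i, 'x) line_bundle =
  lb_dom :: "'i \<Rightarrow> 'x set"
  lb_trans :: "'i \<Rightarrow> 'i \<Rightarrow> 'x \<Rightarrow> complex"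

definition holomorphic_line_bundle ::
  "('x::topological_space, 'e::complex_normed) atlas \<Rightarrow> ('i, 'x) line_bundle \<Rightarrow> bool" where
  "holomorphic_line_bundle A L \<longleftrightarrow>
     (\<forall>i. open (lb_dom L i)) \<and> (\<Union>i. lb_dom L i) = UNIV \<and>
     (\<forall>i j. holomorphic_fun A (lb_dom L i \<inter> lb_dom L j) (lb_trans L i j)) \<and>
     (\<forall>i j. \<forall>x \<in> lb_dom L i \<inter> lb_dom L j. lb_trans L i j x \<noteq> 0) \<and>
     (\<forall>i j k. \<forall>x \<in> lb_dom L i \<inter> lb_dom L j \<inter> lb_dom L k.
        lb_trans L i j x * lb_trans L j k x = lb_trans L i k x)"

text \<open>The pullback along the projection \<open>fst\<close>.\<close>
definition pullback_lb :: "('i, 'x) line_bundle \<Rightarrow> ('i, 'x \<times> complex) line_bundle" where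
  "pullback_lb L = \<lparr>lb_dom = (\<lambda>i. lb_dom L i \<times> UNIV), lb_trans = (\<lambda>i j. lb_trans L i j \<circ> fst)\<rparr>"

text \<open>Global holomorphic sections of \<open>kL\<close>: a section is the family of its coefficients with respect
  to the frames \<open>f\<^sub>i\<^sup>k\<close>, extended by \<open>0\<close> so that distinct families are distinct sections.\<close>
definition sections ::
  "('x::topological_space, 'e::complex_normed) atlas \<Rightarrow> ('i, 'x) line_bundle \<Rightarrow> nat \<Rightarrow>
   ('i \<Rightarrow> 'x \<Rightarrow> complex) set" where
  "sections A L k = {s.
     (\<forall>i. holomorphic_fun A (lb_dom L i) (s i)) \<and>
     (\<forall>i. \<forall>x. x \<notin> lb_dom L i \<longrightarrow> s i x = 0) \<and>
     (\<forall>i j. \<forall>x \<in> lb_dom L i \<inter> lb_dom L j. s i x = lb_trans L i j x ^ k * s j x)}"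

definition section_scale :: "complex \<Rightarrow> ('i \<Rightarrow> 'x \<Rightarrow> complex) \<Rightarrow> 'i \<Rightarrow> 'x \<Rightarrow> complex" where
  "section_scale c s = (\<lambda>i x. c * s i x)"

lemma vector_space_section_scale: "vector_space section_scale"
  by standard (auto simp: section_scale_def fun_eq_iff algebra_simps)

text \<open>On a compact manifold this is the genuine dimension, since the space of sections is
  finite-dimensional.\<close>
definition h0 ::
  "('x::topological_space, 'e::complex_normed) atlas \<Rightarrow> ('i, 'x) line_bundle \<Rightarrow> nat \<Rightarrow> nat" where
  "h0 A L k = vector_space.dim section_scale (sections A L k)"

definition volume ::
  "('x::topological_space, complex^'n) atlas \<Rightarrow> ('i, 'x) line_bundle \<Rightarrow> ereal" where
  "volume A L =
     limsup (\<lambda>k. ereal (fact CARD('n) * real (h0 A L k) / real k ^ CARD('n)))"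

definition big ::
  "('x::topological_space, complex^'n) atlas \<Rightarrow> ('i, 'x) line_bundle \<Rightarrow> bool" where
  "big A L \<longleftrightarrow> volume A L > 0"


section \<open>Metrics\<close>

text \<open>A metric on \<open>aL\<close> over \<open>S\<close>, for a real number \<open>a\<close>, is the family of its local weights
  \<open>\<phi>\<^sub>i = -ln |f\<^sub>i|\<^sup>2\<close> (for \<open>a = 1\<close>). From \<open>f\<^sub>j = g\<^sub>i\<^sub>j f\<^sub>i\<close> one gets
  \<open>\<phi>\<^sub>i = \<phi>\<^sub>j + ln |g\<^sub>i\<^sub>j|\<^sup>2\<close>. For general \<open>a\<close> the rule below says precisely that \<open>\<phi> - a\<sigma>\<close> is a
  well-defined function for every metric \<open>\<sigma>\<close> on \<open>L\<close> with real weights. The values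
  \<open>\<phi> i x\<close> with \<open>x \<notin> S \<inter> lb_dom L i\<close> carry no meaning.\<close>
definition metric_on ::
  "'x set \<Rightarrow> real \<Rightarrow> ('i, 'x) line_bundle \<Rightarrow> ('i \<Rightarrow> 'x \<Rightarrow> ereal) \<Rightarrow> bool" where
  "metric_on S a L \<phi> \<longleftrightarrow>
     (\<forall>i. \<forall>x \<in> S \<inter> lb_dom L i. \<phi> i x \<noteq> \<infinity>) \<and>
     (\<forall>i j. \<forall>x \<in> S \<inter> lb_dom L i \<inter> lb_dom L j.
        \<phi> i x = \<phi> j x + ereal (a * ln ((cmod (lb_trans L i j x))\<^sup>2)))"

definition metric_le ::
  "'x set \<Rightarrow> ('i, 'x) line_bundle \<Rightarrow> ('i \<Rightarrow> 'x \<Rightarrow> ereal) \<Rightarrow> ('i \<Rightarrow> 'x \<Rightarrow> ereal) \<Rightarrow> bool" where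
  "metric_le S L \<gamma> \<delta> \<longleftrightarrow> (\<forall>i. \<forall>x \<in> S \<inter> lb_dom L i. \<gamma> i x \<le> \<delta> i x)"

definition smooth_metric ::
  "('x::topological_space, 'e::complex_normed) atlas \<Rightarrow> ('i, 'x) line_bundle \<Rightarrow>
   ('i \<Rightarrow> 'x \<Rightarrow> real) \<Rightarrow> bool" where
  "smooth_metric A L \<phi> \<longleftrightarrow>
     metric_on UNIV 1 L (\<lambda>i x. ereal (\<phi> i x)) \<and> (\<forall>i. smooth_fun A (lb_dom L i) (\<phi> i))"

text \<open>Positive singular metrics on \<open>aL\<close> over \<open>S\<close>. When \<open>S\<close> has boundary points, the weights are
  upper semicontinuous up to the boundary and plurisubharmonic in the interior.\<close>
definition PSH ::
  "('x::topological_space, 'e::complex_normed) atlas \<Rightarrow> 'x set \<Rightarrow> real \<Rightarrow> ('i, 'x) line_bundle \<Rightarrow>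
   ('i \<Rightarrow> 'x \<Rightarrow> ereal) set" where
  "PSH A S a L = {\<phi>. metric_on S a L \<phi> \<and>
     (\<forall>i. usc_on (S \<inter> lb_dom L i) (\<phi> i) \<and> psh_fun A (interior S \<inter> lb_dom L i) (\<phi> i))}"

definition sup_star ::
  "'x::topological_space set \<Rightarrow> ('i, 'x) line_bundle \<Rightarrow> ('i \<Rightarrow> 'x \<Rightarrow> ereal) set \<Rightarrow>
   'i \<Rightarrow> 'x \<Rightarrow> ereal" where
  "sup_star S L \<Gamma> i = usc_reg (S \<inter> lb_dom L i) (\<lambda>x. SUP \<gamma>\<in>\<Gamma>. \<gamma> i x)"

text \<open>\<open>(sup {\<gamma> \<in> PSH(L) : \<gamma> \<le> \<phi>, \<gamma> \<le> \<theta> + O(1)})\<^sup>*\<close> over \<open>S\<close>.\<close>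
definition maximal_envelope ::
  "('x::topological_space, 'e::complex_normed) atlas \<Rightarrow> 'x set \<Rightarrow> ('i, 'x) line_bundle \<Rightarrow>
   ('i \<Rightarrow> 'x \<Rightarrow> ereal) \<Rightarrow> ('i \<Rightarrow> 'x \<Rightarrow> ereal) \<Rightarrow> 'i \<Rightarrow> 'x \<Rightarrow> ereal" where
  "maximal_envelope A S L \<phi> \<theta> = sup_star S L
     {\<gamma> \<in> PSH A S 1 L. metric_le S L \<gamma> \<phi> \<and>
        (\<exists>C::real. metric_le S L \<gamma> (\<lambda>i x. \<theta> i x + ereal C))}"


section \<open>Test curves and Legendre transforms\<close>

definition test_curve ::
  "('x::topological_space, 'e::complex_normed) atlas \<Rightarrow> ('j, 'x) line_bundle \<Rightarrow> real \<Rightarrow>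
   (real \<Rightarrow> 'j \<Rightarrow> 'x \<Rightarrow> ereal) \<Rightarrow> bool" where
  "test_curve A F c \<psi> \<longleftrightarrow> 0 < c \<and>
     (\<forall>l\<in>{0<..<c}. \<psi> l \<in> PSH A UNIV l F) \<and>
     (\<forall>l\<in>{0<..<c}. \<forall>\<mu>\<in>{0<..<c}. \<forall>s\<in>{0<..<1}. metric_le UNIV F
        (\<lambda>j x. ereal s * \<psi> l j x + ereal (1 - s) * \<psi> \<mu> j x) (\<psi> (s * l + (1 - s) * \<mu>))) \<and>
     (\<forall>l\<in>{0<..<c}. \<forall>\<mu>\<in>{0<..<c}. l \<le> \<mu> \<longrightarrow> metric_le UNIV F
        (\<lambda>j x. ereal (1 / \<mu>) * \<psi> \<mu> j x) (\<lambda>j x. ereal (1 / l) * \<psi> l j x)) \<and>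
     (\<exists>\<phi>F. metric_on UNIV 1 F \<phi>F \<and>
        (\<forall>l\<in>{0<..<c}. metric_le UNIV F (\<lambda>j x. ereal (1 / l) * \<psi> l j x) \<phi>F))"

text \<open>The function \<open>\<psi>\<^sub>\<lambda> - \<lambda>\<sigma>\<close>, where \<open>\<psi>\<^sub>\<lambda>\<close> is a metric on \<open>\<lambda>F\<close>; its value does not depend on the
  chosen frame.\<close>
definition metric_diff ::
  "('j, 'x) line_bundle \<Rightarrow> real \<Rightarrow> ('j \<Rightarrow> 'x \<Rightarrow> ereal) \<Rightarrow> ('j \<Rightarrow> 'x \<Rightarrow> real) \<Rightarrow> 'x \<Rightarrow> ereal" where
  "metric_diff F l \<tau> \<sigma> x =
     (let j = (SOME j. x \<in> lb_dom F j) in \<tau> j x - ereal (l * \<sigma> j x))"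

definition envelope_curve ::
  "('x::topological_space, 'e::complex_normed) atlas \<Rightarrow> ('i, 'x) line_bundle \<Rightarrow>
   ('j, 'x) line_bundle \<Rightarrow> ('i \<Rightarrow> 'x \<Rightarrow> real) \<Rightarrow> ('j \<Rightarrow> 'x \<Rightarrow> real) \<Rightarrow> real \<Rightarrow>
   (real \<Rightarrow> 'j \<Rightarrow> 'x \<Rightarrow> ereal) \<Rightarrow> real \<Rightarrow> 'i \<Rightarrow> 'x \<Rightarrow> ereal" where
  "envelope_curve A L F \<phi> \<sigma> c \<psi> l =
     (if l \<le> 0 then (\<lambda>i x. ereal (\<phi> i x))
      else if l < c then maximal_envelope A UNIV L (\<lambda>i x. ereal (\<phi> i x))
             (\<lambda>i x. ereal (\<phi> i x) + metric_diff F l (\<psi> l) \<sigma> x)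
      else (\<lambda>i x. -\<infinity>))"

definition legendre_transform ::
  "('x::topological_space, 'e::complex_normed) atlas \<Rightarrow> ('i, 'x) line_bundle \<Rightarrow>
   ('j, 'x) line_bundle \<Rightarrow> ('i \<Rightarrow> 'x \<Rightarrow> real) \<Rightarrow> ('j \<Rightarrow> 'x \<Rightarrow> real) \<Rightarrow> real \<Rightarrow>
   (real \<Rightarrow> 'j \<Rightarrow> 'x \<Rightarrow> ereal) \<Rightarrow> real \<Rightarrow> 'i \<Rightarrow> 'x \<Rightarrow> ereal" where
  "legendre_transform A L F \<phi> \<sigma> c \<psi> t = sup_star UNIV L
     (range (\<lambda>l::real. \<lambda>i x. envelope_curve A L F \<phi> \<sigma> c \<psi> l i x + ereal (t * l)))"


section \<open>The product with the disc\<close>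

definition tpar :: "complex \<Rightarrow> real" where
  "tpar w = - ln ((cmod w)\<^sup>2)"

text \<open>The part of the closed unit disc \<open>B\<close> on which \<open>t = -ln |w|\<^sup>2\<close> is defined (and takes values in
  \<open>[0,\<infinity>)\<close>). The puncture is essential: a positive metric across \<open>w = 0\<close> bounded by \<open>\<phi>\<close> for
  \<open>|w| = 1\<close> is bounded by \<open>\<phi>\<close> for all \<open>w\<close>, by the maximum principle.\<close>
definition punctured_disc :: "complex set" where
  "punctured_disc = cball 0 1 - {0}"

text \<open>\<open>\<psi>'\<close> relative to the reference metric \<open>\<sigma>\<close>; the regularisation is in both variables.\<close>
definition psi_prime ::
  "('j, 'x::topological_space) line_bundle \<Rightarrow> ('j \<Rightarrow> 'x \<Rightarrow> real) \<Rightarrow> real \<Rightarrow>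
   (real \<Rightarrow> 'j \<Rightarrow> 'x \<Rightarrow> ereal) \<Rightarrow> 'x \<times> complex \<Rightarrow> ereal" where
  "psi_prime F \<sigma> c \<psi> = usc_reg (UNIV \<times> punctured_disc)
     (\<lambda>(x, w). SUP l\<in>{0<..<c}. metric_diff F l (\<psi> l) \<sigma> x + ereal (l * tpar w))"

definition product_envelope ::
  "('x::topological_space, 'e::complex_normed) atlas \<Rightarrow> ('i, 'x) line_bundle \<Rightarrow>
   ('j, 'x) line_bundle \<Rightarrow> ('i \<Rightarrow> 'x \<Rightarrow> real) \<Rightarrow> ('j \<Rightarrow> 'x \<Rightarrow> real) \<Rightarrow> real \<Rightarrow>
   (real \<Rightarrow> 'j \<Rightarrow> 'x \<Rightarrow> ereal) \<Rightarrow> 'i \<Rightarrow> 'x \<times> complex \<Rightarrow> ereal" where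
  "product_envelope A L F \<phi> \<sigma> c \<psi> =
     maximal_envelope (times_plane A) (UNIV \<times> punctured_disc) (pullback_lb L)
       (\<lambda>i (x, w). ereal (\<phi> i x + c * tpar w))
       (\<lambda>i (x, w). ereal (\<phi> i x) + psi_prime F \<sigma> c \<psi> (x, w))"

end

theory Submission
  imports Defs "HOL-Complex_Analysis.Complex_Analysis"
begin

text \<open>Put \<open>t = -ln |w|\<^sup>2\<close> and \<open>u\<^sub>\<lambda> = \<psi>\<^sub>\<lambda> - \<lambda>\<sigma>\<close>. The theorem is Legendre duality in the variable
  \<open>t\<close>, and each inequality comes from moving competitors between the two envelopes.

  If \<open>\<gamma>\<close> competes for \<open>\<phi>\<^sub>\<lambda>\<close>, then \<open>\<gamma> + \<lambda>t\<close> competes on the product, because \<open>\<lambda>t\<close> is pluriharmonic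
  for \<open>w \<noteq> 0\<close>. The metric \<open>\<phi>\<close> competes as well: \<open>u\<^sub>\<lambda> \<ge> (\<lambda>/\<nu>) u\<^sub>\<nu>\<close> for \<open>\<lambda> \<le> \<nu>\<close>, so \<open>sup\<^sub>\<lambda> u\<^sub>\<lambda> \<ge> 0\<close> wherever
  \<open>u\<^sub>\<nu>\<close> is finite, which is a dense set, and hence \<open>g \<ge> 0\<close> after regularisation (\<open>g_nonneg\<close>).
  Hence the Legendre transform is at most the envelope.

  Conversely let \<open>\<gamma>\<close> compete on the product, and let \<open>\<Gamma>(x,t)\<close> be its supremum over the circle
  \<open>|w|\<^sup>2 = e\<^sup>-\<^sup>t\<close>. It is convex in \<open>t\<close> by the three circles theorem, and by Kiselman's minimum principle
  (\<open>psh_on_legendre_inf\<close>) the metric \<open>\<gamma>\<^sub>\<lambda> = inf\<^sub>t (\<Gamma> - \<lambda>t)\<close> on \<open>L\<close> is positive. From \<open>\<gamma> \<le> \<phi> + g + O(1)\<close>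
  one gets \<open>\<gamma>\<^sub>\<lambda> \<le> \<phi> + u\<^sub>\<lambda>\<^sub>' + O(1)\<close> for every \<open>\<lambda>' < \<lambda>\<close> (\<open>legendre_inf_g_le\<close>), so \<open>\<gamma>\<^sub>\<lambda>\<close> competes for \<open>\<phi>\<^sub>\<lambda>\<^sub>'\<close>.
  A supporting line of the convex function \<open>\<Gamma>(x,\<cdot>)\<close> recovers \<open>\<Gamma>\<close> from the \<open>\<gamma>\<^sub>\<lambda>\<close>, and \<open>\<lambda>' \<rightarrow> \<lambda>\<close>
  shows that the envelope is at most the Legendre transform.

  Giving way from \<open>\<lambda>\<close> to \<open>\<lambda>'\<close> is what keeps the argument elementary. At a fixed \<open>\<lambda>\<close> the inequality
  would hold off the negligible set where the regularisation changes \<open>sup\<^sub>\<lambda> (u\<^sub>\<lambda> + \<lambda>t)\<close>, and one would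
  need to know that this set is null. With a gap, that supremum may be replaced by a maximum over a
  finite grid of values of \<open>\<lambda>\<close>; a finite maximum is upper semicontinuous already, so regularisation
  does not see the difference.

  Kiselman's principle is proved with discs. To test the submean inequality of \<open>inf\<^sub>t (\<Gamma> - \<lambda>t)\<close> on a
  disc, one selects nearly optimal values \<open>t(\<zeta>)\<close> continuously on the boundary circle, approximates them
  by the real part of a polynomial \<open>G\<close>, and applies the maximum principle to \<open>\<gamma>\<close> on the disc
  \<open>\<zeta> \<mapsto> (z + \<zeta>v, e\<^sup>-\<^sup>G\<^sup>/\<^sup>2)\<close>. Plurisubharmonicity is defined by affine discs, so the maximum principle on
  such curved discs is a theorem (\<open>psh_le_along_graph\<close>).

  The pluripotential input on the manifold (the finite locus of \<open>u\<^sub>\<nu>\<close> is dense, and all \<open>u\<^sub>\<lambda>\<close> have a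
  common upper bound) follows from averaging the submean inequality over balls.\<close>

section \<open>Upper semicontinuous functions\<close>

lemma usc_on_iff:
  "usc_on S f \<longleftrightarrow>
     (\<forall>x\<in>S. \<forall>a. f x < a \<longrightarrow> (\<exists>N. open N \<and> x \<in> N \<and> (\<forall>y\<in>N \<inter> S. f y < a)))"
proof
  assume L: "usc_on S f"
  show "\<forall>x\<in>S. \<forall>a. f x < a \<longrightarrow> (\<exists>N. open N \<and> x \<in> N \<and> (\<forall>y\<in>N \<inter> S. f y < a))"
  proof (intro ballI allI impI)
    fix x a assume x: "x \<in> S" "f x < a"
    have "openin (top_of_set S) {x \<in> S. f x < a}" using L by (simp add: usc_on_def)
    then obtain N where N: "open N" "{x \<in> S. f x < a} = S \<inter> N"
      unfolding openin_open by (elim exE conjE) (rule that)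
    with x show "\<exists>N. open N \<and> x \<in> N \<and> (\<forall>y\<in>N \<inter> S. f y < a)" by blast
  qed
next
  assume R: "\<forall>x\<in>S. \<forall>a. f x < a \<longrightarrow> (\<exists>N. open N \<and> x \<in> N \<and> (\<forall>y\<in>N \<inter> S. f y < a))"
  show "usc_on S f" unfolding usc_on_def openin_open
  proof
    fix a
    define T where "T = \<Union>{N. open N \<and> (\<forall>y\<in>N \<inter> S. f y < a)}"
    have "open T" unfolding T_def by blast
    moreover have "{x \<in> S. f x < a} = S \<inter> T"
    proof (intro equalityI subsetI)
      fix x assume "x \<in> {x \<in> S. f x < a}"
      then have x: "x \<in> S" "f x < a" by auto
      with R obtain N where "open N \<and> x \<in> N \<and> (\<forall>y\<in>N \<inter> S. f y < a)" by presburger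
      with x show "x \<in> S \<inter> T" unfolding T_def by auto
    qed (auto simp: T_def)
    ultimately show "\<exists>T. open T \<and> {x \<in> S. f x < a} = S \<inter> T" by blast
  qed
qed

lemma usc_onE:
  assumes "usc_on S f" "x \<in> S" "f x < a"
  obtains N where "open N" "x \<in> N" "\<And>y. y \<in> N \<Longrightarrow> y \<in> S \<Longrightarrow> f y < a"
  using assms unfolding usc_on_iff by (metis IntI)

lemma usc_onI:
  assumes "\<And>x a. x \<in> S \<Longrightarrow> f x < a \<Longrightarrow> \<exists>N. open N \<and> x \<in> N \<and> (\<forall>y\<in>N \<inter> S. f y < a)"
  shows "usc_on S f"
  using assms unfolding usc_on_iff by blast

lemma usc_on_cong: "(\<And>x. x \<in> S \<Longrightarrow> f x = g x) \<Longrightarrow> usc_on S f \<longleftrightarrow> usc_on S g"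
  unfolding usc_on_def by (metis (mono_tags, lifting) Collect_cong)

lemma usc_on_subset: "usc_on S f \<Longrightarrow> T \<subseteq> S \<Longrightarrow> usc_on T f"
proof (rule usc_onI)
  fix x a assume A: "usc_on S f" "T \<subseteq> S" "x \<in> T" "f x < a"
  then have "x \<in> S" by auto
  from usc_onE[OF A(1) this A(4)] obtain N
    where "open N" "x \<in> N" "\<And>y. y \<in> N \<Longrightarrow> y \<in> S \<Longrightarrow> f y < a" by metis
  with A(2) show "\<exists>N. open N \<and> x \<in> N \<and> (\<forall>y\<in>N \<inter> T. f y < a)" by (intro exI[of _ N]) auto
qed

lemma usc_on_compose:
  assumes f: "usc_on S f" and g: "continuous_on T g" and "g ` T \<subseteq> S"
  shows "usc_on T (\<lambda>x. f (g x))"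
proof (rule usc_onI)
  fix x a assume x: "x \<in> T" "f (g x) < a"
  then have "g x \<in> S" using assms by blast
  from usc_onE[OF f this x(2)]
  obtain N where N: "open N" "g x \<in> N" "\<And>y. y \<in> N \<Longrightarrow> y \<in> S \<Longrightarrow> f y < a" by blast
  from g N(1) obtain M where M: "open M" "M \<inter> T = g -` N \<inter> T"
    unfolding continuous_on_open_invariant by blast
  then show "\<exists>N. open N \<and> x \<in> N \<and> (\<forall>y\<in>N \<inter> T. f (g y) < a)"
    using N x assms by (intro exI[of _ M]) auto
qed

lemma usc_on_add_continuous:
  assumes f: "usc_on S f" and h: "continuous_on S h"
  shows "usc_on S (\<lambda>x. f x + ereal (h x))"
proof (rule usc_onI)
  fix x a assume x: "x \<in> S" "f x + ereal (h x) < a"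
  obtain r where r: "f x + ereal (h x) < ereal r" "ereal r < a" using ereal_dense2[OF x(2)] by blast
  obtain r' where r': "ereal r < ereal r'" "ereal r' < a" using ereal_dense2[OF r(2)] by blast
  have "f x < ereal (r - h x)" using r by (cases "f x") auto
  from usc_onE[OF f x(1) this]
  obtain N where N: "open N" "x \<in> N" "\<And>y. y \<in> N \<Longrightarrow> y \<in> S \<Longrightarrow> f y < ereal (r - h x)" by blast
  have o: "open {..<h x + (r' - r)}" by simp
  from h this obtain M where M: "open M" "M \<inter> S = h -` {..<h x + (r' - r)} \<inter> S"
    unfolding continuous_on_open_invariant by blast
  have "f y + ereal (h y) < a" if "y \<in> N \<inter> M \<inter> S" for y
  proof -
    have 1: "f y < ereal (r - h x)" using N that by blast
    have 2: "h y < h x + (r' - r)" using M that by blast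
    have "f y + ereal (h y) \<le> ereal (r - h x) + ereal (h y)" using 1 by (intro add_right_mono) auto
    also have "\<dots> \<le> ereal r'" using 2 by simp
    finally show ?thesis using r' by auto
  qed
  moreover have "x \<in> M" using M r' x by auto
  ultimately show "\<exists>N. open N \<and> x \<in> N \<and> (\<forall>y\<in>N \<inter> S. f y + ereal (h y) < a)"
    using N(1,2) M(1) by (intro exI[of _ "N \<inter> M"]) auto
qed

lemma usc_on_const: "usc_on S (\<lambda>x. a)"
  by (rule usc_onI) (use open_UNIV in blast)

lemma usc_on_continuous: "continuous_on S h \<Longrightarrow> usc_on S (\<lambda>x. ereal (h x))"
proof -
  assume "continuous_on S h"
  from usc_on_add_continuous[OF usc_on_const[of S 0] this] show ?thesis by simp
qed

lemma usc_on_INF: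
  assumes "\<And>i. i \<in> I \<Longrightarrow> usc_on S (f i)"
  shows "usc_on S (\<lambda>x. INF i\<in>I. f i x)"
proof (rule usc_onI)
  fix x a assume x: "x \<in> S" "(INF i\<in>I. f i x) < a"
  then obtain i where i: "i \<in> I" "f i x < a" by (auto simp: INF_less_iff)
  from usc_onE[OF assms[OF i(1)] x(1) i(2)]
  obtain N where "open N" "x \<in> N" "\<And>y. y \<in> N \<Longrightarrow> y \<in> S \<Longrightarrow> f i y < a" by blast
  then show "\<exists>N. open N \<and> x \<in> N \<and> (\<forall>y\<in>N \<inter> S. (INF i\<in>I. f i y) < a)"
    using i by (intro exI[of _ N]) (auto simp: INF_less_iff)
qed

lemma usc_on_max:
  assumes "usc_on S f" "usc_on S g"
  shows "usc_on S (\<lambda>x. max (f x) (g x))"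
proof (rule usc_onI)
  fix x a assume x: "x \<in> S" "max (f x) (g x) < a"
  obtain N where N: "open N" "x \<in> N" "\<And>y. y \<in> N \<Longrightarrow> y \<in> S \<Longrightarrow> f y < a"
    using usc_onE[OF assms(1) x(1), of a] x(2) by (metis max_less_iff_conj)
  obtain N' where N': "open N'" "x \<in> N'" "\<And>y. y \<in> N' \<Longrightarrow> y \<in> S \<Longrightarrow> g y < a"
    using usc_onE[OF assms(2) x(1), of a] x(2) by (metis max_less_iff_conj)
  show "\<exists>N. open N \<and> x \<in> N \<and> (\<forall>y\<in>N \<inter> S. max (f y) (g y) < a)"
    using N N' by (intro exI[of _ "N \<inter> N'"]) auto
qed

lemma usc_on_SUP_finite:
  assumes "finite K" "\<And>k. k \<in> K \<Longrightarrow> usc_on S (f k)"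
  shows "usc_on S (\<lambda>x. SUP k\<in>K. f k x)"
  using assms
proof (induction K)
  case empty
  show ?case by (simp add: usc_on_const)
next
  case (insert k K)
  have "usc_on S (\<lambda>x. max (f k x) (SUP k\<in>K. f k x))" using insert by (intro usc_on_max) auto
  then show ?case by (simp add: sup_max)
qed

text \<open>A supremum over a compact parameter space needs no regularisation: finitely many boxes cover
  the compact factor.\<close>

lemma usc_on_SUP_compact:
  assumes f: "usc_on (S \<times> K) f" and K: "compact K"
  shows "usc_on S (\<lambda>x. SUP k\<in>K. f (x, k))"
proof (rule usc_onI)
  fix x a assume x: "x \<in> S" "(SUP k\<in>K. f (x, k)) < a"
  obtain r where r: "(SUP k\<in>K. f (x, k)) < r" "r < a" using dense[OF x(2)] by blast
  have "\<exists>N M. open N \<and> open M \<and> x \<in> N \<and> k \<in> M \<and> (\<forall>p\<in>(N \<times> M) \<inter> (S \<times> K). f p < r)" if "k \<in> K" for k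
  proof -
    have "f (x,k) \<le> (SUP k\<in>K. f (x, k))" using that by (rule SUP_upper)
    then have *: "f (x,k) < r" using r(1) by simp
    from x that
    obtain B where B: "open B" "(x,k) \<in> B" "\<And>y. y \<in> B \<Longrightarrow> y \<in> S \<times> K \<Longrightarrow> f y < r"
      using usc_onE[OF f _ *] by (metis SigmaI)
    from open_prod_elim[OF B(1,2)] obtain N M where "open N" "open M" "(x,k) \<in> N \<times> M" "N \<times> M \<subseteq> B"
      by blast
    then show ?thesis using B by (intro exI[of _ N] exI[of _ M]) auto
  qed
  then obtain N M where NM: "\<And>k. k \<in> K \<Longrightarrow> open (N k) \<and> open (M k) \<and> x \<in> N k \<and> k \<in> M k
      \<and> (\<forall>p\<in>(N k \<times> M k) \<inter> (S \<times> K). f p < r)" by metis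
  obtain C where C: "C \<subseteq> K" "finite C" "K \<subseteq> (\<Union>c\<in>C. M c)"
    using compactE_image[OF K, of K M] NM by blast
  have "(SUP k\<in>K. f (y, k)) < a" if "y \<in> (\<Inter>c\<in>C. N c) \<inter> S" for y
  proof -
    have "f (y,k) \<le> r" if k: "k \<in> K" for k
    proof -
      obtain c where c: "c \<in> C" "k \<in> M c" using C k by blast
      then have "(y,k) \<in> (N c \<times> M c) \<inter> (S \<times> K)" using \<open>y \<in> _\<close> k by auto
      moreover have "c \<in> K" using c C by blast
      ultimately have "f (y,k) < r" using NM by blast
      then show ?thesis by simp
    qed
    then have "(SUP k\<in>K. f (y, k)) \<le> r" by (rule SUP_least)
    then show ?thesis using r by simp
  qed
  moreover have "open (\<Inter>c\<in>C. N c)" using C NM by (intro open_INT) auto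
  moreover have "x \<in> (\<Inter>c\<in>C. N c)" using C NM by auto
  ultimately show "\<exists>N. open N \<and> x \<in> N \<and> (\<forall>y\<in>N \<inter> S. (SUP k\<in>K. f (y, k)) < a)"
    by (intro exI[of _ "\<Inter>c\<in>C. N c"]) auto
qed

lemma usc_on_attains_sup:
  assumes f: "usc_on K f" and K: "compact K" "K \<noteq> {}"
  obtains k where "k \<in> K" "\<And>y. y \<in> K \<Longrightarrow> f y \<le> f k"
proof -
  have "\<exists>k\<in>K. \<forall>y\<in>K. f y \<le> f k"
  proof (rule ccontr)
    assume neg: "\<not> (\<exists>k\<in>K. \<forall>y\<in>K. f y \<le> f k)"
    then obtain y where y: "\<And>k. k \<in> K \<Longrightarrow> y k \<in> K \<and> f k < f (y k)" by (metis not_le)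
    have "\<exists>N. open N \<and> k \<in> N \<and> (\<forall>z\<in>N \<inter> K. f z < f (y k))" if "k \<in> K" for k
      using f y[OF that] that unfolding usc_on_iff by blast
    then obtain N where N: "\<And>k. k \<in> K \<Longrightarrow> open (N k) \<and> k \<in> N k \<and> (\<forall>z\<in>N k \<inter> K. f z < f (y k))"
      by metis
    obtain C where C: "C \<subseteq> K" "finite C" "K \<subseteq> (\<Union>c\<in>C. N c)"
      using compactE_image[OF K(1), of K N] N by blast
    have "C \<noteq> {}" using C K by auto
    define m where "m = Max ((f \<circ> y) ` C)"
    have "m \<in> (f \<circ> y) ` C" unfolding m_def using \<open>C \<noteq> {}\<close> C(2) by (intro Max_in) auto
    then obtain c where c: "c \<in> C" "m = f (y c)" by auto
    then have "y c \<in> K" using C y by blast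
    then obtain c' where c': "c' \<in> C" "y c \<in> N c'" using C by blast
    then have "f (y c) < f (y c')" using N C \<open>y c \<in> K\<close> by blast
    also have "\<dots> \<le> m" unfolding m_def using C(2) c' by (intro Max_ge) auto
    finally show False using c by simp
  qed
  then show ?thesis using that by blast
qed

lemma usc_on_bounded_above:
  assumes f: "usc_on K f" and K: "compact K" and fin: "\<And>x. x \<in> K \<Longrightarrow> f x \<noteq> \<infinity>"
  obtains M :: real where "M \<ge> 0" "\<And>x. x \<in> K \<Longrightarrow> f x \<le> ereal M"
proof (cases "K = {}")
  case True
  then show ?thesis using that[of 0] by auto
next
  case False
  obtain k where k: "k \<in> K" "\<And>y. y \<in> K \<Longrightarrow> f y \<le> f k" using usc_on_attains_sup[OF f K False] by blast
  have "f k \<le> ereal \<bar>real_of_ereal (f k)\<bar>" using fin[OF k(1)] by (cases "f k") auto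
  then show ?thesis using k that[of "\<bar>real_of_ereal (f k)\<bar>"] by (meson abs_ge_zero order_trans)
qed

lemma usc_on_measurable:
  fixes f :: "'a::topological_space \<Rightarrow> ereal"
  assumes f: "usc_on S f" and S: "S \<in> sets borel"
  shows "(\<lambda>x. if x \<in> S then f x else c) \<in> borel_measurable borel"
unfolding borel_measurable_ereal_iff_Iio
proof (rule allI)
  fix a
  have "openin (top_of_set S) {x \<in> S. f x < a}" using f by (simp add: usc_on_def)
  then obtain N where N: "open N" "{x \<in> S. f x < a} = S \<inter> N"
      unfolding openin_open by (elim exE conjE) (rule that)
  have "(\<lambda>x. if x \<in> S then f x else c) -` {..<a} \<inter> space borel
      = (S \<inter> N) \<union> (if c < a then - S else {})"
    unfolding N(2)[symmetric] by (auto split: if_splits)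
  also have "\<dots> \<in> sets borel" using N S by auto
  finally show "(\<lambda>x. if x \<in> S then f x else c) -` {..<a} \<inter> space borel \<in> sets borel" .
qed

lemma usc_on_UNIV_measurable: "usc_on UNIV f \<Longrightarrow> f \<in> borel_measurable borel"
  using usc_on_measurable[of UNIV f] by simp

section \<open>Upper semicontinuous regularisation\<close>

lemma le_usc_reg:
  assumes "\<And>N. open N \<Longrightarrow> x \<in> N \<Longrightarrow> \<exists>y\<in>N \<inter> S. a \<le> f y"
  shows "a \<le> usc_reg S f x"
  unfolding usc_reg_def Limsup_def
proof (rule INF_greatest)
  fix P assume "P \<in> {P. eventually P (inf (nhds x) (principal S))}"
  then obtain N where N: "open N" "x \<in> N" "\<And>y. y \<in> N \<Longrightarrow> y \<in> S \<Longrightarrow> P y"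
    unfolding eventually_inf_principal eventually_nhds by auto
  obtain y where "y \<in> N \<inter> S" "a \<le> f y" using assms[OF N(1,2)] by auto
  then show "a \<le> Sup (f ` Collect P)" using N(3) by (intro SUP_upper2[of y]) auto
qed

lemma usc_reg_lessE:
  assumes "usc_reg S f x < a"
  obtains N where "open N" "x \<in> N" "\<And>y. y \<in> N \<Longrightarrow> y \<in> S \<Longrightarrow> f y < a"
proof -
  from assms obtain P where P: "eventually P (inf (nhds x) (principal S))" "(SUP y\<in>Collect P. f y) < a"
    unfolding usc_reg_def Limsup_def by (auto simp: INF_less_iff)
  obtain N where N: "open N" "x \<in> N" "\<And>y. y \<in> N \<Longrightarrow> y \<in> S \<Longrightarrow> P y"
    using P(1) unfolding eventually_inf_principal eventually_nhds by auto
  have "f y < a" if "y \<in> N" "y \<in> S" for y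
  proof -
    have "f y \<le> (SUP y\<in>Collect P. f y)" using N(3)[OF that] by (intro SUP_upper) auto
    then show ?thesis using P(2) by simp
  qed
  then show ?thesis using that N(1,2) by blast
qed

lemma usc_reg_bounded:
  assumes N: "open N" "x \<in> N" and le: "\<And>y. y \<in> N \<Longrightarrow> y \<in> S \<Longrightarrow> f y \<le> b"
  shows "usc_reg S f x \<le> b"
proof -
  have "eventually (\<lambda>y. f y \<le> b) (inf (nhds x) (principal S))"
    unfolding eventually_inf_principal eventually_nhds using N le by (intro exI[of _ N]) auto
  then show ?thesis unfolding usc_reg_def by (rule Limsup_bounded)
qed

lemma usc_reg_ge: "x \<in> S \<Longrightarrow> f x \<le> usc_reg S f x"
  by (rule le_usc_reg) auto

lemma usc_reg_least:
  assumes x: "x \<in> S" and h: "usc_on S h" and le: "\<And>y. y \<in> S \<Longrightarrow> f y \<le> h y"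
  shows "usc_reg S f x \<le> h x"
proof (rule dense_ge)
  fix a assume "h x < a"
  then obtain N where N: "open N" "x \<in> N" "\<And>y. y \<in> N \<Longrightarrow> y \<in> S \<Longrightarrow> h y < a"
    using usc_onE[OF h x] by metis
  show "usc_reg S f x \<le> a"
    by (rule usc_reg_bounded[OF N(1,2)]) (meson N(3) le order_trans less_imp_le)
qed

lemma usc_on_usc_reg: "usc_on S (usc_reg S f)"
proof (rule usc_onI)
  fix x a assume "x \<in> S" "usc_reg S f x < a"
  then obtain b where b: "usc_reg S f x < b" "b < a" using dense by blast
  obtain N where N: "open N" "x \<in> N" "\<And>y. y \<in> N \<Longrightarrow> y \<in> S \<Longrightarrow> f y < b"
    using usc_reg_lessE[OF b(1)] by metis
  have "usc_reg S f z < a" if "z \<in> N \<inter> S" for z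
  proof -
    have "usc_reg S f z \<le> b"
      by (rule usc_reg_bounded[OF N(1)]) (use that N(3) less_imp_le in auto)
    then show ?thesis using b by simp
  qed
  then show "\<exists>N. open N \<and> x \<in> N \<and> (\<forall>y\<in>N \<inter> S. usc_reg S f y < a)" using N(1,2) by blast
qed

section \<open>Circle means\<close>

lemma bounded_linear_scaleC_left: "bounded_linear (\<lambda>a. a *\<^sub>C v)"
proof
  show "(a + b) *\<^sub>C v = a *\<^sub>C v + b *\<^sub>C v" for a b by (rule scaleC_add_left)
  show "(r *\<^sub>R a) *\<^sub>C v = r *\<^sub>R a *\<^sub>C v" for r a
    by (metis scaleC_of_real scaleC_scaleC scaleR_conv_of_real)
  show "\<exists>K. \<forall>a. norm (a *\<^sub>C v) \<le> norm a * K" by (auto simp: norm_scaleC)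
qed

lemma bounded_linear_scaleC_right: "bounded_linear (\<lambda>v::'a::complex_normed. a *\<^sub>C v)"
proof
  show "a *\<^sub>C (v + w) = a *\<^sub>C v + a *\<^sub>C w" for v w :: 'a by (rule scaleC_add_right)
  show "a *\<^sub>C r *\<^sub>R v = r *\<^sub>R a *\<^sub>C v" for r and v :: 'a
    by (metis scaleC_of_real scaleC_scaleC mult.commute)
  show "\<exists>K. \<forall>v::'a. norm (a *\<^sub>C v) \<le> norm v * K"
    by (intro exI[of _ "cmod a"]) (simp add: norm_scaleC mult.commute)
qed

lemma scaleC_zero_left [simp]: "0 *\<^sub>C v = 0"
  using bounded_linear_scaleC_left[of v] by (rule linear_simps(3))

lemma scaleC_one [simp]: "1 *\<^sub>C v = v"
  using scaleC_of_real[of 1 v] by simp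

lemma continuous_on_scaleC_left [continuous_intros]:
  "continuous_on S a \<Longrightarrow> continuous_on S (\<lambda>x. a x *\<^sub>C v)"
  by (rule bounded_linear.continuous_on[OF bounded_linear_scaleC_left])

text \<open>Subtracting from an upper bound turns the difference of two integrals, one of which may be
  infinite, into a single integral of a nonnegative function. Additivity and monotone convergence are
  applied in this form.\<close>

lemma circle_mean_eq_diff:
  fixes M :: real
  assumes meas: "(\<lambda>\<theta>. f (z + cis (2 * pi * \<theta>) *\<^sub>C v)) \<in> borel_measurable borel"
    and le: "\<And>\<theta>. f (z + cis (2 * pi * \<theta>) *\<^sub>C v) \<le> ereal M" and M: "M \<ge> 0"
  shows "circle_mean f z v = ereal M
    - enn2ereal (\<integral>\<^sup>+\<theta>\<in>{0..1}. e2ennreal (ereal M - f (z + cis (2 * pi * \<theta>) *\<^sub>C v)) \<partial>lborel)"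
proof -
  define g where "g = (\<lambda>\<theta>::real. f (z + cis (2 * pi * \<theta>) *\<^sub>C v))"
  have [measurable]: "g \<in> borel_measurable borel" using meas by (simp add: g_def)
  have gM: "g \<theta> \<le> ereal M" for \<theta> using le by (simp add: g_def)
  define P where "P = (\<integral>\<^sup>+\<theta>\<in>{0..1}. e2ennreal (g \<theta>) \<partial>lborel)"
  define N where "N = (\<integral>\<^sup>+\<theta>\<in>{0..1}. e2ennreal (- g \<theta>) \<partial>lborel)"
  define K where "K = (\<integral>\<^sup>+\<theta>\<in>{0..1}. e2ennreal (ereal M - g \<theta>) \<partial>lborel)"
  have M1: "(\<integral>\<^sup>+\<theta>\<in>{0..1::real}. ennreal M \<partial>lborel) = ennreal M"
    by (simp add: nn_integral_cmult)
  have pt: "e2ennreal (ereal M - g \<theta>) + e2ennreal (g \<theta>) = ennreal M + e2ennreal (- g \<theta>)" for \<theta>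
  proof (cases "g \<theta>")
    case (real r)
    have "r \<le> M" using gM[of \<theta>] real by simp
    then have "e2ennreal (ereal M - g \<theta>) = ennreal (M - r)"
      using real by (simp add: ennreal.rep_eq e2ennreal_ereal)
    moreover have "e2ennreal (g \<theta>) = ennreal (max 0 r)" using real
      by (simp add: e2ennreal_ereal max_def ennreal_neg)
    moreover have "e2ennreal (- g \<theta>) = ennreal (max 0 (- r))" using real
      by (simp add: e2ennreal_ereal max_def ennreal_neg)
    ultimately show ?thesis using \<open>r \<le> M\<close> M by (simp flip: ennreal_plus)
  next
    case PInf then show ?thesis using gM[of \<theta>] by simp
  next
    case MInf then show ?thesis by (simp add: e2ennreal_infty e2ennreal_neg)
  qed
  have "K + P = (\<integral>\<^sup>+\<theta>\<in>{0..1}. (e2ennreal (ereal M - g \<theta>) + e2ennreal (g \<theta>)) \<partial>lborel)"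
    unfolding K_def P_def by (subst nn_integral_add[symmetric]) (auto simp: distrib_right)
  also have "\<dots> = (\<integral>\<^sup>+\<theta>\<in>{0..1}. (ennreal M + e2ennreal (- g \<theta>)) \<partial>lborel)" unfolding pt ..
  also have "\<dots> = ennreal M + N" unfolding N_def
    by (simp only: distrib_right) (subst nn_integral_add, auto simp: M1)
  finally have eq: "K + P = ennreal M + N" .
  have "P \<le> (\<integral>\<^sup>+\<theta>\<in>{0..1::real}. ennreal M \<partial>lborel)" unfolding P_def
    by (intro nn_integral_mono mult_right_mono)
       (use gM e2ennreal_mono[OF gM] in \<open>auto simp: e2ennreal_ereal\<close>)
  then have "P \<le> ennreal M" by (simp only: M1)
  then obtain p where p: "P = ennreal p" "p \<ge> 0" by (metis ennreal_cases ennreal_neq_top top.extremum_uniqueI)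
  have "enn2ereal P - enn2ereal N = ereal M - enn2ereal K"
  proof (cases K)
    case (real k)
    then obtain n where n: "N = ennreal n" "n \<ge> 0" using eq p
      by (metis ennreal_add_eq_top ennreal_cases ennreal_neq_top)
    have "k + p = M + n" using eq real p n M by (simp flip: ennreal_plus)
    then show ?thesis using real p n by (simp add: enn2ereal_ennreal)
  next
    case top
    then have "N = top" using eq by (metis ennreal_add_eq_top ennreal_neq_top)
    then show ?thesis using top p by (simp add: enn2ereal_ennreal)
  qed
  then show ?thesis unfolding circle_mean_def P_def N_def K_def g_def .
qed

lemma nn_integral_unit_interval:
  fixes k :: "real \<Rightarrow> real"
  assumes k: "\<And>\<theta>. 0 \<le> k \<theta>" "(k has_integral I) {0..1}"
  shows "(\<integral>\<^sup>+\<theta>\<in>{0..1}. ennreal (k \<theta>) \<partial>lborel) = ennreal I"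
proof -
  have "ennreal (indicator {0..1} \<theta> * k \<theta>) = ennreal (k \<theta>) * indicator {0..1} \<theta>" for \<theta> :: real
    by (simp add: indicator_def)
  then show ?thesis using nn_integral_has_integral_lebesgue[OF k] by simp
qed

lemma circle_mean_le_integral:
  assumes meas: "(\<lambda>\<theta>. f (z + cis (2 * pi * \<theta>) *\<^sub>C v)) \<in> borel_measurable borel"
    and le: "\<And>\<theta>. f (z + cis (2 * pi * \<theta>) *\<^sub>C v) \<le> ereal (h \<theta>)"
    and hM: "\<And>\<theta>. h \<theta> \<le> M" and h: "(h has_integral I) {0..1}"
  shows "circle_mean f z v \<le> ereal I"
proof -
  define B where "B = max M 0"
  have hB: "h \<theta> \<le> B" for \<theta> using hM[of \<theta>] by (simp add: B_def)
  have "((\<lambda>\<theta>. B - h \<theta>) has_integral (B - I)) {0..1}"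
    using has_integral_diff[OF has_integral_const_real[of B 0 1] h] by simp
  from nn_integral_unit_interval[OF _ this]
  have "(\<integral>\<^sup>+\<theta>\<in>{0..1}. ennreal (B - h \<theta>) \<partial>lborel) = ennreal (B - I)" using hB by simp
  moreover have "(\<integral>\<^sup>+\<theta>\<in>{0..1}. ennreal (B - h \<theta>) \<partial>lborel)
     \<le> (\<integral>\<^sup>+\<theta>\<in>{0..1}. e2ennreal (ereal B - f (z + cis (2 * pi * \<theta>) *\<^sub>C v)) \<partial>lborel)"
  proof (intro nn_integral_mono mult_right_mono)
    fix \<theta> :: real
    have "ereal (B - h \<theta>) \<le> ereal B - f (z + cis (2 * pi * \<theta>) *\<^sub>C v)"
      using le[of \<theta>] by (cases "f (z + cis (2 * pi * \<theta>) *\<^sub>C v)") auto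
    then show "ennreal (B - h \<theta>) \<le> e2ennreal (ereal B - f (z + cis (2 * pi * \<theta>) *\<^sub>C v))"
      by (metis e2ennreal_ereal e2ennreal_mono)
  qed simp
  ultimately have le2: "ennreal (B - I) \<le> (\<integral>\<^sup>+\<theta>\<in>{0..1}. e2ennreal (ereal B - f (z + cis (2 * pi * \<theta>) *\<^sub>C v)) \<partial>lborel)"
    (is "_ \<le> ?K") by simp
  have "ereal (B - I) \<le> enn2ereal ?K"
  proof -
    have "ereal (B - I) \<le> enn2ereal (ennreal (B - I))" by (simp add: ennreal.rep_eq)
    also have "\<dots> \<le> enn2ereal ?K" using le2 by (simp add: less_eq_ennreal.rep_eq)
    finally show ?thesis .
  qed
  moreover have "circle_mean f z v = ereal B - enn2ereal ?K"
  proof (rule circle_mean_eq_diff[OF meas])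
    show "f (z + cis (2 * pi * \<theta>) *\<^sub>C v) \<le> ereal B" for \<theta>
      using le[of \<theta>] hB[of \<theta>] by (meson ereal_less_eq(3) order_trans)
  qed (simp add: B_def)
  ultimately show ?thesis by (cases "enn2ereal ?K") auto
qed

text \<open>Cauchy's integral formula at the centre of the unit circle.\<close>

lemma holomorphic_circle_mean:
  assumes "H holomorphic_on S" "open S" "cball 0 1 \<subseteq> S"
  shows "((\<lambda>\<theta>. H (cis (2 * pi * \<theta>))) has_integral H 0) {0..1}"
proof -
  have "H holomorphic_on cball 0 1" using assms holomorphic_on_subset by blast
  from Cauchy_integral_circlepath_simple[OF this, of 0]
  have "((\<lambda>u. H u / u) has_contour_integral (2 * of_real pi * \<i> * H 0)) (circlepath 0 1)" by simp
  then have I: "((\<lambda>x. (2 * of_real pi * \<i>) * H (exp (2 * of_real pi * \<i> * of_real x))) has_integral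
      (2 * of_real pi * \<i> * H 0)) {0..1}"
    unfolding has_contour_integral_def
  proof (rule has_integral_eq[rotated])
    fix x :: real assume "x \<in> {0..1}"
    then have "vector_derivative (circlepath 0 1) (at x within {0..1})
        = 2 * of_real pi * \<i> * exp (2 * of_real pi * \<i> * of_real x)"
      by (simp add: vector_derivative_circlepath01)
    then show "H (circlepath 0 1 x) / circlepath 0 1 x * vector_derivative (circlepath 0 1) (at x within {0..1})
        = 2 * of_real pi * \<i> * H (exp (2 * of_real pi * \<i> * of_real x))"
      by (simp only:) (simp add: circlepath)
  qed
  define c where "c = 2 * complex_of_real pi * \<i>"
  have "((\<lambda>x. inverse c * (c * H (exp (c * of_real x)))) has_integral inverse c * (c * H 0)) {0..1}"
    using I unfolding c_def[symmetric] by (rule has_integral_mult_right)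
  moreover have "inverse c * (c * y) = y" for y
  proof -
    have "c \<noteq> 0" by (simp add: c_def)
    then show ?thesis by simp
  qed
  moreover have "exp (c * of_real x) = cis (2 * pi * x)" for x :: real
    by (simp add: cis_conv_exp mult_ac c_def)
  ultimately show ?thesis by simp
qed

lemma Re_holomorphic_circle_mean:
  assumes "H holomorphic_on S" "open S" "cball 0 1 \<subseteq> S"
  shows "((\<lambda>\<theta>. Re (H (cis (2 * pi * \<theta>)))) has_integral Re (H 0)) {0..1}"
  using has_integral_linear[OF holomorphic_circle_mean[OF assms] bounded_linear_Re] by (simp add: o_def)

lemma Re_holomorphic_bounded:
  assumes H: "H holomorphic_on S" "cball 0 1 \<subseteq> S"
  obtains M where "\<And>\<zeta>. \<zeta> \<in> cball 0 1 \<Longrightarrow> \<bar>Re (H \<zeta>)\<bar> \<le> M"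
proof -
  have "continuous_on (cball 0 1) (\<lambda>\<zeta>. Re (H \<zeta>))"
    using H by (intro continuous_intros holomorphic_on_imp_continuous_on) (auto dest: holomorphic_on_subset)
  from compact_imp_bounded[OF compact_continuous_image[OF this compact_cball]]
  obtain M where "\<And>\<zeta>. \<zeta> \<in> cball 0 1 \<Longrightarrow> \<bar>Re (H \<zeta>)\<bar> \<le> M"
    unfolding bounded_iff by (metis image_eqI real_norm_def)
  then show ?thesis using that by blast
qed

lemma continuous_cis: "continuous_on S (\<lambda>\<theta>::real. cis (2 * pi * \<theta>))"
  by (intro continuous_intros)

lemma usc_circle_measurable:
  assumes "usc_on U f" "\<And>\<zeta>. cmod \<zeta> = 1 \<Longrightarrow> z + \<zeta> *\<^sub>C v \<in> U"
  shows "(\<lambda>\<theta>. f (z + cis (2 * pi * \<theta>) *\<^sub>C v)) \<in> borel_measurable borel"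
proof (rule usc_on_UNIV_measurable, rule usc_on_compose[OF assms(1)])
  show "continuous_on UNIV (\<lambda>x. z + cis (2 * pi * x) *\<^sub>C v)"
    by (intro continuous_intros continuous_cis)
qed (use assms(2) in auto)

text \<open>For a harmonic majorant the mean over the circle is the value at the centre. Every majorant to
  which the submean property is applied below has this form, so integrals do not appear again.\<close>

lemma usc_circle_mean_le_Re_holomorphic:
  assumes usc: "usc_on U f" and U: "\<And>\<zeta>. cmod \<zeta> = 1 \<Longrightarrow> z + \<zeta> *\<^sub>C v \<in> U"
    and H: "H holomorphic_on S" "open S" "cball 0 1 \<subseteq> S"
    and le: "\<And>\<zeta>. cmod \<zeta> = 1 \<Longrightarrow> f (z + \<zeta> *\<^sub>C v) \<le> ereal (Re (H \<zeta>))"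
  shows "circle_mean f z v \<le> ereal (Re (H 0))"
proof -
  obtain M where M: "\<And>\<zeta>. \<zeta> \<in> cball 0 1 \<Longrightarrow> \<bar>Re (H \<zeta>)\<bar> \<le> M"
    using Re_holomorphic_bounded[OF H(1,3)] by metis
  show ?thesis
  proof (rule circle_mean_le_integral[OF usc_circle_measurable[OF usc U]])
    show "((\<lambda>\<theta>. Re (H (cis (2 * pi * \<theta>)))) has_integral Re (H 0)) {0..1}"
      by (rule Re_holomorphic_circle_mean[OF H])
    show "Re (H (cis (2 * pi * \<theta>))) \<le> M" for \<theta> using M[of "cis (2 * pi * \<theta>)"] by auto
  qed (use le in auto)
qed

lemma psh_le_Re_holomorphic:
  assumes psh: "psh_on f U" and U: "\<And>\<zeta>. cmod \<zeta> \<le> 1 \<Longrightarrow> z + \<zeta> *\<^sub>C v \<in> U"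
    and H: "H holomorphic_on S" "open S" "cball 0 1 \<subseteq> S"
    and le: "\<And>\<zeta>. cmod \<zeta> = 1 \<Longrightarrow> f (z + \<zeta> *\<^sub>C v) \<le> ereal (Re (H \<zeta>))"
  shows "f z \<le> ereal (Re (H 0))"
proof -
  have "f z \<le> circle_mean f z v" using psh U unfolding psh_on_def by auto
  also have "\<dots> \<le> ereal (Re (H 0))"
    using psh by (intro usc_circle_mean_le_Re_holomorphic[of U, OF _ U H le]) (auto simp: psh_on_def)
  finally show ?thesis .
qed

text \<open>The bound \<open>M\<close> of \<open>f\<close> and the bound \<open>B\<close> of the harmonic summand are added, so that both sides
  become differences with finite minuend.\<close>

lemma circle_mean_add_Re_holomorphic:
  assumes usc: "usc_on U f" and fin: "\<And>z. z \<in> U \<Longrightarrow> f z \<noteq> \<infinity>"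
    and U: "\<And>\<zeta>. cmod \<zeta> = 1 \<Longrightarrow> z + \<zeta> *\<^sub>C v \<in> U"
    and H: "H holomorphic_on S" "open S" "cball 0 1 \<subseteq> S"
    and k: "\<And>\<zeta>. cmod \<zeta> = 1 \<Longrightarrow> k (z + \<zeta> *\<^sub>C v) = Re (H \<zeta>)"
  shows "circle_mean (\<lambda>p. f p + ereal (k p)) z v = circle_mean f z v + ereal (Re (H 0))"
proof -
  have cont: "continuous_on (cball 0 1) (\<lambda>\<zeta>. Re (H \<zeta>))"
    using H by (intro continuous_intros holomorphic_on_imp_continuous_on) (auto dest: holomorphic_on_subset)
  obtain B0 where B0: "\<And>\<zeta>. \<zeta> \<in> cball 0 1 \<Longrightarrow> \<bar>Re (H \<zeta>)\<bar> \<le> B0"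
    using Re_holomorphic_bounded[OF H(1,3)] by metis
  define B where "B = max B0 0"
  have usc1: "usc_on (sphere 0 1) (\<lambda>\<zeta>. f (z + \<zeta> *\<^sub>C v))"
    by (rule usc_on_compose[OF usc]) (use U in \<open>auto intro!: continuous_intros\<close>)
  obtain M where M: "M \<ge> 0" "\<And>\<zeta>. \<zeta> \<in> sphere 0 1 \<Longrightarrow> f (z + \<zeta> *\<^sub>C v) \<le> ereal M"
    using usc_on_bounded_above[OF usc1 compact_sphere] fin U by (metis dist_0_norm mem_sphere)
  define g where "g = (\<lambda>\<theta>::real. f (z + cis (2 * pi * \<theta>) *\<^sub>C v))"
  define h where "h = (\<lambda>\<theta>::real. Re (H (cis (2 * pi * \<theta>))))"
  have gm [measurable]: "g \<in> borel_measurable borel"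
    unfolding g_def by (rule usc_circle_measurable[OF usc U])
  have "continuous_on UNIV h" unfolding h_def
    by (rule continuous_on_compose2[OF cont continuous_cis]) auto
  then have hm [measurable]: "h \<in> borel_measurable borel" by (rule borel_measurable_continuous_onI)
  have hB: "\<bar>h \<theta>\<bar> \<le> B" for \<theta> using B0[of "cis (2 * pi * \<theta>)"] by (simp add: h_def B_def)
  have gM: "g \<theta> \<le> ereal M" for \<theta> using M by (simp add: g_def)
  have kh: "k (z + cis (2 * pi * \<theta>) *\<^sub>C v) = h \<theta>" for \<theta> using k by (simp add: h_def)
  have gh: "g \<theta> + ereal (h \<theta>) \<le> ereal (M + B)" for \<theta>
    using gM[of \<theta>] hB[of \<theta>] by (cases "g \<theta>") auto
  have 1: "circle_mean f z v = ereal M - enn2ereal (\<integral>\<^sup>+\<theta>\<in>{0..1}. e2ennreal (ereal M - g \<theta>) \<partial>lborel)"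
    (is "_ = _ - enn2ereal ?K")
    unfolding g_def by (rule circle_mean_eq_diff) (use gm gM M in \<open>auto simp: g_def\<close>)
  have 2: "circle_mean (\<lambda>p. f p + ereal (k p)) z v = ereal (M + B)
     - enn2ereal (\<integral>\<^sup>+\<theta>\<in>{0..1}. e2ennreal (ereal (M + B) - (g \<theta> + ereal (h \<theta>))) \<partial>lborel)"
    (is "_ = _ - enn2ereal ?L")
    unfolding g_def kh[symmetric]
  proof (rule circle_mean_eq_diff)
    show "(\<lambda>\<theta>. f (z + cis (2 * pi * \<theta>) *\<^sub>C v) + ereal (k (z + cis (2 * pi * \<theta>) *\<^sub>C v))) \<in> borel_measurable borel"
      unfolding kh g_def[symmetric] using gm hm unfolding g_def by measurable
    show "f (z + cis (2 * pi * \<theta>) *\<^sub>C v) + ereal (k (z + cis (2 * pi * \<theta>) *\<^sub>C v)) \<le> ereal (M + B)" for \<theta>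
      using gh[of \<theta>] unfolding kh g_def .
  qed (use M B_def in auto)
  have pt: "e2ennreal (ereal (M + B) - (g \<theta> + ereal (h \<theta>))) = e2ennreal (ereal M - g \<theta>) + ennreal (B - h \<theta>)" for \<theta>
    using gM[of \<theta>] hB[of \<theta>] by (cases "g \<theta>") (auto simp: e2ennreal_ereal simp flip: ennreal_plus)
  have hI: "((\<lambda>\<theta>. B - h \<theta>) has_integral (B - Re (H 0))) {0..1}"
    using has_integral_diff[OF has_integral_const_real[of B 0 1] Re_holomorphic_circle_mean[OF H]]
    by (simp add: h_def)
  have BI: "B - Re (H 0) \<ge> 0" using B0[of 0] by (auto simp: B_def)
  have hI2: "(\<integral>\<^sup>+\<theta>\<in>{0..1}. ennreal (B - h \<theta>) \<partial>lborel) = ennreal (B - Re (H 0))"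
    by (rule nn_integral_unit_interval[OF _ hI]) (use hB in \<open>simp add: abs_le_iff\<close>)
  have "?L = ?K + ennreal (B - Re (H 0))"
    unfolding pt distrib_right hI2[symmetric] by (rule nn_integral_add) measurable
  then have "enn2ereal ?L = enn2ereal ?K + ereal (B - Re (H 0))"
    using BI by (simp add: plus_ennreal.rep_eq enn2ereal_ennreal)
  then show ?thesis unfolding 1 2 by (cases "enn2ereal ?K") (auto simp: enn2ereal_nonneg)
qed

lemma psh_on_cong:
  assumes eq: "\<And>p. p \<in> U \<Longrightarrow> f p = h p"
  shows "psh_on f U \<longleftrightarrow> psh_on h U"
proof -
  have "circle_mean f z v = circle_mean h z v" if "\<forall>\<zeta>\<in>cball 0 1. z + \<zeta> *\<^sub>C v \<in> U" for z v
  proof -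
    have "f (z + cis (2 * pi * \<theta>) *\<^sub>C v) = h (z + cis (2 * pi * \<theta>) *\<^sub>C v)" for \<theta>
      by (rule eq) (use that in auto)
    then show ?thesis by (simp add: circle_mean_def)
  qed
  moreover have "f z = h z" if "\<forall>\<zeta>\<in>cball 0 1. z + \<zeta> *\<^sub>C v \<in> U" for z v
    using bspec[OF that, of 0] by (simp add: eq)
  ultimately have "f z \<le> circle_mean f z v \<longleftrightarrow> h z \<le> circle_mean h z v"
    if "\<forall>\<zeta>\<in>cball 0 1. z + \<zeta> *\<^sub>C v \<in> U" for z v using that by simp
  then show ?thesis unfolding psh_on_def using usc_on_cong[of U f h, OF eq] eq by auto
qed

section \<open>Harmonic majorants characterise circle means\<close>

text \<open>The approximations are the Lipschitz envelopes \<open>sup\<^sub>y (f y - n d(x,y))\<close>, where \<open>f\<close> is first cut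
  off below at \<open>-n\<close> to make them real.\<close>

lemma usc_approx_from_above:
  fixes f :: "'a::metric_space \<Rightarrow> ereal"
  assumes f: "usc_on K f" and K: "K \<noteq> {}" and M: "\<And>x. x \<in> K \<Longrightarrow> f x \<le> ereal M"
  obtains h :: "nat \<Rightarrow> 'a \<Rightarrow> real" where
    "\<And>n. continuous_on K (h n)" "\<And>n x. x \<in> K \<Longrightarrow> f x \<le> ereal (h n x)"
    "\<And>m n x. x \<in> K \<Longrightarrow> m \<le> n \<Longrightarrow> h n x \<le> h m x" "\<And>n x. x \<in> K \<Longrightarrow> h n x \<le> max M 0"
    "\<And>x a. x \<in> K \<Longrightarrow> f x < ereal a \<Longrightarrow> \<exists>n. h n x \<le> a"
proof -
  define B where "B = max M 0"
  define F where "F = (\<lambda>n y. real_of_ereal (max (f y) (- ereal (real n))))"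
  have FB: "F n y \<le> B" if "y \<in> K" for n y
    using M[OF that] by (cases "f y") (auto simp: F_def B_def max_def split: if_splits)
  have Ff: "f y \<le> ereal (F n y)" if "y \<in> K" for n y
    using M[OF that] by (cases "f y") (auto simp: F_def max_def)
  have Fmono: "F n y \<le> F m y" if "y \<in> K" "m \<le> n" for m n y
    using M[OF that(1)] that(2) by (cases "f y") (auto simp: F_def max_def)
  have Fa: "F n y \<le> a" if "y \<in> K" "f y < ereal a" "- real n \<le> a" for n y a
    using M[OF that(1)] that by (cases "f y") (auto simp: F_def max_def)
  define h where "h = (\<lambda>n x. SUP y\<in>K. F n y - real n * dist x y)"
  have le: "F n y - real n * dist x y \<le> B" if "y \<in> K" for n x y
    using FB[OF that, of n] by (smt (verit) mult_nonneg_nonneg of_nat_0_le_iff zero_le_dist)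
  then have bdd: "bdd_above ((\<lambda>y. F n y - real n * dist x y) ` K)" for n x by (intro bdd_aboveI2)
  have lip: "h n x \<le> h n x' + real n * dist x x'" for n x x'
    unfolding h_def
  proof (rule cSUP_least[OF K])
    fix y assume y: "y \<in> K"
    have "real n * dist x' y \<le> real n * (dist x y + dist x x')"
      by (intro mult_left_mono) (metis add.commute dist_commute dist_triangle, simp)
    then have "F n y - real n * dist x y \<le> (F n y - real n * dist x' y) + real n * dist x x'"
      by (simp add: distrib_left)
    also have "F n y - real n * dist x' y \<le> (SUP y\<in>K. F n y - real n * dist x' y)"
      by (rule cSUP_upper[OF y bdd])
    finally show "F n y - real n * dist x y \<le> (SUP y\<in>K. F n y - real n * dist x' y) + real n * dist x x'"
      by simp
  qed
  show ?thesis
  proof (rule that[of h])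
    fix n
    have "(real n)-lipschitz_on K (h n)"
    proof (rule lipschitz_onI)
      fix x y
      show "dist (h n x) (h n y) \<le> real n * dist x y"
        using lip[of n x y] lip[of n y x] by (simp add: dist_real_def dist_commute abs_le_iff)
    qed simp
    then show "continuous_on K (h n)" by (rule lipschitz_on_continuous_on)
  next
    fix n x assume x: "x \<in> K"
    have "F n x - real n * dist x x \<le> h n x" unfolding h_def by (rule cSUP_upper[OF x bdd])
    then show "f x \<le> ereal (h n x)" using Ff[OF x, of n] by (simp add: order_trans)
  next
    fix m n x assume x: "x \<in> K" and mn: "m \<le> (n::nat)"
    show "h n x \<le> h m x" unfolding h_def
    proof (rule cSUP_mono[OF K bdd])
      fix y assume y: "y \<in> K"
      have "real m * dist x y \<le> real n * dist x y" using mn by (intro mult_right_mono) auto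
      then show "\<exists>z\<in>K. F n y - real n * dist x y \<le> F m z - real m * dist x z"
        using Fmono[OF y mn] y by (intro bexI[of _ y]) auto
    qed
  next
    fix n x show "h n x \<le> max M 0" unfolding h_def B_def[symmetric] by (rule cSUP_least[OF K le])
  next
    fix x a assume x: "x \<in> K" "f x < ereal a"
    from usc_onE[OF f this] obtain N where N: "open N" "x \<in> N" "\<And>y. y \<in> N \<Longrightarrow> y \<in> K \<Longrightarrow> f y < ereal a"
      by metis
    obtain r where r: "r > 0" "ball x r \<subseteq> N" using N(1,2) open_contains_ball by blast
    obtain n where n: "real n \<ge> max (- a) ((B - a) / r)" using real_arch_simple by blast
    have "h n x \<le> a" unfolding h_def
    proof (rule cSUP_least[OF K])
      fix y assume y: "y \<in> K"
      show "F n y - real n * dist x y \<le> a"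
      proof (cases "dist x y < r")
        case True
        then have "f y < ereal a" using N r y by auto
        then have "F n y \<le> a" using Fa[OF y] n by auto
        then show ?thesis by (smt (verit) mult_nonneg_nonneg of_nat_0_le_iff zero_le_dist)
      next
        case False
        have "B - a \<le> real n * r" using n r by (simp add: pos_divide_le_eq)
        also have "\<dots> \<le> real n * dist x y" using False by (intro mult_left_mono) auto
        finally show ?thesis using FB[OF y, of n] by simp
      qed
    qed
    then show "\<exists>n. h n x \<le> a" ..
  qed
qed

text \<open>The Stone-Weierstrass theorem applies because real parts of polynomials are closed under
  multiplication on the circle: \<open>Re P \<cdot> Re Q\<close> is one half of \<open>Re (P Q) + Re (P cnj Q)\<close>.\<close>

lemma Re_poly_dense_on_circle:
  fixes g :: "complex \<Rightarrow> real"
  assumes "continuous_on (sphere 0 1) g" "e > 0"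
  obtains p :: "complex poly" where "\<And>\<zeta>. cmod \<zeta> = 1 \<Longrightarrow> \<bar>g \<zeta> - Re (poly p \<zeta>)\<bar> < e"
proof -
  define P where "P = (\<lambda>f::complex \<Rightarrow> real. \<exists>p. \<forall>\<zeta>\<in>sphere 0 1. f \<zeta> = Re (poly p \<zeta>))"
  have P_add: "P (\<lambda>x. f x + g x)" if fg: "P f" "P g" for f g
  proof -
    obtain p q where "\<forall>\<zeta>\<in>sphere 0 1. f \<zeta> = Re (poly p \<zeta>)" "\<forall>\<zeta>\<in>sphere 0 1. g \<zeta> = Re (poly q \<zeta>)"
      using fg unfolding P_def by blast
    then show ?thesis unfolding P_def by (intro exI[of _ "p + q"]) simp
  qed
  have P_const: "P (\<lambda>x. c)" for c unfolding P_def by (intro exI[of _ "[:of_real c:]"]) simp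
  have P_sum: "P (\<lambda>x. \<Sum>i\<in>I. f i x)" if "finite I" "\<And>i. i \<in> I \<Longrightarrow> P (f i)"
    for I :: "nat set" and f
    using that by (induction I) (auto intro: P_add P_const)
  have P_cong: "P g" if "P f" "\<And>\<zeta>. cmod \<zeta> = 1 \<Longrightarrow> f \<zeta> = g \<zeta>" for f g
    using that unfolding P_def by (metis dist_0_norm mem_sphere)
  \<comment> \<open>On the circle complex conjugation is inversion, so a product \<open>\<zeta>\<^sup>m cnj \<zeta>\<^sup>n\<close> is, up to
    conjugation, a single power of \<open>\<zeta>\<close>.\<close>
  have mono: "P (\<lambda>\<zeta>. Re (a * \<zeta> ^ m * cnj (b * \<zeta> ^ n)))" for a b m n
  proof (cases "n \<le> m")
    case True
    have "Re (poly (monom (a * cnj b) (m - n)) \<zeta>) = Re (a * \<zeta> ^ m * cnj (b * \<zeta> ^ n))" if "cmod \<zeta> = 1" for \<zeta>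
    proof -
      have "\<zeta> * cnj \<zeta> = 1" using that by (simp add: complex_norm_square[symmetric])
      moreover have "\<zeta> ^ m * cnj \<zeta> ^ n = \<zeta> ^ (m - n) * (\<zeta> * cnj \<zeta>) ^ n"
        using True by (simp only: power_mult_distrib mult.assoc[symmetric] power_add[symmetric] le_add_diff_inverse2)
      ultimately have "\<zeta> ^ m * cnj \<zeta> ^ n = \<zeta> ^ (m - n)" by simp
      then show ?thesis by (simp add: poly_monom mult_ac)
    qed
    then show ?thesis using P_cong unfolding P_def by (metis dist_0_norm mem_sphere)
  next
    case False
    have "Re (poly (monom (cnj a * b) (n - m)) \<zeta>) = Re (a * \<zeta> ^ m * cnj (b * \<zeta> ^ n))" if "cmod \<zeta> = 1" for \<zeta>
    proof -
      have "\<zeta> * cnj \<zeta> = 1" using that by (simp add: complex_norm_square[symmetric])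
      moreover have "\<zeta> ^ n * cnj \<zeta> ^ m = \<zeta> ^ (n - m) * (\<zeta> * cnj \<zeta>) ^ m"
        using False by (simp only: power_mult_distrib mult.assoc[symmetric] power_add[symmetric] le_add_diff_inverse2 nat_le_linear not_le less_imp_le)
      ultimately have "\<zeta> ^ n * cnj \<zeta> ^ m = \<zeta> ^ (n - m)" by simp
      then have "poly (monom (cnj a * b) (n - m)) \<zeta> = cnj (a * \<zeta> ^ m * cnj (b * \<zeta> ^ n))"
        by (simp add: poly_monom mult_ac)
      then show ?thesis by (metis complex_cnj_cnj cnj.simps(1))
    qed
    then show ?thesis using P_cong unfolding P_def by (metis dist_0_norm mem_sphere)
  qed
  have P_mult: "P (\<lambda>x. f x * g x)" if fg: "P f" "P g" for f g
  proof -
    obtain p q where pq: "\<forall>\<zeta>\<in>sphere 0 1. f \<zeta> = Re (poly p \<zeta>)" "\<forall>\<zeta>\<in>sphere 0 1. g \<zeta> = Re (poly q \<zeta>)"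
      using fg unfolding P_def by blast
    have "P (\<lambda>\<zeta>. Re (poly (smult (1/2) (p * q)) \<zeta>))" unfolding P_def by blast
    moreover have "P (\<lambda>\<zeta>. \<Sum>i\<le>degree p. \<Sum>j\<le>degree q. Re ((coeff p i / 2) * \<zeta> ^ i * cnj (coeff q j * \<zeta> ^ j)))"
      by (intro P_sum mono) auto
    ultimately have "P (\<lambda>\<zeta>. Re (poly (smult (1/2) (p * q)) \<zeta>)
       + (\<Sum>i\<le>degree p. \<Sum>j\<le>degree q. Re ((coeff p i / 2) * \<zeta> ^ i * cnj (coeff q j * \<zeta> ^ j))))"
      by (rule P_add)
    moreover have "Re (poly (smult (1/2) (p * q)) \<zeta>)
       + (\<Sum>i\<le>degree p. \<Sum>j\<le>degree q. Re ((coeff p i / 2) * \<zeta> ^ i * cnj (coeff q j * \<zeta> ^ j)))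
       = f \<zeta> * g \<zeta>" if "cmod \<zeta> = 1" for \<zeta>
    proof -
      have "(\<Sum>i\<le>degree p. \<Sum>j\<le>degree q. Re ((coeff p i / 2) * \<zeta> ^ i * cnj (coeff q j * \<zeta> ^ j)))
        = Re ((\<Sum>i\<le>degree p. coeff p i * \<zeta> ^ i) * cnj (\<Sum>j\<le>degree q. coeff q j * \<zeta> ^ j) / 2)"
        by (simp only: cnj_sum sum_product sum_divide_distrib Re_sum times_divide_eq_left)
      also have "\<dots> = Re (poly p \<zeta> * cnj (poly q \<zeta>) / 2)" by (simp only: poly_altdef)
      finally have S: "(\<Sum>i\<le>degree p. \<Sum>j\<le>degree q. Re ((coeff p i / 2) * \<zeta> ^ i * cnj (coeff q j * \<zeta> ^ j)))
        = Re (poly p \<zeta> * cnj (poly q \<zeta>) / 2)" .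
      show ?thesis unfolding S using pq that by (simp add: field_simps)
    qed
    ultimately show ?thesis by (rule P_cong)
  qed
  have "\<exists>g'. P g' \<and> (\<forall>x\<in>sphere 0 1. \<bar>g x - g' x\<bar> < e)"
  proof (rule Stone_Weierstrass_HOL[of "sphere 0 1" P g e])
    show "continuous_on (sphere 0 1) f" if Pf: "P f" for f
    proof -
      obtain p where p: "\<forall>\<zeta>\<in>sphere 0 1. f \<zeta> = Re (poly p \<zeta>)" using Pf unfolding P_def by blast
      have "continuous_on (sphere 0 1) (\<lambda>\<zeta>. Re (poly p \<zeta>))" by (intro continuous_intros)
      then show ?thesis using p by (metis (no_types, lifting) continuous_on_cong)
    qed
    show "\<exists>f. P f \<and> f x \<noteq> f y" if "x \<in> sphere 0 1 \<and> y \<in> sphere 0 1 \<and> x \<noteq> y" for x y :: complex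
    proof -
      have 1: "P Re" unfolding P_def by (intro exI[of _ "[:0,1:]"]) simp
      have 2: "P Im" unfolding P_def by (intro exI[of _ "[:0,-\<i>:]"]) simp
      from that have "Re x \<noteq> Re y \<or> Im x \<noteq> Im y" by (simp add: complex_eq_iff)
      with 1 2 show ?thesis by blast
    qed
  qed (use P_add P_mult P_const assms in auto)
  then obtain g' p where "\<forall>x\<in>sphere 0 1. \<bar>g x - g' x\<bar> < e" "\<forall>\<zeta>\<in>sphere 0 1. g' \<zeta> = Re (poly p \<zeta>)"
    unfolding P_def by blast
  then show ?thesis by (intro that[of p]) auto
qed

text \<open>A converse to the maximum principle: an upper semicontinuous function is a decreasing limit of
  continuous functions, and each of these is uniformly close to the real part of a polynomial. It
  reduces a submean inequality to polynomial majorants.\<close>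

lemma le_circle_mean_if_le_Re_poly:
  assumes usc: "usc_on U f" and fin: "\<And>z. z \<in> U \<Longrightarrow> f z \<noteq> \<infinity>"
    and U: "\<And>\<zeta>. cmod \<zeta> = 1 \<Longrightarrow> z + \<zeta> *\<^sub>C v \<in> U"
    and le: "\<And>p. (\<And>\<zeta>. cmod \<zeta> = 1 \<Longrightarrow> f (z + \<zeta> *\<^sub>C v) < ereal (Re (poly p \<zeta>))) \<Longrightarrow> a \<le> ereal (Re (poly p 0))"
  shows "a \<le> circle_mean f z v"
proof -
  define g where "g = (\<lambda>\<zeta>. f (z + \<zeta> *\<^sub>C v))"
  have usc1: "usc_on (sphere 0 1) g" unfolding g_def
    by (rule usc_on_compose[OF usc]) (use U in \<open>auto intro!: continuous_intros\<close>)
  obtain M where M: "M \<ge> 0" "\<And>\<zeta>. \<zeta> \<in> sphere 0 1 \<Longrightarrow> g \<zeta> \<le> ereal M"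
    using usc_on_bounded_above[OF usc1 compact_sphere] fin U unfolding g_def by (metis dist_0_norm mem_sphere)
  have "(1::complex) \<in> sphere 0 1" by simp
  then have ne: "sphere 0 (1::real) \<noteq> ({}::complex set)" by blast
  have maxM: "max M 0 = M" using M by simp
  obtain h :: "nat \<Rightarrow> complex \<Rightarrow> real" where h: "\<And>n. continuous_on (sphere 0 1) (h n)"
      "\<And>n x. x \<in> sphere 0 1 \<Longrightarrow> g x \<le> ereal (h n x)"
      "\<And>m n x. x \<in> sphere 0 1 \<Longrightarrow> m \<le> n \<Longrightarrow> h n x \<le> h m x"
      "\<And>n x. x \<in> sphere 0 1 \<Longrightarrow> h n x \<le> M"
      "\<And>x a. x \<in> sphere 0 1 \<Longrightarrow> g x < ereal a \<Longrightarrow> \<exists>n. h n x \<le> a"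
    using usc_approx_from_above[OF usc1 ne M(2)] unfolding maxM by metis
  define G where "G = (\<lambda>\<theta>::real. g (cis (2 * pi * \<theta>)))"
  define k where "k = (\<lambda>n \<theta>. M - h n (cis (2 * pi * \<theta>)))"
  have k0: "k n \<theta> \<ge> 0" for n \<theta> using h(4) by (simp add: k_def)
  have kcont: "continuous_on UNIV (k n)" for n unfolding k_def
    by (intro continuous_intros continuous_on_compose2[OF h(1) continuous_cis]) auto
  then have km [measurable]: "k n \<in> borel_measurable borel" for n by (rule borel_measurable_continuous_onI)
  have mean: "a \<le> ereal (M - integral {0..1} (k n))" for n
  proof (rule ereal_le_epsilon2)
    fix e :: real assume e: "e > 0"
    have cont: "continuous_on (sphere 0 1) (\<lambda>\<zeta>. h n \<zeta> + e/2)"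
      by (intro continuous_intros h(1))
    obtain p where p: "\<And>\<zeta>. cmod \<zeta> = 1 \<Longrightarrow> \<bar>(h n \<zeta> + e/2) - Re (poly p \<zeta>)\<bar> < e/2"
      using Re_poly_dense_on_circle[OF cont half_gt_zero[OF e]] by blast
    have "g \<zeta> < ereal (Re (poly p \<zeta>))" if "cmod \<zeta> = 1" for \<zeta>
    proof -
      have "g \<zeta> \<le> ereal (h n \<zeta>)" using h(2) that by simp
      also have "h n \<zeta> < Re (poly p \<zeta>)" using p[OF that] unfolding abs_less_iff by linarith
      then have "ereal (h n \<zeta>) < ereal (Re (poly p \<zeta>))" by simp
      finally show ?thesis .
    qed
    then have 1: "a \<le> ereal (Re (poly p 0))" by (intro le) (simp add: g_def)
    have "((\<lambda>\<theta>. Re (poly p (cis (2 * pi * \<theta>)))) has_integral Re (poly p 0)) {0..1}"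
      by (rule Re_holomorphic_circle_mean[of _ UNIV]) (auto intro: holomorphic_intros)
    moreover have "((\<lambda>\<theta>. M - k n \<theta> + e) has_integral M - integral {0..1} (k n) + e) {0..1}"
    proof -
      have "(k n has_integral integral {0..1} (k n)) {0..1}"
        by (intro integrable_integral integrable_continuous_real continuous_on_subset[OF kcont]) auto
      from has_integral_add[OF has_integral_diff[OF has_integral_const_real[of M 0 1] this] has_integral_const_real[of e 0 1]]
      show ?thesis by simp
    qed
    ultimately have "Re (poly p 0) \<le> M - integral {0..1} (k n) + e"
      by (rule has_integral_le) (use p in \<open>auto simp: k_def abs_less_iff; smt (verit) field_sum_of_halves norm_cis\<close>)
    then show "a \<le> ereal (M - integral {0..1} (k n)) + ereal e" using 1 order_trans by fastforce
  qed
  have int: "(\<integral>\<^sup>+\<theta>\<in>{0..1}. ennreal (k n \<theta>) \<partial>lborel) = ennreal (integral {0..1} (k n))" for n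
  proof -
    have "(k n has_integral integral {0..1} (k n)) {0..1}"
      by (intro integrable_integral integrable_continuous_real continuous_on_subset[OF kcont]) auto
    then show ?thesis by (rule nn_integral_unit_interval[OF k0])
  qed
  have sup: "e2ennreal (ereal M - G \<theta>) = (SUP n. ennreal (k n \<theta>))" for \<theta>
  proof (rule antisym)
    define c where "c = cis (2 * pi * \<theta>)"
    have c: "c \<in> sphere 0 1" by (simp add: c_def)
    have kc: "k n \<theta> = M - h n c" for n by (simp add: k_def c_def)
    have G: "G \<theta> = g c" by (simp add: G_def c_def)
    show "(SUP n. ennreal (k n \<theta>)) \<le> e2ennreal (ereal M - G \<theta>)"
    proof (rule SUP_least)
      fix n
      have "ereal (k n \<theta>) \<le> ereal M - G \<theta>" using h(2)[OF c, of n] unfolding kc G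
        by (cases "g c") auto
      then show "ennreal (k n \<theta>) \<le> e2ennreal (ereal M - G \<theta>)" by (metis e2ennreal_ereal e2ennreal_mono)
    qed
    show "e2ennreal (ereal M - G \<theta>) \<le> (SUP n. ennreal (k n \<theta>))"
    proof (rule dense_le)
      fix y assume y: "y < e2ennreal (ereal M - G \<theta>)"
      then obtain r where r: "y = ennreal r" "r \<ge> 0" by (cases y) auto
      have "ereal r < ereal M - G \<theta>"
      proof (rule ccontr)
        assume "\<not> ?thesis"
        then have "e2ennreal (ereal M - G \<theta>) \<le> e2ennreal (ereal r)" by (intro e2ennreal_mono) auto
        with y r show False by (simp add: e2ennreal_ereal)
      qed
      then have "g c < ereal (M - r)" unfolding G by (cases "g c") auto
      from h(5)[OF c this] obtain n where "h n c \<le> M - r" ..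
      then have "y \<le> ennreal (k n \<theta>)" unfolding r kc by (intro ennreal_leI) simp
      also have "\<dots> \<le> (SUP n. ennreal (k n \<theta>))" by (rule SUP_upper) simp
      finally show "y \<le> (SUP n. ennreal (k n \<theta>))" .
    qed
  qed
  have "(\<integral>\<^sup>+\<theta>\<in>{0..1}. e2ennreal (ereal M - G \<theta>) \<partial>lborel)
      = (\<integral>\<^sup>+\<theta>. (SUP n. ennreal (k n \<theta>) * indicator {0..1} \<theta>) \<partial>lborel)"
    unfolding sup by (simp add: SUP_mult_right_ennreal)
  also have "\<dots> = (SUP n. (\<integral>\<^sup>+\<theta>\<in>{0..1}. ennreal (k n \<theta>) \<partial>lborel))"
  proof (rule nn_integral_monotone_convergence_SUP)
    have "k m \<theta> \<le> k n \<theta>" if "m \<le> n" for m n \<theta>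
      using h(3)[of "cis (2 * pi * \<theta>)" m n] that by (simp add: k_def)
    then show "incseq (\<lambda>n \<theta>. ennreal (k n \<theta>) * indicator {0..1} \<theta>)"
      by (auto simp: incseq_def le_fun_def intro!: mult_right_mono ennreal_leI)
    show "(\<lambda>\<theta>. ennreal (k n \<theta>) * indicator {0..1} \<theta>) \<in> borel_measurable lborel" for n by measurable
  qed
  finally have K: "(\<integral>\<^sup>+\<theta>\<in>{0..1}. e2ennreal (ereal M - G \<theta>) \<partial>lborel) = (SUP n. ennreal (integral {0..1} (k n)))"
    unfolding int .
  have cm: "circle_mean f z v = ereal M - enn2ereal (SUP n. ennreal (integral {0..1} (k n)))"
    unfolding K[symmetric] unfolding G_def g_def
    by (rule circle_mean_eq_diff[OF usc_circle_measurable[OF usc U]]) (use M in \<open>auto simp: g_def\<close>)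
  have ik0: "integral {0..1} (k n) \<ge> 0" for n by (rule integral_nonneg) (use k0 kcont in \<open>auto intro!: integrable_continuous_real continuous_on_subset[OF kcont]\<close>)
  show ?thesis
  proof (cases a)
    case MInf then show ?thesis by simp
  next
    case PInf then show ?thesis using mean[of 0] by simp
  next
    case (real b)
    have "integral {0..1} (k n) \<le> M - b" for n using mean[of n] real by simp
    then have "(SUP n. ennreal (integral {0..1} (k n))) \<le> ennreal (M - b)"
      by (intro SUP_least ennreal_leI)
    then have "enn2ereal (SUP n. ennreal (integral {0..1} (k n))) \<le> enn2ereal (ennreal (M - b))"
      by (simp only: less_eq_ennreal.rep_eq)
    moreover have "M - b \<ge> 0" using mean[of 0] ik0[of 0] real by auto
    ultimately have "enn2ereal (SUP n. ennreal (integral {0..1} (k n))) \<le> ereal (M - b)"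
      by (simp add: enn2ereal_ennreal)
    then show ?thesis unfolding cm real
      by (cases "enn2ereal (SUP n. ennreal (integral {0..1} (k n)))") auto
  qed
qed

section \<open>Plurisubharmonic functions along analytic discs\<close>

lemma scaleC_Pair [simp]: "a *\<^sub>C (x, y) = (a *\<^sub>C x, a *\<^sub>C y)"
  by (simp add: scaleC_prod_def)

lemma scaleC_complex [simp]: "a *\<^sub>C (x::complex) = a * x"
  by (simp add: scaleC_complex_def)

lemma entire_compose_affine:
  assumes "Q holomorphic_on UNIV"
  shows "(\<lambda>\<zeta>. Q (a + b * \<zeta>)) holomorphic_on UNIV"
proof -
  have "(\<lambda>\<zeta>. a + b * \<zeta>) holomorphic_on UNIV" by (intro holomorphic_intros)
  from holomorphic_on_compose_gen[OF this assms] show ?thesis by (simp add: o_def)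
qed

lemma entire_continuous_on: "w holomorphic_on UNIV \<Longrightarrow> continuous_on S w"
  by (rule continuous_on_subset[OF holomorphic_on_imp_continuous_on]) auto

lemma second_order_remainder:
  assumes w: "w holomorphic_on UNIV"
  obtains w1 w2 where "w2 holomorphic_on UNIV" "\<And>s. w (a + s) = w a + s * w1 + s\<^sup>2 * w2 s"
proof -
  define u1 where "u1 = (\<lambda>z. if z = a then deriv w a else (w z - w a) / (z - a))"
  define u2 where "u2 = (\<lambda>z. if z = a then deriv u1 a else (u1 z - u1 a) / (z - a))"
  have h1: "u1 holomorphic_on UNIV" unfolding u1_def by (rule pole_lemma_open[OF w]) simp
  have h2: "u2 holomorphic_on UNIV" unfolding u2_def by (rule pole_lemma_open[OF h1]) simp
  have "w z = w a + (z - a) * u1 z" for z by (simp add: u1_def)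
  moreover have "u1 z = u1 a + (z - a) * u2 z" for z by (simp add: u2_def)
  ultimately have "w z = w a + (z - a) * (u1 a + (z - a) * u2 z)" for z by metis
  then have "w (a + s) = w a + s * u1 a + s\<^sup>2 * u2 (a + s)" for s
    by (metis (no_types, opaque_lifting) add.assoc add_diff_cancel_left' distrib_left mult.assoc power2_eq_square)
  moreover have "(\<lambda>s. u2 (a + s)) holomorphic_on UNIV"
    using entire_compose_affine[OF h2, of a 1] by simp
  ultimately show ?thesis using that[of "\<lambda>s. u2 (a + s)" "u1 a"] by blast
qed

text \<open>The maximum principle on a disc that is affine in the first variable and arbitrary in the
  second. The function \<open>f\<close> is considered on the tube of points \<open>(z + \<zeta>v, w \<zeta> + \<omega>)\<close> with small \<open>\<omega>\<close>, with
  \<open>Re Q + \<epsilon>(1 - |\<zeta>|\<^sup>2)\<close> and a penalty \<open>k|\<omega>|\<^sup>2\<close> subtracted. If the claim failed, the maximum would be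
  interior. Through the maximum runs the affine disc whose second component has the slope of \<open>w\<close>;
  along it \<open>\<omega>\<close> is constant up to second order, so on a circle of radius \<open>r\<close> the penalty is harmonic up
  to \<open>O(r\<^sup>4)\<close>, whereas the term with \<open>\<epsilon>\<close> loses \<open>\<epsilon>r\<^sup>2\<close>. For small \<open>r\<close> this contradicts the submean
  inequality for \<open>f\<close>.\<close>

lemma psh_le_along_graph:
  fixes f :: "'a::complex_normed \<times> complex \<Rightarrow> ereal"
  assumes psh: "psh_on f U" and U: "open U"
    and w: "w holomorphic_on UNIV" and Q: "Q holomorphic_on UNIV"
    and disc: "\<And>\<zeta>. cmod \<zeta> \<le> 1 \<Longrightarrow> (z + \<zeta> *\<^sub>C v, w \<zeta>) \<in> U"
    and le: "\<And>\<zeta>. cmod \<zeta> = 1 \<Longrightarrow> f (z + \<zeta> *\<^sub>C v, w \<zeta>) \<le> ereal (Re (Q \<zeta>))"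
  shows "f (z, w 0) \<le> ereal (Re (Q 0))"
proof (rule ccontr)
  assume neg: "\<not> f (z, w 0) \<le> ereal (Re (Q 0))"
  have usc: "usc_on U f" and fin: "\<And>p. p \<in> U \<Longrightarrow> f p \<noteq> \<infinity>"
    using psh by (auto simp: psh_on_def)
  have "(z, w 0) \<in> U" using disc[of 0] by simp
  from fin[OF this] neg obtain F0 where F0: "f (z, w 0) = ereal F0" "F0 > Re (Q 0)"
    by (cases "f (z, w 0)") auto
  define \<epsilon> where "\<epsilon> = (F0 - Re (Q 0)) / 2"
  have \<epsilon>: "\<epsilon> > 0" using F0 by (simp add: \<epsilon>_def)
  define q where "q = (\<lambda>\<zeta>. Re (Q \<zeta>) + \<epsilon> * (1 - (cmod \<zeta>)\<^sup>2))"
  define \<Xi> where "\<Xi> = (\<lambda>(\<zeta>, \<omega>). (z + \<zeta> *\<^sub>C v, w \<zeta> + \<omega>))"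
  have wc: "continuous_on S w" and Qc: "continuous_on S Q" for S
    using w Q by (auto intro: entire_continuous_on)
  have \<Xi>c: "continuous_on S \<Xi>" for S unfolding \<Xi>_def case_prod_beta
    by (intro continuous_intros continuous_on_compose2[OF wc[of UNIV]]) auto
  have qc: "continuous_on S (\<lambda>p. q (fst p))" for S :: "(complex \<times> complex) set" unfolding q_def
    by (intro continuous_intros continuous_on_compose2[OF Qc[of UNIV]]) auto
  have "open (\<Xi> -` U)" by (rule open_vimage[OF U \<Xi>c])
  moreover have "compact (cball (0::complex) 1 \<times> {0::complex})" by (intro compact_Times) auto
  moreover have "cball (0::complex) 1 \<times> {0::complex} \<subseteq> \<Xi> -` U" using disc by (auto simp: \<Xi>_def)
  ultimately obtain \<delta>1 where \<delta>1: "\<delta>1 > 0" "(\<Union>x\<in>cball 0 1 \<times> {0}. ball x \<delta>1) \<subseteq> \<Xi> -` U"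
    using compact_subset_open_imp_ball_epsilon_subset[of "cball (0::complex) 1 \<times> {0::complex}" "\<Xi> -` U"] by metis
  have in_U: "\<Xi> (\<zeta>, \<omega>) \<in> U" if "cmod \<zeta> \<le> 1" "cmod \<omega> < \<delta>1" for \<zeta> \<omega>
  proof -
    have "(\<zeta>, \<omega>) \<in> ball (\<zeta>, 0) \<delta>1" using that by (simp add: dist_Pair_Pair)
    moreover have "(\<zeta>, 0) \<in> cball 0 1 \<times> {0}" using that by simp
    ultimately show ?thesis using \<delta>1(2) by blast
  qed
  define \<Phi> where "\<Phi> = (\<lambda>k p. f (\<Xi> p) + ereal (- q (fst p) - k * (cmod (snd p))\<^sup>2))"
  have \<Phi>usc: "usc_on (cball 0 1 \<times> ball 0 \<delta>1) (\<Phi> k)" for k unfolding \<Phi>_def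
    by (intro usc_on_add_continuous usc_on_compose[OF usc] \<Xi>c continuous_intros qc) (use in_U in auto)
  \<comment> \<open>Near the part of the graph over the unit circle the function stays below its value over the centre.\<close>
  have "\<exists>\<delta>2>0. \<forall>\<zeta> \<omega>. cmod \<zeta> = 1 \<longrightarrow> cmod \<omega> < \<delta>2 \<longrightarrow> cmod \<omega> < \<delta>1 \<longrightarrow> \<Phi> 0 (\<zeta>, \<omega>) < ereal \<epsilon>"
  proof -
    have "openin (top_of_set (cball 0 1 \<times> ball 0 \<delta>1)) {p \<in> cball 0 1 \<times> ball 0 \<delta>1. \<Phi> 0 p < ereal \<epsilon>}"
      using \<Phi>usc[of 0] by (simp add: usc_on_def)
    then obtain N where N: "open N" "{p \<in> cball 0 1 \<times> ball 0 \<delta>1. \<Phi> 0 p < ereal \<epsilon>} = cball 0 1 \<times> ball 0 \<delta>1 \<inter> N"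
      unfolding openin_open by (elim exE conjE) (rule that)
    have "(\<zeta>, 0) \<in> {p \<in> cball 0 1 \<times> ball 0 \<delta>1. \<Phi> 0 p < ereal \<epsilon>}" if "cmod \<zeta> = 1" for \<zeta>
    proof -
      have "\<Phi> 0 (\<zeta>, 0) \<le> ereal (Re (Q \<zeta>)) + ereal (- q \<zeta>)"
        using add_right_mono[OF le[OF that], of "ereal (- q \<zeta>)"] by (simp add: \<Phi>_def \<Xi>_def)
      also have "\<dots> < ereal \<epsilon>" using that \<epsilon> by (simp add: q_def)
      finally show ?thesis using that \<delta>1 by auto
    qed
    then have sub: "sphere 0 1 \<times> {0} \<subseteq> N" unfolding N(2) by auto
    have "compact (sphere (0::complex) 1 \<times> {0::complex})" by (intro compact_Times) auto
    from compact_subset_open_imp_ball_epsilon_subset[OF this N(1) sub]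
    obtain \<delta>2 where \<delta>2: "\<delta>2 > 0" "(\<Union>x\<in>sphere 0 1 \<times> {0}. ball x \<delta>2) \<subseteq> N" by metis
    have "\<Phi> 0 (\<zeta>, \<omega>) < ereal \<epsilon>" if "cmod \<zeta> = 1" "cmod \<omega> < \<delta>2" "cmod \<omega> < \<delta>1" for \<zeta> \<omega>
    proof -
      have "(\<zeta>, \<omega>) \<in> ball (\<zeta>, 0) \<delta>2" using that by (simp add: dist_Pair_Pair)
      moreover have "(\<zeta>, 0) \<in> sphere 0 1 \<times> {0}" using that by simp
      ultimately have "(\<zeta>, \<omega>) \<in> N" using \<delta>2(2) by blast
      then have "(\<zeta>, \<omega>) \<in> {p \<in> cball 0 1 \<times> ball 0 \<delta>1. \<Phi> 0 p < ereal \<epsilon>}"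
        unfolding N(2) using that by auto
      then show ?thesis by simp
    qed
    then show ?thesis using \<delta>2(1) by blast
  qed
  then obtain \<delta>2 where \<delta>2: "\<delta>2 > 0"
    "\<And>\<zeta> \<omega>. cmod \<zeta> = 1 \<Longrightarrow> cmod \<omega> < \<delta>2 \<Longrightarrow> cmod \<omega> < \<delta>1 \<Longrightarrow> \<Phi> 0 (\<zeta>, \<omega>) < ereal \<epsilon>" by blast
  define \<delta> where "\<delta> = min \<delta>1 \<delta>2 / 2"
  have \<delta>: "\<delta> > 0" "\<delta> < \<delta>1" "\<delta> < \<delta>2" using \<delta>1(1) \<delta>2(1) by (auto simp: \<delta>_def)
  define D where "D = cball (0::complex) 1 \<times> cball (0::complex) \<delta>"
  have Dc: "compact D" and Dne: "D \<noteq> {}" unfolding D_def using \<delta> by (auto intro: compact_Times)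
  have Dsub: "D \<subseteq> cball 0 1 \<times> ball 0 \<delta>1" using \<delta> by (auto simp: D_def)
  have Dusc: "usc_on D (\<Phi> k)" for k by (rule usc_on_subset[OF \<Phi>usc Dsub])
  have Dfin: "\<Phi> k p \<noteq> \<infinity>" if "p \<in> D" for k p
  proof -
    have "\<Xi> p \<in> U" using in_U[of "fst p" "snd p"] that Dsub by auto
    from fin[OF this] show ?thesis by (auto simp: \<Phi>_def)
  qed
  obtain M where M: "M \<ge> 0" "\<And>p. p \<in> D \<Longrightarrow> \<Phi> 0 p \<le> ereal M"
    using usc_on_bounded_above[OF Dusc Dc] Dfin by metis
  \<comment> \<open>The penalty outweighs everything on the lateral boundary of the tube around the graph.\<close>
  define k where "k = (M + 1) / \<delta>\<^sup>2"
  have k: "k > 0" using M \<delta> by (simp add: k_def)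
  have \<Phi>k: "\<Phi> k p = \<Phi> 0 p + ereal (- k * (cmod (snd p))\<^sup>2)" for p
    by (cases "f (\<Xi> p)") (auto simp: \<Phi>_def)
  obtain p where p: "p \<in> D" "\<And>y. y \<in> D \<Longrightarrow> \<Phi> k y \<le> \<Phi> k p"
    using usc_on_attains_sup[OF Dusc Dc Dne] by metis
  obtain a \<omega>0 where a: "p = (a, \<omega>0)" by (cases p)
  have "(0, 0) \<in> D" using \<delta> by (simp add: D_def)
  then have "\<Phi> k (0, 0) \<le> \<Phi> k p" by (rule p(2))
  moreover have "\<Phi> k (0, 0) = ereal \<epsilon>" using F0 by (simp add: \<Phi>_def \<Xi>_def q_def \<epsilon>_def field_simps)
  ultimately have m\<epsilon>: "ereal \<epsilon> \<le> \<Phi> k (a, \<omega>0)" by (simp add: a)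
  with Dfin[OF p(1), of k] obtain m where m: "\<Phi> k (a, \<omega>0) = ereal m" "m \<ge> \<epsilon>"
    by (cases "\<Phi> k (a, \<omega>0)") (auto simp: a)
  have a_le: "cmod a \<le> 1" "cmod \<omega>0 \<le> \<delta>" using p(1) by (auto simp: a D_def)
  have \<Phi>0: "ereal \<epsilon> \<le> \<Phi> 0 (a, \<omega>0) + ereal (- k * (cmod \<omega>0)\<^sup>2)" using m\<epsilon> by (simp add: \<Phi>k)
  have a1: "cmod a < 1"
  proof (rule ccontr)
    assume "\<not> cmod a < 1"
    then have "\<Phi> 0 (a, \<omega>0) < ereal \<epsilon>" using \<delta>2(2)[of a \<omega>0] a_le \<delta> by auto
    moreover have "k * (cmod \<omega>0)\<^sup>2 \<ge> 0" using k by simp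
    ultimately show False using \<Phi>0 by (cases "\<Phi> 0 (a, \<omega>0)") auto
  qed
  have o1: "cmod \<omega>0 < \<delta>"
  proof (rule ccontr)
    assume "\<not> cmod \<omega>0 < \<delta>"
    then have "cmod \<omega>0 = \<delta>" using a_le by simp
    then have "k * (cmod \<omega>0)\<^sup>2 = M + 1" using \<delta> by (simp add: k_def)
    then show False using \<Phi>0 M(2)[OF p(1)] \<epsilon> by (cases "\<Phi> 0 (a, \<omega>0)") (auto simp: a)
  qed
  obtain w1 w2 where w12: "w2 holomorphic_on UNIV" "\<And>s. w (a + s) = w a + s * w1 + s\<^sup>2 * w2 s"
    using second_order_remainder[OF w] by metis
  have w2c: "continuous_on S w2" for S
    using w12(1) by (rule entire_continuous_on)
  have "bounded (w2 ` cball 0 1)"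
    by (rule compact_imp_bounded[OF compact_continuous_image[OF w2c compact_cball]])
  then obtain C where C: "C > 0" "\<And>s. cmod s \<le> 1 \<Longrightarrow> cmod (w2 s) \<le> C"
    unfolding bounded_pos by auto
  \<comment> \<open>Small enough for the affine disc to stay in the tube and for \<open>k C\<^sup>2 r\<^sup>4 < \<epsilon> r\<^sup>2\<close>.\<close>
  define r where "r = min (min 1 (1 - cmod a)) (min ((\<delta> - cmod \<omega>0) / C) (\<epsilon> / (2 * k * C\<^sup>2)))"
  have r: "r > 0" "r \<le> 1" "r \<le> 1 - cmod a" "r \<le> (\<delta> - cmod \<omega>0) / C" "r \<le> \<epsilon> / (2 * k * C\<^sup>2)"
    using a1 o1 C(1) k \<epsilon> unfolding r_def by (simp, linarith, linarith, linarith, linarith)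
  have r2: "r\<^sup>2 \<le> r" using r by (simp add: power2_eq_square mult_left_le)
  have rC: "r\<^sup>2 * C \<le> \<delta> - cmod \<omega>0"
  proof -
    have "r\<^sup>2 * C \<le> r * C" using r2 C by (intro mult_right_mono) auto
    also have "\<dots> \<le> \<delta> - cmod \<omega>0" using r(4) C by (simp add: pos_le_divide_eq)
    finally show ?thesis .
  qed
  have rk: "k * (r\<^sup>2 * C)\<^sup>2 < \<epsilon> * r\<^sup>2"
  proof -
    have "r\<^sup>2 * (2 * k * C\<^sup>2) \<le> r * (2 * k * C\<^sup>2)" using r2 k by (intro mult_right_mono) auto
    also have "\<dots> \<le> \<epsilon>" using r(5) k C by (simp add: pos_le_divide_eq)
    finally have "r\<^sup>2 * (k * C\<^sup>2) < \<epsilon>" using \<epsilon> by simp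
    then have "r\<^sup>2 * (r\<^sup>2 * (k * C\<^sup>2)) < r\<^sup>2 * \<epsilon>" using r by (intro mult_strict_left_mono) auto
    then show ?thesis by (simp add: power2_eq_square mult_ac)
  qed
  define om where "om = (\<lambda>s. \<omega>0 - s\<^sup>2 * w2 s)"
  have line: "\<Xi> (a, \<omega>0) + \<zeta> *\<^sub>C (of_real r *\<^sub>C (v, w1)) = \<Xi> (a + of_real r * \<zeta>, om (of_real r * \<zeta>))" for \<zeta>
  proof -
    have "z + a *\<^sub>C v + \<zeta> *\<^sub>C of_real r *\<^sub>C v = z + (a + of_real r * \<zeta>) *\<^sub>C v"
      by (simp add: scaleC_scaleC scaleC_add_left mult.commute add.assoc)
    then show ?thesis by (simp add: \<Xi>_def om_def w12(2) mult_ac)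
  qed
  have inD: "(a + of_real r * \<zeta>, om (of_real r * \<zeta>)) \<in> D" if "cmod \<zeta> \<le> 1" for \<zeta>
  proof -
    have s: "cmod (of_real r * \<zeta>) \<le> r" using that r by (simp add: norm_mult mult_left_le)
    have "cmod (a + of_real r * \<zeta>) \<le> cmod a + cmod (of_real r * \<zeta>)" by (rule norm_triangle_ineq)
    then have 1: "cmod (a + of_real r * \<zeta>) \<le> 1" using s r by linarith
    have "cmod ((of_real r * \<zeta>)\<^sup>2 * w2 (of_real r * \<zeta>)) \<le> r\<^sup>2 * C"
      unfolding norm_mult[of "(of_real r * \<zeta>)\<^sup>2"] norm_power
      using s r C by (intro mult_mono power_mono) (auto intro!: C)
    moreover have "cmod (om (of_real r * \<zeta>)) \<le> cmod \<omega>0 + cmod ((of_real r * \<zeta>)\<^sup>2 * w2 (of_real r * \<zeta>))"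
      unfolding om_def by (rule norm_triangle_ineq4)
    ultimately have "cmod (om (of_real r * \<zeta>)) \<le> \<delta>" using rC by linarith
    with 1 show ?thesis by (simp add: D_def)
  qed
  \<comment> \<open>The squares \<open>|a + s|\<^sup>2\<close> and \<open>|\<omega>0 - s\<^sup>2 w2 s|\<^sup>2\<close> expand into harmonic terms and constants on \<open>|s| = r\<close>.\<close>
  define H where "H = (\<lambda>\<zeta>. of_real (m + \<epsilon> * (1 - (cmod a)\<^sup>2) - \<epsilon> * r\<^sup>2 + k * (cmod \<omega>0)\<^sup>2 + k * (r\<^sup>2 * C)\<^sup>2)
     + Q (a + of_real r * \<zeta>) - of_real (2 * \<epsilon>) * (cnj a * (of_real r * \<zeta>))
     - of_real (2 * k) * (cnj \<omega>0 * ((of_real r * \<zeta>)\<^sup>2 * w2 (of_real r * \<zeta>))))"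
  have H: "H holomorphic_on UNIV"
  proof -
    have "(\<lambda>\<zeta>. Q (a + of_real r * \<zeta>)) holomorphic_on UNIV"
      using Q by (rule entire_compose_affine)
    moreover have "(\<lambda>\<zeta>. w2 (of_real r * \<zeta>)) holomorphic_on UNIV"
      using entire_compose_affine[OF w12(1), of 0 "of_real r"] by simp
    ultimately show ?thesis unfolding H_def by (intro holomorphic_intros)
  qed
  have maj: "f (\<Xi> (a, \<omega>0) + \<zeta> *\<^sub>C (of_real r *\<^sub>C (v, w1))) \<le> ereal (Re (H \<zeta>))" if \<zeta>: "cmod \<zeta> = 1" for \<zeta>
  proof -
    define s where "s = of_real r * \<zeta>"
    have cs: "cmod s = r" using \<zeta> r by (simp add: s_def norm_mult)
    have "(a + s, om s) \<in> D" using inD[of \<zeta>] \<zeta> by (simp add: s_def)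
    then have "\<Phi> k (a + s, om s) \<le> ereal m" using p(2) m by (metis a)
    then have 1: "f (\<Xi> (a + s, om s)) \<le> ereal (m + q (a + s) + k * (cmod (om s))\<^sup>2)"
      unfolding \<Phi>_def by (cases "f (\<Xi> (a + s, om s))") auto
    have sq: "(cmod (x + y))\<^sup>2 = (cmod x)\<^sup>2 + 2 * Re (cnj x * y) + (cmod y)\<^sup>2" for x y :: complex
      unfolding cmod_power2 by (simp add: power2_eq_square algebra_simps)
    have 2: "(cmod (a + s))\<^sup>2 = (cmod a)\<^sup>2 + 2 * Re (cnj a * s) + r\<^sup>2" unfolding sq cs ..
    have "(cmod (om s))\<^sup>2 = (cmod \<omega>0)\<^sup>2 - 2 * Re (cnj \<omega>0 * (s\<^sup>2 * w2 s)) + (cmod (s\<^sup>2 * w2 s))\<^sup>2"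
      using sq[of \<omega>0 "- (s\<^sup>2 * w2 s)"] by (simp add: om_def del: times_complex.simps)
    moreover have "cmod (s\<^sup>2 * w2 s) \<le> r\<^sup>2 * C"
      unfolding norm_mult norm_power cs using r C cs by (intro mult_left_mono) auto
    then have "(cmod (s\<^sup>2 * w2 s))\<^sup>2 \<le> (r\<^sup>2 * C)\<^sup>2" by (intro power_mono) auto
    ultimately have "(cmod (om s))\<^sup>2 \<le> (cmod \<omega>0)\<^sup>2 - 2 * Re (cnj \<omega>0 * (s\<^sup>2 * w2 s)) + (r\<^sup>2 * C)\<^sup>2" by linarith
    then have "k * (cmod (om s))\<^sup>2 \<le> k * ((cmod \<omega>0)\<^sup>2 - 2 * Re (cnj \<omega>0 * (s\<^sup>2 * w2 s)) + (r\<^sup>2 * C)\<^sup>2)"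
      using k by (intro mult_left_mono) auto
    moreover have Rm: "Re (of_real x * y) = x * Re y" for x y by simp
    have "Re (H \<zeta>) = m + \<epsilon> * (1 - (cmod a)\<^sup>2) - \<epsilon> * r\<^sup>2 + k * (cmod \<omega>0)\<^sup>2 + k * (r\<^sup>2 * C)\<^sup>2
       + Re (Q (a + s)) - 2 * \<epsilon> * Re (cnj a * s) - 2 * k * Re (cnj \<omega>0 * (s\<^sup>2 * w2 s))"
      unfolding H_def s_def[symmetric] by (simp only: plus_complex.simps minus_complex.simps Re_complex_of_real Rm)
    ultimately have "m + q (a + s) + k * (cmod (om s))\<^sup>2 \<le> Re (H \<zeta>)"
      unfolding q_def 2 by (simp only: ring_distribs mult.assoc)
    then show ?thesis using 1 unfolding line s_def[symmetric] by (meson ereal_less_eq(3) order_trans)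
  qed
  have "f (\<Xi> (a, \<omega>0)) \<le> ereal (Re (H 0))"
  proof (rule psh_le_Re_holomorphic[OF psh _ H _ _ maj])
    show "\<Xi> (a, \<omega>0) + \<zeta> *\<^sub>C (of_real r *\<^sub>C (v, w1)) \<in> U" if "cmod \<zeta> \<le> 1" for \<zeta>
      unfolding line using inD[OF that] Dsub in_U by auto
  qed auto
  moreover have "Re (H 0) = m + \<epsilon> * (1 - (cmod a)\<^sup>2) - \<epsilon> * r\<^sup>2 + k * (cmod \<omega>0)\<^sup>2 + k * (r\<^sup>2 * C)\<^sup>2 + Re (Q a)"
    by (simp add: H_def)
  moreover have "f (\<Xi> (a, \<omega>0)) = ereal (m + q a + k * (cmod \<omega>0)\<^sup>2)"
    using m(1) unfolding \<Phi>_def by (cases "f (\<Xi> (a, \<omega>0))") auto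
  ultimately show False using rk by (simp add: q_def)
qed

section \<open>The logarithmic coordinate on the punctured disc\<close>

lemma tpar_eq: "w \<noteq> 0 \<Longrightarrow> tpar w = - 2 * ln (cmod w)"
  by (simp add: tpar_def ln_realpow)

lemma tpar_polar [simp]: "tpar (of_real (exp (- (t / 2))) * cis \<theta>) = t"
  by (simp add: tpar_eq norm_mult)

lemma tpar_nonneg: "w \<in> punctured_disc \<Longrightarrow> tpar w \<ge> 0"
  by (auto simp: punctured_disc_def tpar_eq)

lemma polar_in_punctured_disc: "t \<ge> 0 \<Longrightarrow> of_real (exp (- (t / 2))) * cis \<theta> \<in> punctured_disc"
  by (auto simp: punctured_disc_def norm_mult)

lemma punctured_disc_polar:
  assumes "w \<in> punctured_disc"
  obtains \<theta> where "\<theta> \<in> {0..2 * pi}" "w = of_real (exp (- (tpar w / 2))) * cis \<theta>"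
proof -
  have w: "w \<noteq> 0" using assms by (simp add: punctured_disc_def)
  have "w = of_real (cmod w) * cis (Arg2pi w)"
    using Arg2pi_eq[of w] by (simp add: cis_conv_exp)
  moreover have "cmod w = exp (- (tpar w / 2))" using w by (simp add: tpar_eq)
  ultimately show ?thesis
    using that[of "Arg2pi w"] Arg2pi_ge_0[of w] Arg2pi_lt_2pi[of w] by auto
qed

lemma continuous_on_tpar: "0 \<notin> S \<Longrightarrow> continuous_on S tpar"
  unfolding tpar_def by (intro continuous_intros) auto

text \<open>A disc in the punctured plane satisfies \<open>|b| < |w|\<close>, so \<open>1 + \<zeta>b/w\<close> stays in the right half
  plane and has a logarithm.\<close>

lemma tpar_harmonic:
  assumes nz: "\<And>\<zeta>. cmod \<zeta> \<le> 1 \<Longrightarrow> w + \<zeta> * b \<noteq> 0"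
  obtains H S where "H holomorphic_on S" "open S" "cball 0 1 \<subseteq> S"
    "\<And>\<zeta>. cmod \<zeta> \<le> 1 \<Longrightarrow> Re (H \<zeta>) = tpar (w + \<zeta> * b)"
proof -
  have w: "w \<noteq> 0" using nz[of 0] by simp
  have bw: "cmod (b / w) < 1"
  proof (cases "b = 0")
    case False
    show ?thesis
    proof (rule ccontr)
      assume "\<not> ?thesis"
      then have "cmod (- w / b) \<le> 1" using w False by (simp add: norm_divide field_simps)
      then have "w + (- w / b) * b \<noteq> 0" by (rule nz)
      then show False using False by simp
    qed
  qed simp
  define S where "S = {\<zeta>. cmod (\<zeta> * (b / w)) < 1}"
  define H where "H = (\<lambda>\<zeta>. of_real (tpar w) - 2 * Ln (1 + \<zeta> * (b / w)))"
  have "open S" unfolding S_def by (intro open_Collect_less continuous_intros)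
  moreover have S1: "cball 0 1 \<subseteq> S"
  proof
    fix \<zeta> :: complex assume "\<zeta> \<in> cball 0 1"
    then have "cmod \<zeta> * cmod (b / w) \<le> 1 * cmod (b / w)" by (intro mult_right_mono) auto
    then show "\<zeta> \<in> S" using bw unfolding S_def mem_Collect_eq norm_mult by linarith
  qed
  moreover have "H holomorphic_on S" unfolding H_def
  proof (intro holomorphic_intros)
    fix \<zeta> assume "\<zeta> \<in> S"
    then have "cmod (\<zeta> * (b / w)) < 1" by (simp add: S_def)
    then have "Re (1 + \<zeta> * (b / w)) > 0" using abs_Re_le_cmod[of "\<zeta> * (b / w)"] by simp
    then show "1 + \<zeta> * (b / w) \<notin> \<real>\<^sub>\<le>\<^sub>0" by (auto simp: complex_nonpos_Reals_iff)
  qed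
  moreover have "Re (H \<zeta>) = tpar (w + \<zeta> * b)" if "cmod \<zeta> \<le> 1" for \<zeta>
  proof -
    have eq: "w + \<zeta> * b = w * (1 + \<zeta> * (b / w))" using w by (simp add: field_simps)
    have n: "1 + \<zeta> * (b / w) \<noteq> 0" using nz[OF that] unfolding eq by simp
    have "tpar (w + \<zeta> * b) = - 2 * ln (cmod w * cmod (1 + \<zeta> * (b / w)))"
      using tpar_eq[OF nz[OF that]] unfolding eq norm_mult .
    also have "\<dots> = tpar w - 2 * ln (cmod (1 + \<zeta> * (b / w)))"
      using w n by (simp only: tpar_eq[OF w]) (subst ln_mult, auto)
    also have "\<dots> = Re (H \<zeta>)" using n by (simp add: H_def)
    finally show ?thesis ..
  qed
  ultimately show ?thesis using that by blast
qed

section \<open>Rotation invariance and the partial Legendre transform\<close>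

text \<open>This makes \<open>f\<close> rotation invariant. As the circles are compact, upper semicontinuity is kept
  without regularisation.\<close>

definition rot_sup :: "('a \<times> complex \<Rightarrow> ereal) \<Rightarrow> 'a \<Rightarrow> real \<Rightarrow> ereal" where
  "rot_sup f x t = (SUP \<theta>\<in>{0..2 * pi}. f (x, of_real (exp (- (t / 2))) * cis \<theta>))"

text \<open>The inverse Legendre transform of \<open>rot_sup f x\<close>. The range \<open>t \<ge> 0\<close> is the closed disc; its end
  point \<open>t = 0\<close> makes the result at most the value on the boundary circle.\<close>

definition legendre_inf :: "('a \<times> complex \<Rightarrow> ereal) \<Rightarrow> real \<Rightarrow> 'a \<Rightarrow> ereal" where
  "legendre_inf f l x = (INF t\<in>{0..}. rot_sup f x t + ereal (- l * t))"

lemma le_rot_sup: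
  assumes "w \<in> punctured_disc"
  shows "f (x, w) \<le> rot_sup f x (tpar w)"
proof -
  obtain \<theta> where \<theta>: "\<theta> \<in> {0..2 * pi}" "w = of_real (exp (- (tpar w / 2))) * cis \<theta>"
    using punctured_disc_polar[OF assms] by blast
  have "f (x, of_real (exp (- (tpar w / 2))) * cis \<theta>) \<le> rot_sup f x (tpar w)"
    unfolding rot_sup_def by (rule SUP_upper[OF \<theta>(1)])
  then show ?thesis using \<theta>(2) by simp
qed

lemma rot_sup_le:
  assumes "\<And>w. w \<in> punctured_disc \<Longrightarrow> tpar w = t \<Longrightarrow> f (x, w) \<le> b" "t \<ge> 0"
  shows "rot_sup f x t \<le> b"
  unfolding rot_sup_def by (intro SUP_least assms polar_in_punctured_disc) (auto simp: assms(2))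

lemma usc_on_rot_sup:
  fixes f :: "'a::topological_space \<times> complex \<Rightarrow> ereal"
  assumes usc: "usc_on (V \<times> punctured_disc) f"
  shows "usc_on (V \<times> {0..}) (\<lambda>(x, t). rot_sup f x t)"
proof -
  have "usc_on ((V \<times> {0..}) \<times> {0..2 * pi}) (\<lambda>q. f (fst (fst q), of_real (exp (- (snd (fst q) / 2))) * cis (snd q)))"
    by (rule usc_on_compose[OF usc])
       (use polar_in_punctured_disc in \<open>auto intro!: continuous_intros\<close>)
  from usc_on_SUP_compact[OF this compact_Icc]
  have "usc_on (V \<times> {0..}) (\<lambda>p. rot_sup f (fst p) (snd p))" by (simp add: rot_sup_def)
  then show ?thesis by (simp add: case_prod_unfold)
qed

lemma rot_sup_not_PInf:
  fixes f :: "'a::topological_space \<times> complex \<Rightarrow> ereal"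
  assumes usc: "usc_on (V \<times> punctured_disc) f"
    and fin: "\<And>p. p \<in> V \<times> punctured_disc \<Longrightarrow> f p \<noteq> \<infinity>" and x: "x \<in> V" and t: "t \<ge> 0"
  shows "rot_sup f x t \<noteq> \<infinity>"
proof -
  have usc': "usc_on {0..2 * pi} (\<lambda>\<theta>. f (x, of_real (exp (- (t / 2))) * cis \<theta>))"
  proof (rule usc_on_compose[OF usc])
    show "(\<lambda>\<theta>. (x, of_real (exp (- (t / 2))) * cis \<theta>)) ` {0..2 * pi} \<subseteq> V \<times> punctured_disc"
      using x polar_in_punctured_disc[OF t] by blast
  qed (intro continuous_intros)
  have fin': "f (x, of_real (exp (- (t / 2))) * cis \<theta>) \<noteq> \<infinity>" for \<theta>
    using fin x polar_in_punctured_disc[OF t] by blast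
  obtain M where "\<And>\<theta>. \<theta> \<in> {0..2 * pi} \<Longrightarrow> f (x, of_real (exp (- (t / 2))) * cis \<theta>) \<le> ereal M"
    using usc_on_bounded_above[OF usc' compact_Icc fin'] by metis
  then have "rot_sup f x t \<le> ereal M" unfolding rot_sup_def by (intro SUP_least)
  then show ?thesis by auto
qed

text \<open>Hadamard's three circles theorem. If it failed, \<open>f - (a + bt) + \<epsilon>|w|\<^sup>2\<close> would have an interior
  maximum in the annulus for small \<open>\<epsilon>\<close>; as \<open>a + bt\<close> is harmonic there and \<open>|w|\<^sup>2\<close> is strictly
  subharmonic, this contradicts the submean inequality. Convexity in \<open>t\<close> is stated as a comparison with
  affine functions because this form also covers the value \<open>-\<infinity>\<close>.\<close>

lemma rot_sup_three_circles:
  fixes f :: "'a::complex_normed \<times> complex \<Rightarrow> ereal"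
  assumes psh: "psh_on f (V \<times> (ball 0 1 - {0}))"
    and usc: "usc_on (V \<times> punctured_disc) f"
    and fin: "\<And>p. p \<in> V \<times> punctured_disc \<Longrightarrow> f p \<noteq> \<infinity>"
    and x: "x \<in> V" and t: "0 \<le> t1" "t1 \<le> t" "t \<le> t2"
    and le1: "rot_sup f x t1 \<le> ereal (a + b * t1)" and le2: "rot_sup f x t2 \<le> ereal (a + b * t2)"
  shows "rot_sup f x t \<le> ereal (a + b * t)"
proof (rule rot_sup_le)
  fix w0 assume w0: "w0 \<in> punctured_disc" "tpar w0 = t"
  show "f (x, w0) \<le> ereal (a + b * t)"
  proof (rule ccontr)
    assume neg: "\<not> ?thesis"
    have "f (x, w0) \<noteq> \<infinity>" using fin x w0 by auto
    with neg obtain F0 where F0: "f (x, w0) = ereal F0" "F0 > a + b * t" by (cases "f (x, w0)") auto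
    define \<epsilon> where "\<epsilon> = (F0 - a - b * t) / 2"
    have \<epsilon>: "\<epsilon> > 0" using F0 by (simp add: \<epsilon>_def)
    define A where "A = {w. exp (- (t2 / 2)) \<le> cmod w \<and> cmod w \<le> exp (- (t1 / 2))}"
    have ex: "exp (- (t1 / 2)) \<le> 1" using t by simp
    have Apd: "A \<subseteq> punctured_disc"
    proof
      fix w assume "w \<in> A"
      then have "exp (- (t2 / 2)) \<le> cmod w" "cmod w \<le> exp (- (t1 / 2))" by (auto simp: A_def)
      then have "0 < cmod w" "cmod w \<le> 1" using ex exp_gt_zero[of "- (t2 / 2)"] by linarith+
      then show "w \<in> punctured_disc" by (auto simp: punctured_disc_def)
    qed
    have Ac: "compact A"
    proof -
      have "A = cball 0 (exp (- (t1 / 2))) \<inter> {w. exp (- (t2 / 2)) \<le> cmod w}" by (auto simp: A_def)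
      moreover have "closed {w::complex. exp (- (t2 / 2)) \<le> cmod w}"
        by (intro closed_Collect_le continuous_intros)
      ultimately show ?thesis by (simp add: compact_Int_closed)
    qed
    have cw0: "cmod w0 = exp (- (t / 2))"
      using w0 by (auto simp: punctured_disc_def tpar_eq)
    have w0A: "w0 \<in> A" using t by (simp add: A_def cw0)
    define G where "G = (\<lambda>w. f (x, w) + ereal (- a - b * tpar w + \<epsilon> * (cmod w)\<^sup>2))"
    have 0: "0 \<notin> A" using Apd by (auto simp: punctured_disc_def)
    have Gusc: "usc_on A G" unfolding G_def
      by (intro usc_on_add_continuous usc_on_compose[OF usc] continuous_intros continuous_on_tpar[OF 0]) (use x Apd in auto)
    obtain w1 where w1: "w1 \<in> A" "\<And>y. y \<in> A \<Longrightarrow> G y \<le> G w1"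
      using usc_on_attains_sup[OF Gusc Ac] w0A by blast
    have "ereal \<epsilon> < G w0"
    proof -
      have "cmod w0 > 0" by (simp add: cw0)
      then have "\<epsilon> * (cmod w0)\<^sup>2 > 0" using \<epsilon> by simp
      then have "\<epsilon> < F0 - a - b * t + \<epsilon> * (cmod w0)\<^sup>2" using \<epsilon> unfolding \<epsilon>_def by argo
      then show ?thesis using F0 w0 by (simp add: G_def)
    qed
    also have "G w0 \<le> G w1" by (rule w1(2)[OF w0A])
    finally have G1: "ereal \<epsilon> < G w1" .
    have w1pd: "w1 \<in> punctured_disc" using w1 Apd by auto
    then have w1n: "w1 \<noteq> 0" "cmod w1 \<le> 1" by (auto simp: punctured_disc_def)
    have "f (x, w1) \<noteq> \<infinity>" using fin x w1pd by auto
    with G1 obtain F1 where F1: "f (x, w1) = ereal F1" by (cases "f (x, w1)") (auto simp: G_def)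
    define m where "m = F1 - a - b * tpar w1 + \<epsilon> * (cmod w1)\<^sup>2"
    have m: "G w1 = ereal m" by (simp add: G_def F1 m_def)
    have no: "\<not> f (x, w1) \<le> ereal (a + b * tpar w1)"
    proof
      assume "f (x, w1) \<le> ereal (a + b * tpar w1)"
      then have "m \<le> \<epsilon> * (cmod w1)\<^sup>2" by (simp add: F1 m_def)
      also have "\<dots> \<le> \<epsilon> * 1" using \<epsilon> w1n by (intro mult_left_mono) (auto intro: power_le_one)
      finally show False using G1 m by simp
    qed
    have ne: "cmod w1 \<noteq> exp (- (s / 2))" if "rot_sup f x s \<le> ereal (a + b * s)" for s
    proof
      assume "cmod w1 = exp (- (s / 2))"
      then have "tpar w1 = s" using w1n by (simp add: tpar_eq)
      then show False using no le_rot_sup[OF w1pd, of f x] that by (metis order_trans)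
    qed
    then have strict: "exp (- (t2 / 2)) < cmod w1" "cmod w1 < exp (- (t1 / 2))"
      using ne[OF le1] ne[OF le2] w1(1) by (auto simp: A_def order_less_le)
    define r where "r = min (cmod w1 - exp (- (t2 / 2))) (exp (- (t1 / 2)) - cmod w1)"
    have r: "r > 0" "r \<le> cmod w1 - exp (- (t2 / 2))" "r \<le> exp (- (t1 / 2)) - cmod w1" using strict by (auto simp: r_def)
    define r' where "r' = r / 2"
    have r': "r' > 0" "r' < cmod w1 - exp (- (t2 / 2))" "r' < exp (- (t1 / 2)) - cmod w1" using r by (auto simp: r'_def)
    have in_ann: "exp (- (t2 / 2)) < cmod (w1 + \<zeta> * of_real r') \<and> cmod (w1 + \<zeta> * of_real r') < exp (- (t1 / 2))"
      if "cmod \<zeta> \<le> 1" for \<zeta>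
    proof -
      have 1: "cmod (\<zeta> * of_real r') \<le> r'" using that r' by (simp add: norm_mult mult_left_le_one_le)
      have "cmod (w1 + \<zeta> * of_real r') \<le> cmod w1 + cmod (\<zeta> * of_real r')" by (rule norm_triangle_ineq)
      moreover have "cmod w1 - cmod (\<zeta> * of_real r') \<le> cmod (w1 + \<zeta> * of_real r')"
        by (metis add_diff_cancel norm_triangle_ineq2 diff_minus_eq_add norm_minus_cancel)
      ultimately show ?thesis using 1 r' by linarith
    qed
    then have nz: "w1 + \<zeta> * of_real r' \<noteq> 0" if "cmod \<zeta> \<le> 1" for \<zeta>
      using that by (metis exp_gt_zero less_trans norm_zero order_less_irrefl)
    obtain h S where h: "h holomorphic_on S" "open S" "cball 0 1 \<subseteq> S"
      "\<And>\<zeta>. cmod \<zeta> \<le> 1 \<Longrightarrow> Re (h \<zeta>) = tpar (w1 + \<zeta> * of_real r')"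
      using tpar_harmonic[of w1 "of_real r'", OF nz] by metis
    define H where "H = (\<lambda>\<zeta>. of_real (m + a - \<epsilon> * (cmod w1)\<^sup>2 - \<epsilon> * r'\<^sup>2) + of_real b * h \<zeta> - of_real (2 * \<epsilon>) * (cnj w1 * (\<zeta> * of_real r')))"
    have H: "H holomorphic_on S" unfolding H_def by (intro holomorphic_intros h)
    have Rm: "Re (of_real x * y) = x * Re y" for x y by simp
    have ReH: "Re (H \<zeta>) = m + a - \<epsilon> * (cmod w1)\<^sup>2 - \<epsilon> * r'\<^sup>2 + b * Re (h \<zeta>) - 2 * \<epsilon> * Re (cnj w1 * (\<zeta> * of_real r'))" for \<zeta>
      unfolding H_def by (simp only: plus_complex.simps minus_complex.simps Re_complex_of_real Rm)
    have "f (x, w1) \<le> ereal (Re (H 0))"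
    proof (rule psh_le_Re_holomorphic[OF psh _ H h(2,3)])
      fix \<zeta> :: complex assume \<zeta>: "cmod \<zeta> \<le> 1"
      have "cmod (w1 + \<zeta> * of_real r') < 1" using in_ann[OF \<zeta>] ex by linarith
      with nz[OF \<zeta>] show "(x, w1) + \<zeta> *\<^sub>C (0, of_real r') \<in> V \<times> (ball 0 1 - {0})"
        using x by (auto simp: linear_simps(3)[OF bounded_linear_scaleC_right])
    next
      fix \<zeta> :: complex assume \<zeta>: "cmod \<zeta> = 1"
      define u where "u = w1 + \<zeta> * of_real r'"
      have "u \<in> A" using in_ann[of \<zeta>] \<zeta> by (simp add: A_def u_def)
      then have "G u \<le> ereal m" using w1(2) m by metis
      then have 1: "f (x, u) \<le> ereal (m + a + b * tpar u - \<epsilon> * (cmod u)\<^sup>2)"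
        unfolding G_def by (cases "f (x, u)") auto
      have sq: "(cmod (x + y))\<^sup>2 = (cmod x)\<^sup>2 + 2 * Re (cnj x * y) + (cmod y)\<^sup>2" for x y :: complex
        unfolding cmod_power2 by (simp add: power2_eq_square algebra_simps)
      have 2: "(cmod u)\<^sup>2 = (cmod w1)\<^sup>2 + 2 * Re (cnj w1 * (\<zeta> * of_real r')) + r'\<^sup>2"
        unfolding u_def sq using \<zeta> by (simp add: norm_mult)
      have "Re (h \<zeta>) = tpar u" using h(4)[of \<zeta>] \<zeta> by (simp add: u_def)
      then have "m + a + b * tpar u - \<epsilon> * (cmod u)\<^sup>2 = Re (H \<zeta>)"
        unfolding ReH 2 by (simp only: ring_distribs mult.assoc)
      then have "f (x, u) \<le> ereal (Re (H \<zeta>))" using 1 by simp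
      then show "f ((x, w1) + \<zeta> *\<^sub>C (0, of_real r')) \<le> ereal (Re (H \<zeta>))"
        by (simp add: u_def linear_simps(3)[OF bounded_linear_scaleC_right])
    qed
    moreover have "Re (H 0) = F1 - \<epsilon> * r'\<^sup>2" using h(4)[of 0] by (simp add: ReH m_def)
    moreover have "\<epsilon> * r'\<^sup>2 > 0" using \<epsilon> r' by simp
    ultimately show False using F1 by simp
  qed
qed (use t in auto)

section \<open>Kiselman's minimum principle\<close>

lemma convex_rot_sup_sublevel:
  fixes f :: "'a::complex_normed \<times> complex \<Rightarrow> ereal"
  assumes psh: "psh_on f (V \<times> (ball 0 1 - {0}))"
    and usc: "usc_on (V \<times> punctured_disc) f"
    and fin: "\<And>p. p \<in> V \<times> punctured_disc \<Longrightarrow> f p \<noteq> \<infinity>" and x: "x \<in> V"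
  shows "convex {t. t > 0 \<and> rot_sup f x t + ereal (- l * t) < ereal b}" (is "convex ?C")
proof (rule is_interval_convex_1[THEN iffD1], unfold is_interval_1, intro ballI allI impI)
  fix t1 t2 t assume C: "t1 \<in> ?C" "t2 \<in> ?C" and t: "t1 \<le> t \<and> t \<le> t2"
  obtain r where r: "max (rot_sup f x t1 + ereal (- l * t1)) (rot_sup f x t2 + ereal (- l * t2)) < ereal r" "ereal r < ereal b"
    using ereal_dense2[of "max (rot_sup f x t1 + ereal (- l * t1)) (rot_sup f x t2 + ereal (- l * t2))" "ereal b"] C by auto
  have "rot_sup f x t1 \<le> ereal (r + l * t1)" using r(1) by (cases "rot_sup f x t1") auto
  moreover have "rot_sup f x t2 \<le> ereal (r + l * t2)" using r(1) by (cases "rot_sup f x t2") auto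
  ultimately have "rot_sup f x t \<le> ereal (r + l * t)"
    using C t by (intro rot_sup_three_circles[OF psh usc fin x, of t1 t t2]) auto
  then have "rot_sup f x t + ereal (- l * t) \<le> ereal r" by (cases "rot_sup f x t") auto
  also have "\<dots> < ereal b" by (rule r)
  finally show "t \<in> ?C" using C t by auto
qed

text \<open>Values that work on the members of a finite cover are glued with a partition of unity;
  convexity keeps the weighted mean in \<open>C x\<close>.\<close>

lemma continuous_selection:
  fixes S :: "'a::metric_space set" and C :: "'a \<Rightarrow> real set"
  assumes S: "compact S" and conv: "\<And>x. x \<in> S \<Longrightarrow> convex (C x)"
    and loc: "\<And>x. x \<in> S \<Longrightarrow> \<exists>N t. open N \<and> x \<in> N \<and> (\<forall>y\<in>N \<inter> S. t \<in> C y)"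
  obtains T where "continuous_on S T" "\<And>x. x \<in> S \<Longrightarrow> T x \<in> C x"
proof -
  obtain N \<tau> where N: "\<And>x. x \<in> S \<Longrightarrow> open (N x) \<and> x \<in> N x \<and> (\<forall>y\<in>N x \<inter> S. \<tau> x \<in> C y)"
    using loc by metis
  have "S \<subseteq> (\<Union>x\<in>S. N x)" using N by blast
  then obtain D where D: "D \<subseteq> S" "finite D" "S \<subseteq> (\<Union>x\<in>D. N x)"
    using compactE_image[OF S, of S N] N by metis
  define \<C> where "\<C> = N ` D"
  have fin: "finite \<C>" using D by (simp add: \<C>_def)
  have "\<exists>t. \<forall>y\<in>U \<inter> S. t \<in> C y" if "U \<in> \<C>" for U
  proof -
    obtain x where x: "x \<in> D" "U = N x" using \<open>U \<in> \<C>\<close> by (auto simp: \<C>_def)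
    then have "x \<in> S" using D by auto
    then show ?thesis using N x by blast
  qed
  then obtain s where "\<forall>U\<in>\<C>. \<forall>y\<in>U \<inter> S. s U \<in> C y" using bchoice[of \<C> "\<lambda>U t. \<forall>y\<in>U \<inter> S. t \<in> C y"] by auto
  then have s: "\<And>U y. U \<in> \<C> \<Longrightarrow> y \<in> U \<Longrightarrow> y \<in> S \<Longrightarrow> s U \<in> C y" by auto
  have cov: "S \<subseteq> \<Union>\<C>" using D by (simp add: \<C>_def)
  have op: "open U" if "U \<in> \<C>" for U using that N D by (auto simp: \<C>_def)
  have lf: "\<exists>V. open V \<and> x \<in> V \<and> finite {U \<in> \<C>. U \<inter> V \<noteq> {}}" for x
    using fin by (intro exI[of _ UNIV]) auto
  have "\<exists>F::'a set \<Rightarrow> 'a \<Rightarrow> real. (\<forall>U\<in>\<C>. continuous_on S (F U) \<and> (\<forall>x\<in>S. 0 \<le> F U x))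
      \<and> (\<forall>U\<in>\<C>. \<forall>x\<in>S. x \<notin> U \<longrightarrow> F U x = 0) \<and> (\<forall>x\<in>S. supp_sum (\<lambda>W. F W x) \<C> = 1)"
  proof (rule subordinate_partition_of_unity[OF cov op lf])
    fix F :: "'a set \<Rightarrow> 'a \<Rightarrow> real"
    assume "\<And>U. U \<in> \<C> \<Longrightarrow> continuous_on S (F U) \<and> (\<forall>x \<in> S. 0 \<le> F U x)"
      "\<And>x U. \<lbrakk>U \<in> \<C>; x \<in> S; x \<notin> U\<rbrakk> \<Longrightarrow> F U x = 0"
      "\<And>x. x \<in> S \<Longrightarrow> supp_sum (\<lambda>W. F W x) \<C> = 1"
    then show ?thesis by (intro exI[of _ F]) simp
  qed
  then obtain F :: "'a set \<Rightarrow> 'a \<Rightarrow> real" where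
      F': "\<forall>U\<in>\<C>. continuous_on S (F U) \<and> (\<forall>x\<in>S. 0 \<le> F U x)"
         "\<forall>U\<in>\<C>. \<forall>x\<in>S. x \<notin> U \<longrightarrow> F U x = 0" "\<forall>x\<in>S. supp_sum (\<lambda>W. F W x) \<C> = 1"
    by (elim exE conjE) (rule that)
  define T where "T = (\<lambda>x. \<Sum>U\<in>\<C>. F U x * s U)"
  have "continuous_on S T" unfolding T_def using F'(1) by (intro continuous_intros) auto
  moreover have "T x \<in> C x" if x: "x \<in> S" for x
  proof -
    define \<D> where "\<D> = {U \<in> \<C>. x \<in> U}"
    have out: "F U x = 0" if "U \<in> \<C> - \<D>" for U using that F'(2) x by (auto simp: \<D>_def)
    have sub: "\<D> \<subseteq> \<C>" by (auto simp: \<D>_def)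
    have "(\<Sum>U\<in>\<D>. F U x) = (\<Sum>U\<in>\<C>. F U x)"
      by (rule sum.mono_neutral_left[OF fin sub]) (use out in auto)
    also have "\<dots> = supp_sum (\<lambda>W. F W x) \<C>" unfolding supp_sum_def
      by (rule sum.mono_neutral_right[OF fin]) (auto simp: support_on_def)
    finally have 1: "(\<Sum>U\<in>\<D>. F U x) = 1" using F'(3) x by simp
    have "(\<Sum>U\<in>\<D>. F U x *\<^sub>R s U) \<in> C x"
      by (rule convex_sum[OF finite_subset[OF sub fin] conv[OF x] 1]) (use F'(1) s x in \<open>auto simp: \<D>_def\<close>)
    also have "(\<Sum>U\<in>\<D>. F U x *\<^sub>R s U) = T x" unfolding T_def real_scaleR_def
      by (rule sum.mono_neutral_left[OF fin sub]) (use out in auto)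
    finally show ?thesis .
  qed
  ultimately show ?thesis using that by blast
qed

text \<open>Over the boundary circle the parameters \<open>t\<close> with \<open>rot_sup f (z + \<zeta>v) t - lt < Re p \<zeta>\<close> form a nonempty
  open interval, so they can be selected as the real part of a polynomial \<open>G\<close>, which is then positive
  on the whole disc. The maximum principle on the disc \<open>\<zeta> \<mapsto> (z + \<zeta>v, e\<^sup>-\<^sup>G\<^sup>/\<^sup>2)\<close>, along which
  \<open>t = Re G\<close>, carries the bound from the circle to the centre.\<close>

lemma legendre_inf_le_Re_poly:
  fixes f :: "'a::complex_normed \<times> complex \<Rightarrow> ereal"
  assumes V: "open V" and psh: "psh_on f (V \<times> (ball 0 1 - {0}))"
    and usc: "usc_on (V \<times> punctured_disc) f"
    and fin: "\<And>p. p \<in> V \<times> punctured_disc \<Longrightarrow> f p \<noteq> \<infinity>"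
    and disc: "\<And>\<zeta>. cmod \<zeta> \<le> 1 \<Longrightarrow> z + \<zeta> *\<^sub>C v \<in> V"
    and le: "\<And>\<zeta>. cmod \<zeta> = 1 \<Longrightarrow> legendre_inf f l (z + \<zeta> *\<^sub>C v) < ereal (Re (poly p \<zeta>))"
  shows "legendre_inf f l z \<le> ereal (Re (poly p 0))"
proof -
  define R where "R = (\<lambda>\<zeta> t. rot_sup f (z + \<zeta> *\<^sub>C v) t)"
  define \<Psi> where "\<Psi> = (\<lambda>q. R (fst q) (snd q) + ereal (- l * snd q - Re (poly p (fst q))))"
  have "usc_on (sphere 0 1 \<times> {0..}) (\<lambda>q. (\<lambda>(x, t). rot_sup f x t) (z + fst q *\<^sub>C v, snd q))"
    by (rule usc_on_compose[OF usc_on_rot_sup[OF usc]]) (use disc in \<open>auto intro!: continuous_intros\<close>)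
  then have "usc_on (sphere 0 1 \<times> {0..}) (\<lambda>q. R (fst q) (snd q))" by (simp add: R_def)
  then have \<Psi>usc: "usc_on (sphere 0 1 \<times> {0..}) \<Psi>" unfolding \<Psi>_def
    by (rule usc_on_add_continuous) (intro continuous_intros)
  have "openin (top_of_set (sphere 0 1 \<times> {0..})) {q \<in> sphere 0 1 \<times> {0..}. \<Psi> q < 0}"
    using \<Psi>usc by (simp add: usc_on_def)
  then obtain W0 where W0: "open W0" "{q \<in> sphere 0 1 \<times> {0..}. \<Psi> q < 0} = sphere 0 1 \<times> {0..} \<inter> W0"
    unfolding openin_open by (elim exE conjE) (rule that)
  define W1 where "W1 = W0 \<inter> UNIV \<times> {0<..}"
  have W1: "open W1" unfolding W1_def using W0(1) by (intro open_Int open_Times) auto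
  have W1_iff: "(\<zeta>, t) \<in> W1 \<longleftrightarrow> t > 0 \<and> \<Psi> (\<zeta>, t) < 0" if "cmod \<zeta> = 1" for \<zeta> t
  proof -
    have "t > 0 \<Longrightarrow> (\<zeta>, t) \<in> {q \<in> sphere 0 1 \<times> {0..}. \<Psi> q < 0} \<longleftrightarrow> \<Psi> (\<zeta>, t) < 0" using that by auto
    then show ?thesis unfolding W0(2) using that by (auto simp: W1_def)
  qed
  have \<Psi>neg: "\<Psi> (\<zeta>, t) < 0 \<longleftrightarrow> R \<zeta> t + ereal (- l * t) < ereal (Re (poly p \<zeta>))" for \<zeta> t
    unfolding \<Psi>_def by (cases "R \<zeta> t") auto
  define C where "C = (\<lambda>\<zeta>. {t. t > 0 \<and> R \<zeta> t + ereal (- l * t) < ereal (Re (poly p \<zeta>))})"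
  have C_iff: "t \<in> C \<zeta> \<longleftrightarrow> (\<zeta>, t) \<in> W1" if "cmod \<zeta> = 1" for \<zeta> t
    unfolding W1_iff[OF that] \<Psi>neg C_def by simp
  obtain T where T: "continuous_on (sphere 0 1) T" "\<And>\<zeta>. \<zeta> \<in> sphere 0 1 \<Longrightarrow> T \<zeta> \<in> C \<zeta>"
  proof (rule continuous_selection[of "sphere (0::complex) 1" C])
    fix \<zeta> :: complex assume "\<zeta> \<in> sphere 0 1"
    then have \<zeta>: "cmod \<zeta> = 1" by simp
    show "convex (C \<zeta>)" unfolding C_def R_def
      by (rule convex_rot_sup_sublevel[OF psh usc fin disc]) (use \<zeta> in auto)
    obtain t where t: "t \<ge> 0" "R \<zeta> t + ereal (- l * t) < ereal (Re (poly p \<zeta>))"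
      using le[OF \<zeta>] by (auto simp: legendre_inf_def INF_less_iff R_def)
    have "(\<zeta>, t) \<in> {q \<in> sphere 0 1 \<times> {0..}. \<Psi> q < 0}" using t \<zeta> \<Psi>neg by auto
    then have "(\<zeta>, t) \<in> W0" unfolding W0(2) by simp
    from open_prod_elim[OF W0(1) this] obtain N M
      where NM: "open N" "open M" "(\<zeta>, t) \<in> N \<times> M" "N \<times> M \<subseteq> W0" by metis
    then obtain d where d: "d > 0" "ball t d \<subseteq> M" using open_contains_ball by blast
    \<comment> \<open>The infimum may be attained at \<open>t = 0\<close>, where the disc would meet the boundary.\<close>
    define t0 where "t0 = t + d / 2"
    have t0: "t0 > 0" "t0 \<in> M" using d t by (auto simp: t0_def dist_real_def)
    have "t0 \<in> C \<xi>" if "\<xi> \<in> N \<inter> sphere 0 1" for \<xi>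
    proof -
      have "(\<xi>, t0) \<in> W1" using that NM(4) t0 by (auto simp: W1_def)
      then show ?thesis using C_iff that by simp
    qed
    then show "\<exists>N t. open N \<and> \<zeta> \<in> N \<and> (\<forall>y\<in>N \<inter> sphere 0 1. t \<in> C y)" using NM by blast
  qed auto
  have "continuous_on (sphere 0 1) (\<lambda>\<zeta>. (\<zeta>, T \<zeta>))" by (intro continuous_intros T)
  then have "compact ((\<lambda>\<zeta>. (\<zeta>, T \<zeta>)) ` sphere 0 1)" by (rule compact_continuous_image) simp
  moreover have "(\<lambda>\<zeta>. (\<zeta>, T \<zeta>)) ` sphere 0 1 \<subseteq> W1" using T(2) C_iff by auto
  ultimately obtain e where e: "e > 0" "(\<Union>q\<in>(\<lambda>\<zeta>. (\<zeta>, T \<zeta>)) ` sphere 0 1. ball q e) \<subseteq> W1"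
    using compact_subset_open_imp_ball_epsilon_subset[OF _ W1] by metis
  obtain G where G: "\<And>\<zeta>. cmod \<zeta> = 1 \<Longrightarrow> \<bar>T \<zeta> - Re (poly G \<zeta>)\<bar> < e"
    using Re_poly_dense_on_circle[OF T(1) e(1)] by metis
  have GC: "Re (poly G \<zeta>) \<in> C \<zeta>" if "cmod \<zeta> = 1" for \<zeta>
  proof -
    have "(\<zeta>, Re (poly G \<zeta>)) \<in> ball (\<zeta>, T \<zeta>) e" using G[OF that] by (simp add: dist_Pair_Pair dist_real_def)
    moreover have "(\<zeta>, T \<zeta>) \<in> (\<lambda>\<zeta>. (\<zeta>, T \<zeta>)) ` sphere 0 1" using that by auto
    ultimately have "(\<zeta>, Re (poly G \<zeta>)) \<in> W1" using e(2) by blast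
    then show ?thesis using C_iff that by simp
  qed
  have Gpos: "Re (poly G \<zeta>) > 0" if "cmod \<zeta> \<le> 1" for \<zeta>
  proof -
    have "continuous_on (sphere 0 1) (\<lambda>\<zeta>. Re (poly G \<zeta>))" by (intro continuous_intros)
    then obtain \<xi> where \<xi>: "\<xi> \<in> sphere (0::complex) 1" "\<And>\<zeta>. \<zeta> \<in> sphere 0 1 \<Longrightarrow> Re (poly G \<xi>) \<le> Re (poly G \<zeta>)"
      using continuous_attains_inf[of "sphere (0::complex) 1" "\<lambda>\<zeta>. Re (poly G \<zeta>)"] by auto
    have pos: "Re (poly G \<xi>) > 0" using GC[of \<xi>] \<xi>(1) by (simp add: C_def)
    have "Re (- poly G \<zeta>) \<le> - Re (poly G \<xi>)"
    proof (rule maximum_real_frontier[of "\<lambda>\<zeta>. - poly G \<zeta>" "cball 0 1"])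
      show "continuous_on (closure (cball 0 1)) (\<lambda>\<zeta>. - poly G \<zeta>)" by (intro continuous_intros)
      show "(\<lambda>\<zeta>. - poly G \<zeta>) holomorphic_on interior (cball 0 1)" by (intro holomorphic_intros)
    qed (use \<xi> that in auto)
    then show ?thesis using pos by simp
  qed
  define t where "t = Re (poly G 0)"
  have t0: "t > 0" using Gpos[of 0] by (simp add: t_def)
  have "rot_sup f z t \<le> ereal (l * t + Re (poly p 0))"
    unfolding rot_sup_def
  proof (rule SUP_least)
    fix \<theta> :: real
    \<comment> \<open>The imaginary part of \<open>G\<close> only rotates the disc; the phase makes it pass through the given point.\<close>
    define w where "w = (\<lambda>\<zeta>. cis (\<theta> + Im (poly G 0) / 2) * exp (- (poly G \<zeta> / 2)))"
    have wn: "cmod (w \<zeta>) = exp (- (Re (poly G \<zeta>) / 2))" for \<zeta> by (simp add: w_def norm_mult)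
    have wt: "tpar (w \<zeta>) = Re (poly G \<zeta>)" for \<zeta>
    proof -
      have "w \<zeta> \<noteq> 0" by (simp add: w_def)
      then show ?thesis by (simp add: tpar_eq wn)
    qed
    have wd: "w \<zeta> \<in> ball 0 1 - {0}" if "cmod \<zeta> \<le> 1" for \<zeta>
      using Gpos[OF that] wn[of \<zeta>] by (auto simp: w_def)
    then have wpd: "w \<zeta> \<in> punctured_disc" if "cmod \<zeta> \<le> 1" for \<zeta>
      using that by (auto simp: punctured_disc_def less_imp_le)
    have "f (z, w 0) \<le> ereal (Re ((\<lambda>\<zeta>. of_real l * poly G \<zeta> + poly p \<zeta>) 0))"
    proof (rule psh_le_along_graph[OF psh])
      show "open (V \<times> (ball 0 1 - {0::complex}))" using V by (intro open_Times open_delete) auto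
      show "w holomorphic_on UNIV" unfolding w_def by (intro holomorphic_intros) simp
      show "(\<lambda>\<zeta>. of_real l * poly G \<zeta> + poly p \<zeta>) holomorphic_on UNIV" by (intro holomorphic_intros)
      show "(z + \<zeta> *\<^sub>C v, w \<zeta>) \<in> V \<times> (ball 0 1 - {0})" if "cmod \<zeta> \<le> 1" for \<zeta>
        using disc[OF that] wd[OF that] by blast
      fix \<zeta> :: complex assume \<zeta>: "cmod \<zeta> = 1"
      have "f (z + \<zeta> *\<^sub>C v, w \<zeta>) \<le> R \<zeta> (Re (poly G \<zeta>))"
        using le_rot_sup[OF wpd, of \<zeta> f "z + \<zeta> *\<^sub>C v"] \<zeta> by (simp add: wt R_def)
      also have "\<dots> \<le> ereal (l * Re (poly G \<zeta>) + Re (poly p \<zeta>))"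
        using GC[OF \<zeta>] unfolding C_def by (cases "R \<zeta> (Re (poly G \<zeta>))") auto
      finally show "f (z + \<zeta> *\<^sub>C v, w \<zeta>) \<le> ereal (Re (of_real l * poly G \<zeta> + poly p \<zeta>))" by simp
    qed
    moreover have "w 0 = of_real (exp (- (t / 2))) * cis \<theta>"
    proof -
      have "exp (- (poly G 0 / 2)) = of_real (exp (- (t / 2))) * cis (- (Im (poly G 0) / 2))"
        by (simp add: exp_eq_polar t_def)
      then have "w 0 = of_real (exp (- (t / 2))) * (cis (\<theta> + Im (poly G 0) / 2) * cis (- (Im (poly G 0) / 2)))"
        by (simp add: w_def mult_ac)
      then show ?thesis by (simp add: cis_mult)
    qed
    ultimately show "f (z, of_real (exp (- (t / 2))) * cis \<theta>) \<le> ereal (l * t + Re (poly p 0))"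
      by (simp add: t_def)
  qed
  then have "rot_sup f z t + ereal (- l * t) \<le> ereal (Re (poly p 0))" by (cases "rot_sup f z t") auto
  moreover have "legendre_inf f l z \<le> rot_sup f z t + ereal (- l * t)"
    unfolding legendre_inf_def using t0 by (intro INF_lower) auto
  ultimately show ?thesis by (rule order_trans[rotated])
qed

lemma usc_on_legendre_inf:
  fixes f :: "'a::topological_space \<times> complex \<Rightarrow> ereal"
  assumes usc: "usc_on (V \<times> punctured_disc) f"
  shows "usc_on V (legendre_inf f l)"
  unfolding legendre_inf_def
proof (rule usc_on_INF)
  fix t :: real assume t: "t \<in> {0..}"
  have "usc_on V (\<lambda>x. (\<lambda>(x, t). rot_sup f x t) (x, t))"
    by (rule usc_on_compose[OF usc_on_rot_sup[OF usc]]) (use t in \<open>auto intro!: continuous_intros\<close>)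
  then have "usc_on V (\<lambda>x. rot_sup f x t)" by simp
  then show "usc_on V (\<lambda>x. rot_sup f x t + ereal (- l * t))"
    by (rule usc_on_add_continuous) (intro continuous_intros)
qed

text \<open>For a rotation invariant \<open>f\<close> this is Kiselman's minimum principle. Polynomial majorants on the
  boundary circle decide the submean inequality, and the previous lemma treats these.\<close>

theorem psh_on_legendre_inf:
  fixes f :: "'a::complex_normed \<times> complex \<Rightarrow> ereal"
  assumes V: "open V" and psh: "psh_on f (V \<times> (ball 0 1 - {0}))"
    and usc: "usc_on (V \<times> punctured_disc) f"
    and fin: "\<And>p. p \<in> V \<times> punctured_disc \<Longrightarrow> f p \<noteq> \<infinity>"
  shows "psh_on (legendre_inf f l) V"
proof -
  have usc': "usc_on V (legendre_inf f l)" by (rule usc_on_legendre_inf[OF usc])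
  have fin': "legendre_inf f l x \<noteq> \<infinity>" if "x \<in> V" for x
  proof -
    have "legendre_inf f l x \<le> rot_sup f x 0 + ereal (- l * 0)"
      unfolding legendre_inf_def by (intro INF_lower) auto
    moreover have "rot_sup f x 0 \<noteq> \<infinity>" by (rule rot_sup_not_PInf[OF usc fin that]) auto
    ultimately show ?thesis by auto
  qed
  have "legendre_inf f l z \<le> circle_mean (legendre_inf f l) z v"
    if "\<forall>\<zeta>\<in>cball 0 1. z + \<zeta> *\<^sub>C v \<in> V" for z v
  proof (rule le_circle_mean_if_le_Re_poly[OF usc' fin'])
    show "legendre_inf f l z \<le> ereal (Re (poly p 0))"
      if "\<And>\<zeta>. cmod \<zeta> = 1 \<Longrightarrow> legendre_inf f l (z + \<zeta> *\<^sub>C v) < ereal (Re (poly p \<zeta>))" for p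
      by (rule legendre_inf_le_Re_poly[OF V psh usc fin _ that]) (use \<open>\<forall>\<zeta>\<in>cball 0 1. _\<close> in auto)
  qed (use that in auto)
  then show ?thesis using usc' fin' unfolding psh_on_def by blast
qed

section \<open>Ball averages\<close>

lemma nn_integral_lborel_translate:
  fixes h :: "'a::euclidean_space \<Rightarrow> ennreal"
  assumes [measurable]: "h \<in> borel_measurable borel"
  shows "(\<integral>\<^sup>+x. h (c + x) \<partial>lborel) = (\<integral>\<^sup>+x. h x \<partial>lborel)"
proof -
  have "(\<integral>\<^sup>+x. h x \<partial>lborel) = (\<integral>\<^sup>+x. h x \<partial>distr lborel borel ((+) c))" by (simp add: lborel_distr_plus)
  also have "\<dots> = (\<integral>\<^sup>+x. h (c + x) \<partial>lborel)" by (subst nn_integral_distr) auto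
  finally show ?thesis ..
qed

text \<open>Comparing the two sides of Fubini's theorem for \<open>B\<close> and the unit ball shows that Lebesgue
  measure and its image under an isometry are proportional; the unit ball itself fixes the factor.\<close>

lemma emeasure_lborel_vimage_isometry:
  fixes T :: "'a::euclidean_space \<Rightarrow> 'a"
  assumes T: "linear T" and T': "\<And>x. T (T' x) = x" and iso: "\<And>x. norm (T x) = norm x"
    and B: "B \<in> sets borel"
  shows "emeasure lborel {x. T x \<in> B} = emeasure lborel B"
proof -
  have Tm [measurable]: "T \<in> borel \<rightarrow>\<^sub>M borel"
    by (intro borel_measurable_continuous_onI linear_continuous_on linear_conv_bounded_linear[THEN iffD1] T)
  have [measurable]: "B \<in> sets borel" by (rule B)
  define A where "A = cball (0::'a) 1"
  have [measurable]: "A \<in> sets borel" by (simp add: A_def)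
  have A: "emeasure lborel A \<noteq> 0" "emeasure lborel A \<noteq> top"
  proof -
    have "emeasure lborel (ball (0::'a) 1) \<noteq> 0"
      using open_not_negligible[of "ball (0::'a) 1"] by (auto simp: negligible_iff_emeasure0)
    then show "emeasure lborel A \<noteq> 0" unfolding A_def
      using emeasure_mono[of "ball (0::'a) 1" "cball 0 1" lborel] by (metis ball_subset_cball borel_closed closed_cball le_zero_eq sets_lborel)
    show "emeasure lborel A \<noteq> top" unfolding A_def
      using emeasure_lborel_cball_finite[of "0::'a" 1] by auto
  qed
  have tr: "(\<integral>\<^sup>+y. indicator B (T y) \<partial>lborel) = (\<integral>\<^sup>+y. indicator B (x + T y) \<partial>lborel :: ennreal)" for x
  proof -
    have "x + T y = T (T' x + y)" for y using T by (simp add: linear_add T')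
    then show ?thesis
      using nn_integral_lborel_translate[of "\<lambda>y. indicator B (T y)" "T' x"] by simp
  qed
  have ball: "(\<integral>\<^sup>+y. indicator A (x - T y) \<partial>lborel) = emeasure lborel A" for x
  proof -
    have "x - T y \<in> A \<longleftrightarrow> - T' x + y \<in> A" for y
    proof -
      have "x - T y = T (T' x - y)" using T by (simp add: linear_diff T')
      then have "norm (x - T y) = norm (- T' x + y)" using iso by (metis norm_minus_commute add.commute diff_conv_add_uminus)
      then show ?thesis by (simp add: A_def)
    qed
    then have "(\<integral>\<^sup>+y. indicator A (x - T y) \<partial>lborel) = (\<integral>\<^sup>+y. indicator A (- T' x + y) \<partial>lborel :: ennreal)"
      by (intro nn_integral_cong) (simp add: indicator_def)
    also have "\<dots> = emeasure lborel A"
      using nn_integral_lborel_translate[of "indicator A" "- T' x"] by simp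
    finally show ?thesis .
  qed
  have "emeasure lborel A * emeasure lborel {x. T x \<in> B}
    = (\<integral>\<^sup>+x. indicator A x * (\<integral>\<^sup>+y. indicator B (T y) \<partial>lborel) \<partial>lborel)"
  proof -
    have m: "{x. T x \<in> B} \<in> sets lborel" using measurable_sets[OF Tm B] by (simp add: vimage_def)
    have "(\<integral>\<^sup>+y. indicator B (T y) \<partial>lborel) = (\<integral>\<^sup>+y. indicator {x. T x \<in> B} y \<partial>lborel :: ennreal)"
      by (intro nn_integral_cong) (simp add: indicator_def)
    also have "\<dots> = emeasure lborel {x. T x \<in> B}" using m by simp
    finally show ?thesis by (simp add: nn_integral_multc)
  qed
  also have "\<dots> = (\<integral>\<^sup>+x. (\<integral>\<^sup>+y. indicator A x * indicator B (x + T y) \<partial>lborel) \<partial>lborel)"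
  proof -
    have "indicator A x * (\<integral>\<^sup>+y. indicator B (T y) \<partial>lborel)
        = (\<integral>\<^sup>+y. indicator A x * indicator B (x + T y) \<partial>lborel :: ennreal)" for x :: 'a
      unfolding tr[of x] by (subst nn_integral_cmult) auto
    then show ?thesis by (simp only:)
  qed
  also have "\<dots> = (\<integral>\<^sup>+y. (\<integral>\<^sup>+x. indicator A x * indicator B (x + T y) \<partial>lborel) \<partial>lborel)"
    by (rule lborel_pair.Fubini') measurable
  also have "\<dots> = (\<integral>\<^sup>+y. (\<integral>\<^sup>+x. indicator A (x - T y) * indicator B x \<partial>lborel) \<partial>lborel)"
  proof (rule nn_integral_cong)
    fix y
    show "(\<integral>\<^sup>+x. indicator A x * indicator B (x + T y) \<partial>lborel) = (\<integral>\<^sup>+x. indicator A (x - T y) * indicator B x \<partial>lborel :: ennreal)"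
      using nn_integral_lborel_translate[of "\<lambda>x. indicator A (x - T y) * indicator B x" "T y"] by (simp add: add.commute)
  qed
  also have "\<dots> = (\<integral>\<^sup>+x. (\<integral>\<^sup>+y. indicator A (x - T y) * indicator B x \<partial>lborel) \<partial>lborel)"
    by (rule lborel_pair.Fubini') measurable
  also have "\<dots> = (\<integral>\<^sup>+x. emeasure lborel A * indicator B x \<partial>lborel)"
    by (rule nn_integral_cong, subst nn_integral_multc) (auto simp: ball)
  also have "\<dots> = emeasure lborel A * emeasure lborel B" by (simp add: nn_integral_cmult)
  finally show ?thesis using A by (simp add: ennreal_mult_cancel_left)
qed

lemma lborel_distr_isometry:
  fixes T :: "'a::euclidean_space \<Rightarrow> 'a"
  assumes T: "linear T" and T': "\<And>x. T (T' x) = x" and iso: "\<And>x. norm (T x) = norm x"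
  shows "distr lborel borel T = lborel"
proof (rule measure_eqI)
  fix B assume "B \<in> sets (distr lborel borel T)"
  then have B: "B \<in> sets borel" by simp
  have Tm: "T \<in> lborel \<rightarrow>\<^sub>M borel"
    using borel_measurable_continuous_onI[OF linear_continuous_on[OF linear_conv_bounded_linear[THEN iffD1, OF T]]] by simp
  show "emeasure (distr lborel borel T) B = emeasure lborel B"
    using emeasure_lborel_vimage_isometry[OF T T' iso B]
    by (simp add: emeasure_distr[OF Tm] B vimage_def)
qed simp

lemma bounded_bilinear_scaleC: "bounded_bilinear (\<lambda>a (v::'a::complex_normed). a *\<^sub>C v)"
proof
  fix a b :: complex and v w :: 'a and r :: real
  show "(a + b) *\<^sub>C v = a *\<^sub>C v + b *\<^sub>C v" by (rule scaleC_add_left)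
  show "a *\<^sub>C (v + w) = a *\<^sub>C v + a *\<^sub>C w" by (rule scaleC_add_right)
  show "(r *\<^sub>R a) *\<^sub>C v = r *\<^sub>R a *\<^sub>C v" by (rule linear_simps(5)[OF bounded_linear_scaleC_left])
  show "a *\<^sub>C r *\<^sub>R v = r *\<^sub>R a *\<^sub>C v" by (rule linear_simps(5)[OF bounded_linear_scaleC_right])
  show "\<exists>K. \<forall>a (v::'a). norm (a *\<^sub>C v) \<le> norm a * norm v * K"
    by (intro exI[of _ 1]) (simp add: norm_scaleC)
qed

text \<open>For each \<open>\<theta>\<close> the map \<open>v \<mapsto> z + e\<^sup>2\<^sup>\<pi>\<^sup>i\<^sup>\<theta> v\<close> carries the ball around \<open>0\<close> to the ball around \<open>z\<close> and
  preserves volume, so after exchanging the integrals the inner one is constant.\<close>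

lemma nn_integral_ball_circle:
  fixes h :: "'a::{complex_normed, euclidean_space} \<Rightarrow> ennreal"
  assumes hm [measurable]: "h \<in> borel_measurable borel"
  shows "(\<integral>\<^sup>+v\<in>cball 0 R. (\<integral>\<^sup>+\<theta>\<in>{0..1}. h (z + cis (2 * pi * \<theta>) *\<^sub>C v) \<partial>lborel) \<partial>lborel)
       = (\<integral>\<^sup>+x\<in>cball z R. h x \<partial>lborel)"
proof -
  define k where "k = (\<lambda>x. h x * indicator (cball z R) x)"
  have [measurable]: "cball z R \<in> sets borel" by simp
  have km [measurable]: "k \<in> borel_measurable borel" unfolding k_def by measurable
  have cont: "continuous_on UNIV (\<lambda>p::'a \<times> real. z + cis (2 * pi * snd p) *\<^sub>C fst p)"
    by (intro continuous_intros bounded_bilinear.continuous_on[OF bounded_bilinear_scaleC])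
  have cm [measurable]: "(\<lambda>p::'a \<times> real. z + cis (2 * pi * snd p) *\<^sub>C fst p) \<in> borel \<Otimes>\<^sub>M borel \<rightarrow>\<^sub>M borel"
    unfolding borel_prod by (rule borel_measurable_continuous_onI[OF cont])
  have km2: "(\<lambda>p. k (z + cis (2 * pi * snd p) *\<^sub>C fst p) * indicator {0..1} (snd p)) \<in> borel_measurable (lborel \<Otimes>\<^sub>M lborel)"
  proof -
    have "(\<lambda>p. k (z + cis (2 * pi * snd p) *\<^sub>C fst p)) \<in> borel_measurable (borel \<Otimes>\<^sub>M borel)"
      by (rule measurable_compose[OF cm km])
    then have "(\<lambda>p. k (z + cis (2 * pi * snd p) *\<^sub>C fst p) * indicator {0..1} (snd p)) \<in> borel_measurable (borel \<Otimes>\<^sub>M borel)"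
      by measurable
    then show ?thesis by (simp add: lborel_prod borel_prod)
  qed
  have in_ball: "v \<in> cball 0 R \<longleftrightarrow> z + cis a *\<^sub>C v \<in> cball z R" for v a
    by (simp add: dist_norm norm_scaleC)
  have rot: "(\<integral>\<^sup>+v. k (z + cis a *\<^sub>C v) \<partial>lborel) = (\<integral>\<^sup>+x. k x \<partial>lborel)" for a
  proof -
    have lin: "linear (\<lambda>v::'a. cis a *\<^sub>C v)"
      by (rule bounded_linear.linear[OF bounded_linear_scaleC_right])
    have inv: "cis a *\<^sub>C (cis (- a) *\<^sub>C v) = v" for v :: 'a
      by (simp add: scaleC_scaleC cis_mult)
    have m: "(\<lambda>v::'a. cis a *\<^sub>C v) \<in> lborel \<rightarrow>\<^sub>M borel"
      using borel_measurable_continuous_onI[OF linear_continuous_on[OF bounded_linear_scaleC_right]] by simp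
    have "(\<integral>\<^sup>+v. k (z + cis a *\<^sub>C v) \<partial>lborel) = (\<integral>\<^sup>+v. k (z + v) \<partial>distr lborel borel (\<lambda>v. cis a *\<^sub>C v))"
      by (subst nn_integral_distr[OF m]) auto
    also have "\<dots> = (\<integral>\<^sup>+v. k (z + v) \<partial>lborel)"
      by (subst lborel_distr_isometry[OF lin inv]) (simp_all add: norm_scaleC)
    also have "\<dots> = (\<integral>\<^sup>+x. k x \<partial>lborel)" by (rule nn_integral_lborel_translate) measurable
    finally show ?thesis .
  qed
  have pt: "(\<integral>\<^sup>+\<theta>\<in>{0..1}. h (z + cis (2 * pi * \<theta>) *\<^sub>C v) \<partial>lborel) * indicator (cball 0 R) v
      = (\<integral>\<^sup>+\<theta>. k (z + cis (2 * pi * \<theta>) *\<^sub>C v) * indicator {0..1} \<theta> \<partial>lborel)" for v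
  proof (cases "v \<in> cball 0 R")
    case True
    then have "k (z + cis (2 * pi * \<theta>) *\<^sub>C v) = h (z + cis (2 * pi * \<theta>) *\<^sub>C v)" for \<theta>
      using in_ball[of v "2 * pi * \<theta>"] unfolding k_def by (simp only: indicator_simps mult_1_right)
    then show ?thesis using True by (simp only: indicator_simps mult_1_right)
  next
    case False
    then have "z + cis (2 * pi * \<theta>) *\<^sub>C v \<notin> cball z R" for \<theta> using in_ball by blast
    then have "k (z + cis (2 * pi * \<theta>) *\<^sub>C v) = 0" for \<theta>
      unfolding k_def by (simp del: mem_cball)
    then show ?thesis using False by (simp only: indicator_simps) simp
  qed
  have "(\<integral>\<^sup>+v\<in>cball 0 R. (\<integral>\<^sup>+\<theta>\<in>{0..1}. h (z + cis (2 * pi * \<theta>) *\<^sub>C v) \<partial>lborel) \<partial>lborel)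
    = (\<integral>\<^sup>+v. (\<integral>\<^sup>+\<theta>. k (z + cis (2 * pi * \<theta>) *\<^sub>C v) * indicator {0..1} \<theta> \<partial>lborel) \<partial>lborel)"
    unfolding pt ..
  also have "\<dots> = (\<integral>\<^sup>+\<theta>. (\<integral>\<^sup>+v. k (z + cis (2 * pi * \<theta>) *\<^sub>C v) * indicator {0..1} \<theta> \<partial>lborel) \<partial>lborel)"
    by (rule lborel_pair.Fubini'[symmetric]) (use km2 in \<open>simp add: case_prod_unfold\<close>)
  also have "\<dots> = (\<integral>\<^sup>+\<theta>. (\<integral>\<^sup>+x. k x \<partial>lborel) * indicator {0..1} (\<theta>::real) \<partial>lborel)"
  proof (rule nn_integral_cong)
    fix \<theta> :: real
    have "(\<lambda>v. k (z + cis (2 * pi * \<theta>) *\<^sub>C v)) \<in> borel_measurable lborel"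
    proof -
      have "continuous_on UNIV (\<lambda>v::'a. z + cis (2 * pi * \<theta>) *\<^sub>C v)"
        by (intro continuous_intros bounded_linear.continuous_on[OF bounded_linear_scaleC_right])
      from measurable_compose[OF borel_measurable_continuous_onI[OF this] km] show ?thesis by simp
    qed
    then show "(\<integral>\<^sup>+v. k (z + cis (2 * pi * \<theta>) *\<^sub>C v) * indicator {0..1} \<theta> \<partial>lborel) = (\<integral>\<^sup>+x. k x \<partial>lborel) * indicator {0..1} \<theta>"
      by (subst nn_integral_multc) (auto simp: rot)
  qed
  also have "\<dots> = (\<integral>\<^sup>+x. k x \<partial>lborel)" by (simp add: nn_integral_cmult)
  finally show ?thesis by (simp add: k_def)
qed

text \<open>The submean inequality is averaged over all directions \<open>v\<close> in the ball. Only the positive part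
  of \<open>f\<close> enters, so that any nonnegative majorant will do.\<close>

lemma psh_ball_average:
  fixes f :: "'a::{complex_normed, euclidean_space} \<Rightarrow> ereal"
  assumes psh: "psh_on f U" and U: "cball z R \<subseteq> U"
    and h: "h \<in> borel_measurable borel" "\<And>x. x \<in> cball z R \<Longrightarrow> e2ennreal (f x) \<le> h x"
  shows "e2ennreal (f z) * emeasure lborel (cball z R) \<le> (\<integral>\<^sup>+x\<in>cball z R. h x \<partial>lborel)"
proof -
  have "e2ennreal (f z) * indicator (cball 0 R) v
     \<le> (\<integral>\<^sup>+\<theta>\<in>{0..1}. h (z + cis (2 * pi * \<theta>) *\<^sub>C v) \<partial>lborel) * indicator (cball 0 R) v" for v
  proof (cases "v \<in> cball 0 R")
    case True
    have in_ball: "z + \<zeta> *\<^sub>C v \<in> cball z R" if "cmod \<zeta> \<le> 1" for \<zeta>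
    proof -
      have "cmod \<zeta> * norm v \<le> 1 * norm v" using that by (intro mult_right_mono) auto
      then show ?thesis using True by (simp add: dist_norm norm_scaleC)
    qed
    then have "f z \<le> circle_mean f z v" using psh U unfolding psh_on_def by (meson mem_cball_0 subsetD)
    also have "\<dots> \<le> enn2ereal (\<integral>\<^sup>+\<theta>\<in>{0..1}. e2ennreal (f (z + cis (2 * pi * \<theta>) *\<^sub>C v)) \<partial>lborel)"
      unfolding circle_mean_def by (simp add: ereal_diff_le_self)
    finally have "e2ennreal (f z) \<le> (\<integral>\<^sup>+\<theta>\<in>{0..1}. e2ennreal (f (z + cis (2 * pi * \<theta>) *\<^sub>C v)) \<partial>lborel)"
      by (metis e2ennreal_enn2ereal e2ennreal_mono)
    also have "\<dots> \<le> (\<integral>\<^sup>+\<theta>\<in>{0..1}. h (z + cis (2 * pi * \<theta>) *\<^sub>C v) \<partial>lborel)"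
      by (intro nn_integral_mono mult_right_mono h(2) in_ball) auto
    finally show ?thesis by (intro mult_right_mono) auto
  qed simp
  then have "(\<integral>\<^sup>+v\<in>cball (0::'a) R. e2ennreal (f z) \<partial>lborel) \<le>
     (\<integral>\<^sup>+v\<in>cball 0 R. (\<integral>\<^sup>+\<theta>\<in>{0..1}. h (z + cis (2 * pi * \<theta>) *\<^sub>C v) \<partial>lborel) \<partial>lborel)"
    by (intro nn_integral_mono)
  also have "\<dots> = (\<integral>\<^sup>+x\<in>cball z R. h x \<partial>lborel)" by (rule nn_integral_ball_circle[OF h(1)])
  finally have 1: "e2ennreal (f z) * emeasure lborel (cball 0 R :: 'a set) \<le> (\<integral>\<^sup>+x\<in>cball z R. h x \<partial>lborel)"
    by (subst (asm) nn_integral_cmult_indicator) auto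
  have "emeasure lborel (cball z R) = (\<integral>\<^sup>+x. indicator (cball z R) (z + x) \<partial>lborel)"
    by (subst nn_integral_lborel_translate) (auto intro!: borel_measurable_indicator)
  also have "\<dots> = (\<integral>\<^sup>+x. indicator (cball (0::'a) R) x \<partial>lborel)"
    by (intro nn_integral_cong) (simp add: indicator_def dist_norm)
  finally show ?thesis using 1 by simp
qed

text \<open>The same average, for the distance of \<open>f\<close> to an upper bound: a finite value at the centre makes
  it finite.\<close>

lemma psh_integrable_ball:
  fixes f :: "'a::{complex_normed, euclidean_space} \<Rightarrow> ereal"
  assumes psh: "psh_on f U" and U: "cball z R \<subseteq> U" and M: "M \<ge> 0" "\<And>x. x \<in> cball z R \<Longrightarrow> f x \<le> ereal M"
    and z: "f z \<noteq> -\<infinity>" and R: "R > 0"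
  shows "(\<integral>\<^sup>+x\<in>cball z R. e2ennreal (ereal M - f x) \<partial>lborel) < \<infinity>"
proof -
  have usc: "usc_on U f" using psh by (simp add: psh_on_def)
  define h where "h = (\<lambda>x. e2ennreal (ereal M - (if x \<in> cball z R then f x else ereal M)))"
  have hm: "h \<in> borel_measurable borel" unfolding h_def
    using usc_on_measurable[OF usc_on_subset[OF usc U], of "ereal M"] by measurable
  have "(\<integral>\<^sup>+\<theta>\<in>{0..1}. h (z + cis (2 * pi * \<theta>) *\<^sub>C v) \<partial>lborel) * indicator (cball 0 R) v
      \<le> e2ennreal (ereal M - f z) * indicator (cball 0 R) v" for v
  proof (cases "v \<in> cball 0 R")
    case True
    have in_ball: "z + \<zeta> *\<^sub>C v \<in> cball z R" if "cmod \<zeta> \<le> 1" for \<zeta>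
    proof -
      have "cmod \<zeta> * norm v \<le> 1 * norm v" using that by (intro mult_right_mono) auto
      then show ?thesis using True by (simp add: dist_norm norm_scaleC)
    qed
    have he: "h (z + cis (2 * pi * \<theta>) *\<^sub>C v) = e2ennreal (ereal M - f (z + cis (2 * pi * \<theta>) *\<^sub>C v))" for \<theta>
      using in_ball[of "cis (2 * pi * \<theta>)"] unfolding h_def by simp
    have "f z \<le> circle_mean f z v" using psh U in_ball unfolding psh_on_def by (meson mem_cball_0 subsetD)
    also have "\<dots> = ereal M - enn2ereal (\<integral>\<^sup>+\<theta>\<in>{0..1}. h (z + cis (2 * pi * \<theta>) *\<^sub>C v) \<partial>lborel)"
      unfolding he
      by (rule circle_mean_eq_diff[OF usc_circle_measurable[OF usc]]) (use in_ball U M in auto)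
    finally have "enn2ereal (\<integral>\<^sup>+\<theta>\<in>{0..1}. h (z + cis (2 * pi * \<theta>) *\<^sub>C v) \<partial>lborel) \<le> ereal M - f z" (is "enn2ereal ?I \<le> _")
      using z by (cases "f z"; cases "enn2ereal ?I") auto
    then have "?I \<le> e2ennreal (ereal M - f z)" by (metis e2ennreal_enn2ereal e2ennreal_mono)
    then show ?thesis by (intro mult_right_mono) auto
  qed simp
  then have "(\<integral>\<^sup>+v\<in>cball 0 R. (\<integral>\<^sup>+\<theta>\<in>{0..1}. h (z + cis (2 * pi * \<theta>) *\<^sub>C v) \<partial>lborel) \<partial>lborel)
     \<le> (\<integral>\<^sup>+v\<in>cball (0::'a) R. e2ennreal (ereal M - f z) \<partial>lborel)"
    by (intro nn_integral_mono)
  also have "\<dots> = e2ennreal (ereal M - f z) * emeasure lborel (cball 0 R :: 'a set)"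
    by (rule nn_integral_cmult_indicator) simp
  also have "\<dots> < \<infinity>"
  proof -
    have "e2ennreal (ereal M - f z) < top" using z M(2)[of z] R by (cases "f z") (auto simp: e2ennreal_ereal)
    then show ?thesis using emeasure_lborel_cball_finite[of "0::'a" R] by (simp add: ennreal_mult_less_top)
  qed
  finally have "(\<integral>\<^sup>+x\<in>cball z R. h x \<partial>lborel) < \<infinity>" unfolding nn_integral_ball_circle[OF hm] .
  moreover have "(\<integral>\<^sup>+x\<in>cball z R. h x \<partial>lborel) = (\<integral>\<^sup>+x\<in>cball z R. e2ennreal (ereal M - f x) \<partial>lborel)"
    by (rule nn_integral_cong) (simp add: h_def indicator_def)
  ultimately show ?thesis by simp
qed

text \<open>The value \<open>-\<infinity>\<close> on an open set would make the integral of \<open>M - f\<close> infinite.\<close>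

lemma psh_not_MInf_dense:
  fixes f :: "'a::{complex_normed, euclidean_space} \<Rightarrow> ereal"
  assumes psh: "psh_on f U" and U: "cball z R \<subseteq> U" and z: "f z \<noteq> -\<infinity>" and R: "R > 0"
    and W: "open W" "W \<noteq> {}" "W \<subseteq> cball z R"
  shows "\<exists>x\<in>W. f x \<noteq> -\<infinity>"
proof (rule ccontr)
  assume "\<not> ?thesis"
  then have inf: "\<And>x. x \<in> W \<Longrightarrow> f x = -\<infinity>" by blast
  have usc: "usc_on (cball z R) f" and fin: "\<And>x. x \<in> cball z R \<Longrightarrow> f x \<noteq> \<infinity>"
    using psh U by (auto simp: psh_on_def intro: usc_on_subset)
  obtain M where M: "M \<ge> 0" "\<And>x. x \<in> cball z R \<Longrightarrow> f x \<le> ereal M"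
    using usc_on_bounded_above[OF usc compact_cball fin] by metis
  have "emeasure lborel W \<noteq> 0"
    using open_not_negligible[OF W(1,2)] W(1) by (auto simp: negligible_iff_emeasure0)
  then have "(\<infinity>::ennreal) = \<infinity> * emeasure lborel W" by (simp add: ennreal_top_mult)
  also have "\<dots> = (\<integral>\<^sup>+x\<in>W. \<infinity> \<partial>lborel)" using W(1) by (subst nn_integral_cmult_indicator) auto
  also have "\<dots> \<le> (\<integral>\<^sup>+x\<in>cball z R. e2ennreal (ereal M - f x) \<partial>lborel)"
  proof (rule nn_integral_mono)
    fix x
    show "\<infinity> * indicator W x \<le> e2ennreal (ereal M - f x) * indicator (cball z R) x"
      using inf[of x] W(3) by (auto simp: indicator_def e2ennreal_infty)
  qed
  also have "\<dots> < \<infinity>" by (rule psh_integrable_ball[OF psh U M z R])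
  finally show False by simp
qed

text \<open>The bound \<open>K\<close> serves all \<open>f\<close> at once. Since \<open>f0\<close> is finite at \<open>y\<close>, the function \<open>M0 - f0\<close> is
  integrable over the ball of radius \<open>2R\<close> around \<open>y\<close>, which contains the balls of radius \<open>R/2\<close> around all
  points \<open>x\<close> in question; so the averages of the majorant over these balls are uniformly bounded.\<close>

lemma psh_family_bounded_by_potential:
  fixes f0 :: "'a::{complex_normed, euclidean_space} \<Rightarrow> ereal"
  assumes psh: "psh_on f0 U" and U: "cball x0 (3 * R) \<subseteq> U" and R: "R > 0"
    and y: "dist x0 y < R" "f0 y \<noteq> -\<infinity>"
    and M0: "M0 \<ge> 0" "\<And>x. x \<in> cball x0 (3 * R) \<Longrightarrow> f0 x \<le> ereal M0" and ab: "a \<ge> 0" "b \<ge> 0"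
  obtains K :: real where "\<And>f x. psh_on f U \<Longrightarrow>
      (\<And>x. x \<in> cball x0 (3 * R) \<Longrightarrow> f x \<le> ereal a + ereal b * (ereal M0 - f0 x)) \<Longrightarrow>
      x \<in> cball x0 (R / 2) \<Longrightarrow> f x \<le> ereal K"
proof -
  define B where "B = cball x0 (3 * R)"
  have yB: "cball y (2 * R) \<subseteq> B"
  proof
    fix p assume "p \<in> cball y (2 * R)"
    then have "dist x0 p \<le> dist x0 y + dist y p" "dist y p \<le> 2 * R" by (auto simp: dist_triangle)
    then show "p \<in> B" using y(1) by (simp add: B_def)
  qed
  have usc: "usc_on B f0" using psh U unfolding psh_on_def B_def by (auto intro: usc_on_subset)
  define k where "k = (\<lambda>x. e2ennreal (ereal M0 - (if x \<in> B then f0 x else ereal M0)))"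
  have km [measurable]: "k \<in> borel_measurable borel" unfolding k_def
    using usc_on_measurable[OF usc, of "ereal M0"] by (simp add: B_def)
  have keq: "k x = e2ennreal (ereal M0 - f0 x)" if "x \<in> B" for x using that by (simp add: k_def)
  define I where "I = (\<integral>\<^sup>+x\<in>cball y (2 * R). k x \<partial>lborel)"
  have "I = (\<integral>\<^sup>+x\<in>cball y (2 * R). e2ennreal (ereal M0 - f0 x) \<partial>lborel)"
    unfolding I_def by (rule nn_integral_cong) (use yB keq in \<open>auto simp: indicator_def\<close>)
  also have "\<dots> < \<infinity>"
    by (rule psh_integrable_ball[OF psh _ M0(1) _ y(2)]) (use yB U M0(2) R in \<open>auto simp: B_def\<close>)
  finally have I: "I < top" by simp
  define vol where "vol = emeasure lborel (cball (0::'a) (R / 2))"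
  have vol_eq: "emeasure lborel (cball x (R / 2)) = vol" for x :: 'a
    using R by (simp add: vol_def emeasure_cball)
  have vol: "vol \<noteq> 0" "vol < top"
  proof -
    have "emeasure lborel (ball (0::'a) (R / 2)) \<noteq> 0"
      using open_not_negligible[of "ball (0::'a) (R / 2)"] R by (auto simp: negligible_iff_emeasure0)
    moreover have "emeasure lborel (ball (0::'a) (R / 2)) \<le> vol" unfolding vol_def
      by (rule emeasure_mono) auto
    ultimately show "vol \<noteq> 0" by auto
    show "vol < top" unfolding vol_def using emeasure_lborel_cball_finite[of "0::'a" "R / 2"] by simp
  qed
  define J where "J = ennreal a * vol + ennreal b * I"
  have J: "J < top" unfolding J_def using I vol by (simp add: ennreal_mult_less_top)
  define K where "K = enn2real (J / vol)"
  have JK: "J / vol = ennreal K"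
  proof -
    have "J / vol \<noteq> top" using J vol by (auto simp: ennreal_divide_eq_top_iff)
    then show ?thesis unfolding K_def by (simp add: less_top)
  qed
  show ?thesis
  proof (rule that[of K])
    fix f x assume f: "psh_on f U" and le: "\<And>x. x \<in> cball x0 (3 * R) \<Longrightarrow> f x \<le> ereal a + ereal b * (ereal M0 - f0 x)"
      and x: "x \<in> cball x0 (R / 2)"
    have xy: "cball x (R / 2) \<subseteq> cball y (2 * R)"
    proof
      fix p assume "p \<in> cball x (R / 2)"
      then have "dist x p \<le> R / 2" by simp
      moreover have "dist y p \<le> dist y x0 + dist x0 x + dist x p"
        by (meson add_mono dist_triangle order_refl order_trans)
      moreover have "dist x0 x \<le> R / 2" using x by simp
      ultimately show "p \<in> cball y (2 * R)" using y(1) by (simp add: dist_commute)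
    qed
    have "e2ennreal (f x) * emeasure lborel (cball x (R / 2)) \<le> (\<integral>\<^sup>+p\<in>cball x (R / 2). (ennreal a + ennreal b * k p) \<partial>lborel)"
    proof (rule psh_ball_average[OF f])
      show "cball x (R / 2) \<subseteq> U" using xy yB U by (auto simp: B_def)
      show "(\<lambda>p. ennreal a + ennreal b * k p) \<in> borel_measurable borel" by measurable
      fix p assume "p \<in> cball x (R / 2)"
      then have p: "p \<in> B" using xy yB by blast
      have "f p \<le> ereal a + ereal b * (ereal M0 - f0 p)" using le p by (simp add: B_def)
      then have "e2ennreal (f p) \<le> e2ennreal (ereal a + ereal b * (ereal M0 - f0 p))" by (rule e2ennreal_mono)
      also have "\<dots> = ennreal a + ennreal b * k p"
      proof (cases "f0 p")
        case (real r)
        have "r \<le> M0" using M0(2)[of p] p real by (simp add: B_def)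
        then show ?thesis using ab real unfolding keq[OF p]
          by (simp add: e2ennreal_ereal ennreal_mult)
      next
        case PInf
        then show ?thesis using M0(2)[of p] p by (simp add: B_def)
      next
        case MInf
        then show ?thesis using ab unfolding keq[OF p]
          by (cases "b = 0") (auto simp: e2ennreal_infty e2ennreal_ereal ennreal_mult_top)
      qed
      finally show "e2ennreal (f p) \<le> ennreal a + ennreal b * k p" .
    qed
    also have "\<dots> = ennreal a * emeasure lborel (cball x (R / 2)) + ennreal b * (\<integral>\<^sup>+p\<in>cball x (R / 2). k p \<partial>lborel)"
    proof -
      have [measurable]: "cball x (R / 2) \<in> sets borel" by simp
      have "(\<integral>\<^sup>+p\<in>cball x (R / 2). (ennreal a + ennreal b * k p) \<partial>lborel)
        = (\<integral>\<^sup>+p\<in>cball x (R / 2). ennreal a \<partial>lborel) + (\<integral>\<^sup>+p. ennreal b * (k p * indicator (cball x (R / 2)) p) \<partial>lborel)"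
        unfolding distrib_right mult.assoc by (rule nn_integral_add) measurable
      also have "(\<integral>\<^sup>+p. ennreal b * (k p * indicator (cball x (R / 2)) p) \<partial>lborel) = ennreal b * (\<integral>\<^sup>+p\<in>cball x (R / 2). k p \<partial>lborel)"
        by (rule nn_integral_cmult) measurable
      also have "(\<integral>\<^sup>+p\<in>cball x (R / 2). ennreal a \<partial>lborel) = ennreal a * emeasure lborel (cball x (R / 2))"
        by (rule nn_integral_cmult_indicator) simp
      finally show ?thesis .
    qed
    also have "\<dots> \<le> J" unfolding J_def vol_eq I_def
    proof (intro add_left_mono mult_left_mono nn_integral_mono)
      show "indicator (cball x (R / 2)) p \<le> (indicator (cball y (2 * R)) p :: ennreal)" for p
        using xy by (auto simp: indicator_def)
    qed auto
    finally have "e2ennreal (f x) * vol \<le> J" unfolding vol_eq .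
    then have "e2ennreal (f x) * vol / vol \<le> J / vol" by (rule divide_right_mono_ennreal)
    moreover have "e2ennreal (f x) * vol / vol = e2ennreal (f x)"
      by (rule mult_divide_eq_ennreal) (use vol in auto)
    ultimately have le: "e2ennreal (f x) \<le> ennreal K" by (simp add: JK)
    have K0: "K \<ge> 0" by (simp add: K_def)
    show "f x \<le> ereal K"
    proof (cases "f x \<le> 0")
      case True
      then show ?thesis using K0 by (meson ereal_less_eq(5) order_trans)
    next
      case False
      then have "f x = enn2ereal (e2ennreal (f x))" by (simp add: enn2ereal_e2ennreal)
      also have "\<dots> \<le> enn2ereal (ennreal K)" using le by (simp only: less_eq_ennreal.rep_eq)
      also have "\<dots> = ereal K" using K0 by (simp add: enn2ereal_ennreal)
      finally show ?thesis .
    qed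
  qed
qed

section \<open>Charts and frames\<close>

lemma atlas_chart:
  assumes A: "complex_atlas A" and W: "(W, \<kappa>) \<in> A"
  shows "open W" "homeomorphism W (\<kappa> ` W) \<kappa> (inv_into W \<kappa>)" "open (\<kappa> ` W)"
  using assms unfolding complex_atlas_def by fast+

lemma atlas_covers:
  assumes A: "complex_atlas A"
  obtains W \<kappa> where "(W, \<kappa>) \<in> A" "x \<in> W"
proof -
  have "x \<in> (\<Union>(W, \<kappa>)\<in>A. W)" using A by (simp add: complex_atlas_def)
  then show ?thesis using that by auto
qed

lemma chart_inverse:
  assumes A: "complex_atlas A" and W: "(W, \<kappa>) \<in> A"
  shows "x \<in> W \<Longrightarrow> inv_into W \<kappa> (\<kappa> x) = x"
    and "y \<in> \<kappa> ` (W \<inter> D) \<Longrightarrow> inv_into W \<kappa> y \<in> W \<inter> D"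
    and "continuous_on (\<kappa> ` (W \<inter> D)) (inv_into W \<kappa>)" "continuous_on W \<kappa>"
proof -
  note h = atlas_chart(2)[OF A W]
  show 1: "inv_into W \<kappa> (\<kappa> x) = x" if "x \<in> W" for x using homeomorphism_apply1[OF h that] .
  show "inv_into W \<kappa> y \<in> W \<inter> D" if "y \<in> \<kappa> ` (W \<inter> D)" using that 1 by auto
  show "continuous_on (\<kappa> ` (W \<inter> D)) (inv_into W \<kappa>)"
    by (rule continuous_on_subset[OF homeomorphism_cont2[OF h]]) auto
  show "continuous_on W \<kappa>" by (rule homeomorphism_cont1[OF h])
qed

lemma open_chart_image:
  assumes A: "complex_atlas A" and W: "(W, \<kappa>) \<in> A" and D: "open D"
  shows "open (\<kappa> ` (W \<inter> D))"
proof -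
  note h = atlas_chart[OF A W]
  have "\<kappa> ` (W \<inter> D) = \<kappa> ` W \<inter> inv_into W \<kappa> -` D"
    using chart_inverse(1)[OF A W] by auto
  then show ?thesis using continuous_open_preimage[OF homeomorphism_cont2[OF h(2)] h(3) D] by simp
qed

lemma open_chart_preimage:
  assumes A: "complex_atlas A" and W: "(W, \<kappa>) \<in> A" and D: "open D" and N: "open N"
  shows "open (W \<inter> D \<inter> \<kappa> -` N)"
proof -
  have "continuous_on (W \<inter> D) \<kappa>" using chart_inverse(4)[OF A W] continuous_on_subset by blast
  then show ?thesis using continuous_open_preimage[OF _ open_Int[OF atlas_chart(1)[OF A W] D] N] by simp
qed

lemma smooth_fun_continuous_on:
  assumes A: "complex_atlas A" and D: "open D" and s: "smooth_fun A D f"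
  shows "continuous_on D f"
proof -
  have "continuous_on (fst p \<inter> D) f" if p: "p \<in> A" for p
  proof -
    obtain W \<kappa> where W: "p = (W, \<kappa>)" by (cases p)
    have "smooth_on (f \<circ> inv_into W \<kappa>) (\<kappa> ` (W \<inter> D))" using s p W unfolding smooth_fun_def by blast
    then have "Ck_on 0 (f \<circ> inv_into W \<kappa>) (\<kappa> ` (W \<inter> D))" unfolding smooth_on_def by blast
    then have "continuous_on (\<kappa> ` (W \<inter> D)) (f \<circ> inv_into W \<kappa>)" by simp
    moreover have "continuous_on (W \<inter> D) \<kappa>"
      using chart_inverse(4)[OF A p[unfolded W]] continuous_on_subset by blast
    ultimately have "continuous_on (W \<inter> D) ((f \<circ> inv_into W \<kappa>) \<circ> \<kappa>)" by (rule continuous_on_compose[rotated])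
    moreover have "((f \<circ> inv_into W \<kappa>) \<circ> \<kappa>) x = f x" if "x \<in> W \<inter> D" for x
      using chart_inverse(1)[OF A p[unfolded W]] that by simp
    ultimately have "continuous_on (W \<inter> D) f" by (rule continuous_on_eq)
    then show ?thesis by (simp add: W)
  qed
  then have "continuous_on (\<Union>p\<in>A. fst p \<inter> D) f"
    using atlas_chart(1)[OF A] D by (intro continuous_on_open_UN) auto
  moreover have "(\<Union>p\<in>A. fst p \<inter> D) = D"
  proof (intro equalityI subsetI)
    fix x assume x: "x \<in> D"
    obtain W \<kappa> where "(W, \<kappa>) \<in> A" "x \<in> W" using atlas_covers[OF A] .
    then show "x \<in> (\<Union>p\<in>A. fst p \<inter> D)" using x by (intro UN_I[of "(W, \<kappa>)"]) auto
  qed auto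
  ultimately show ?thesis by simp
qed

lemma metric_on_not_PInf:
  assumes "metric_on S a L \<phi>" "x \<in> S" "x \<in> lb_dom L i"
  shows "\<phi> i x \<noteq> \<infinity>"
proof -
  have "\<forall>i. \<forall>x\<in>S \<inter> lb_dom L i. \<phi> i x \<noteq> \<infinity>" using assms(1) unfolding metric_on_def by (rule conjunct1)
  then show ?thesis using assms(2,3) by simp
qed

lemma metric_on_transition:
  assumes "metric_on S a L \<phi>" "x \<in> S" "x \<in> lb_dom L i" "x \<in> lb_dom L j"
  shows "\<phi> i x = \<phi> j x + ereal (a * ln ((cmod (lb_trans L i j x))\<^sup>2))"
proof -
  have "\<forall>i j. \<forall>x\<in>S \<inter> lb_dom L i \<inter> lb_dom L j. \<phi> i x = \<phi> j x + ereal (a * ln ((cmod (lb_trans L i j x))\<^sup>2))"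
    using assms(1) unfolding metric_on_def by (rule conjunct2)
  then show ?thesis using assms(2,3,4) by (metis IntI)
qed

lemma PSH_UNIV_D:
  assumes "\<gamma> \<in> PSH A UNIV a L"
  shows "metric_on UNIV a L \<gamma>" "usc_on (lb_dom L i) (\<gamma> i)"
    and "(W, \<kappa>) \<in> A \<Longrightarrow> psh_on (\<gamma> i \<circ> inv_into W \<kappa>) (\<kappa> ` (W \<inter> lb_dom L i))"
  using assms unfolding PSH_def psh_fun_def by auto

section \<open>The potentials of a test curve\<close>

text \<open>The transition terms of \<open>\<tau>\<close> and \<open>l\<sigma>\<close> cancel, so any frame computes the difference.\<close>

lemma metric_diff_eq:
  assumes \<tau>: "metric_on UNIV l F \<tau>" and \<sigma>: "metric_on UNIV 1 F (\<lambda>j x. ereal (\<sigma> j x))" and x: "x \<in> lb_dom F j"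
  shows "metric_diff F l \<tau> \<sigma> x = \<tau> j x - ereal (l * \<sigma> j x)"
proof -
  define k where "k = (SOME j. x \<in> lb_dom F j)"
  have k: "x \<in> lb_dom F k" unfolding k_def using x by (rule someI)
  define d where "d = ln ((cmod (lb_trans F k j x))\<^sup>2)"
  have 1: "\<tau> k x = \<tau> j x + ereal (l * d)" unfolding d_def by (rule metric_on_transition[OF \<tau> _ k x]) simp
  have "ereal (\<sigma> k x) = ereal (\<sigma> j x) + ereal (1 * d)" unfolding d_def by (rule metric_on_transition[OF \<sigma> _ k x]) simp
  then have 2: "\<sigma> k x = \<sigma> j x + d" by simp
  have "metric_diff F l \<tau> \<sigma> x = \<tau> k x - ereal (l * \<sigma> k x)"
    by (simp add: metric_diff_def k_def Let_def)
  also have "\<dots> = \<tau> j x - ereal (l * \<sigma> j x)" unfolding 1 2 by (cases "\<tau> j x") (auto simp: algebra_simps)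
  finally show ?thesis .
qed

locale test_curve_setup =
  fixes A :: "('x::t2_space, complex^'n) atlas" and F :: "('j, 'x) line_bundle"
    and \<sigma> :: "'j \<Rightarrow> 'x \<Rightarrow> real" and \<psi> :: "real \<Rightarrow> 'j \<Rightarrow> 'x \<Rightarrow> ereal" and c :: real
  assumes X: "compact_complex_manifold A"
    and F: "holomorphic_line_bundle A F" and \<sigma>: "smooth_metric A F \<sigma>"
    and tc: "test_curve A F c \<psi>"
    and nontrivial: "\<exists>l\<in>{0<..<c}. \<exists>j. \<exists>x\<in>lb_dom F j. \<psi> l j x \<noteq> -\<infinity>"
begin

definition u :: "real \<Rightarrow> 'x \<Rightarrow> ereal" where "u l = metric_diff F l (\<psi> l) \<sigma>"

lemma atlas: "complex_atlas A" using X by (simp add: compact_complex_manifold_def)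

lemma c_pos: "c > 0" using tc by (simp add: test_curve_def)

lemma frame: obtains j where "x \<in> lb_dom F j"
proof -
  have "x \<in> (\<Union>j. lb_dom F j)" using F by (simp add: holomorphic_line_bundle_def)
  then show ?thesis using that by blast
qed

lemma open_frame: "open (lb_dom F j)" using F by (simp add: holomorphic_line_bundle_def)

lemma \<psi>_PSH: "0 < l \<Longrightarrow> l < c \<Longrightarrow> \<psi> l \<in> PSH A UNIV l F" using tc by (simp add: test_curve_def)

lemma u_eq: "0 < l \<Longrightarrow> l < c \<Longrightarrow> x \<in> lb_dom F j \<Longrightarrow> u l x = \<psi> l j x - ereal (l * \<sigma> j x)"
  using \<sigma> unfolding u_def smooth_metric_def
  by (intro metric_diff_eq[OF PSH_UNIV_D(1)[OF \<psi>_PSH]]) simp_all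

lemma \<sigma>_continuous: "continuous_on (lb_dom F j) (\<sigma> j)"
  using smooth_fun_continuous_on[OF atlas open_frame] \<sigma> by (auto simp: smooth_metric_def)

lemma u_not_PInf: "0 < l \<Longrightarrow> l < c \<Longrightarrow> u l x \<noteq> \<infinity>"
proof -
  assume l: "0 < l" "l < c"
  obtain j where j: "x \<in> lb_dom F j" using frame .
  have "\<psi> l j x \<noteq> \<infinity>" by (rule metric_on_not_PInf[OF PSH_UNIV_D(1)[OF \<psi>_PSH[OF l]] _ j]) simp
  then show ?thesis unfolding u_eq[OF l j] by (cases "\<psi> l j x") auto
qed

lemma u_usc: assumes l: "0 < l" "l < c" shows "usc_on UNIV (u l)"
proof (rule usc_onI)
  fix x a assume a: "u l x < a"
  obtain j where j: "x \<in> lb_dom F j" using frame .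
  have "usc_on (lb_dom F j) (\<lambda>x. \<psi> l j x + ereal (- (l * \<sigma> j x)))"
    by (intro usc_on_add_continuous PSH_UNIV_D(2)[OF \<psi>_PSH[OF l]] continuous_intros \<sigma>_continuous)
  then have usc: "usc_on (lb_dom F j) (u l)"
    by (rule usc_on_cong[THEN iffD1, rotated]) (simp add: u_eq[OF l] minus_ereal_def)
  obtain N where N: "open N" "x \<in> N" "\<And>y. y \<in> N \<Longrightarrow> y \<in> lb_dom F j \<Longrightarrow> u l y < a"
    using usc_onE[OF usc j a] by metis
  then show "\<exists>N. open N \<and> x \<in> N \<and> (\<forall>y\<in>N \<inter> UNIV. u l y < a)"
    using j open_frame by (intro exI[of _ "N \<inter> lb_dom F j"]) auto
qed

lemma u_concave:
  assumes l: "0 < l" "l < c" and m: "0 < \<mu>" "\<mu> < c" and s: "0 < s" "s < 1"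
  shows "ereal s * u l x + ereal (1 - s) * u \<mu> x \<le> u (s * l + (1 - s) * \<mu>) x"
proof -
  obtain j where j: "x \<in> lb_dom F j" using frame .
  define n where "n = s * l + (1 - s) * \<mu>"
  have n: "0 < n" "n < c"
  proof -
    show "0 < n" unfolding n_def using l m s by (intro add_pos_pos mult_pos_pos) auto
    have "s * l < s * c" "(1 - s) * \<mu> < (1 - s) * c" using l m s by auto
    then show "n < c" unfolding n_def by (simp add: algebra_simps)
  qed
  have "ereal s * \<psi> l j x + ereal (1 - s) * \<psi> \<mu> j x \<le> \<psi> n j x"
    using tc l m s j unfolding test_curve_def metric_le_def n_def by auto
  then show ?thesis unfolding u_eq[OF l j] u_eq[OF m j] n_def[symmetric] u_eq[OF n j]
    using s by (cases "\<psi> l j x"; cases "\<psi> \<mu> j x"; cases "\<psi> n j x") (auto simp: n_def algebra_simps)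
qed

lemma u_decreasing:
  assumes l: "0 < l" "l \<le> \<mu>" "\<mu> < c"
  shows "u \<mu> x \<le> ereal (\<mu> / l) * u l x"
proof -
  obtain j where j: "x \<in> lb_dom F j" using frame .
  have l': "0 < l" "l < c" "0 < \<mu>" "\<mu> < c" using l by auto
  have "ereal (1 / \<mu>) * \<psi> \<mu> j x \<le> ereal (1 / l) * \<psi> l j x"
    using tc l l' j unfolding test_curve_def metric_le_def by auto
  then show ?thesis unfolding u_eq[OF l'(1,2) j] u_eq[OF l'(3,4) j]
    using l l' by (cases "\<psi> l j x"; cases "\<psi> \<mu> j x") (auto simp: field_simps)
qed

end

section \<open>Density of the finite locus and uniform boundedness\<close>

context test_curve_setup
begin

lemma chart_at:
  obtains W \<kappa> j R where "(W, \<kappa>) \<in> A" "x \<in> W" "x \<in> lb_dom F j" "R > 0"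
    "cball (\<kappa> x) (3 * R) \<subseteq> \<kappa> ` (W \<inter> lb_dom F j)"
proof -
  obtain W \<kappa> where W: "(W, \<kappa>) \<in> A" "x \<in> W" using atlas_covers[OF atlas] .
  obtain j where j: "x \<in> lb_dom F j" using frame .
  have "\<kappa> x \<in> \<kappa> ` (W \<inter> lb_dom F j)" using W j by blast
  then obtain e where e: "e > 0" "cball (\<kappa> x) e \<subseteq> \<kappa> ` (W \<inter> lb_dom F j)"
    using open_chart_image[OF atlas W(1) open_frame] open_contains_cball by blast
  show ?thesis by (rule that[OF W j, of "e / 3"]) (use e in auto)
qed

text \<open>A point where the function is finite makes it finite on a dense subset of a ball whose radius
  depends on the chart only. Hence the closure of the finite locus is open, and \<open>X\<close> is connected.\<close>

lemma closure_finite_locus: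
  assumes \<nu>: "0 < \<nu>" "\<nu> < c" and x1: "u \<nu> x1 \<noteq> -\<infinity>"
  shows "closure {x. u \<nu> x \<noteq> -\<infinity>} = UNIV"
proof -
  define D where "D = {x. u \<nu> x \<noteq> -\<infinity>}"
  have nb: "\<exists>N. open N \<and> x \<in> N \<and> N \<subseteq> closure D" if x: "x \<in> closure D" for x
  proof -
    obtain W \<kappa> j R where ch: "(W, \<kappa>) \<in> A" "x \<in> W" "x \<in> lb_dom F j" "R > 0"
      "cball (\<kappa> x) (3 * R) \<subseteq> \<kappa> ` (W \<inter> lb_dom F j)" using chart_at .
    define N where "N = W \<inter> lb_dom F j \<inter> \<kappa> -` ball (\<kappa> x) R"
    have N: "open N" "x \<in> N" unfolding N_def
      using open_chart_preimage[OF atlas ch(1) open_frame open_ball] ch by auto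
    obtain y where y: "y \<in> D" "y \<in> N" using x N unfolding closure_iff_nhds_not_empty by blast
    define f where "f = \<psi> \<nu> j \<circ> inv_into W \<kappa>"
    have psh: "psh_on f (\<kappa> ` (W \<inter> lb_dom F j))"
      unfolding f_def by (rule PSH_UNIV_D(3)[OF \<psi>_PSH[OF \<nu>] ch(1)])
    have fu: "u \<nu> p = f (\<kappa> p) - ereal (\<nu> * \<sigma> j p)" if "p \<in> W \<inter> lb_dom F j" for p
      using that chart_inverse(1)[OF atlas ch(1), of p] u_eq[OF \<nu>, of p j] by (simp add: f_def)
    have fy: "f (\<kappa> y) \<noteq> -\<infinity>" using fu[of y] y by (cases "f (\<kappa> y)") (auto simp: D_def N_def)
    have yx: "dist (\<kappa> x) (\<kappa> y) < R" using y by (simp add: N_def)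
    have sub: "cball (\<kappa> y) (2 * R) \<subseteq> cball (\<kappa> x) (3 * R)"
    proof
      fix p assume "p \<in> cball (\<kappa> y) (2 * R)"
      then have "dist (\<kappa> x) p \<le> dist (\<kappa> x) (\<kappa> y) + dist (\<kappa> y) p" "dist (\<kappa> y) p \<le> 2 * R"
        by (auto simp: dist_triangle)
      then show "p \<in> cball (\<kappa> x) (3 * R)" using yx by simp
    qed
    have "N \<subseteq> closure D"
    proof
      fix p assume p: "p \<in> N"
      show "p \<in> closure D" unfolding closure_iff_nhds_not_empty
      proof (intro allI impI)
        fix T V assume V: "V \<subseteq> T" "open V" "p \<in> V"
        define Q where "Q = \<kappa> ` (W \<inter> (N \<inter> V))"
        have "open Q" unfolding Q_def
          by (rule open_chart_image[OF atlas ch(1)]) (use N V in auto)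
        moreover have "Q \<noteq> {}" using p V by (auto simp: Q_def N_def)
        moreover have "Q \<subseteq> cball (\<kappa> y) (2 * R)"
        proof
          fix q assume "q \<in> Q"
          then have "dist (\<kappa> x) q < R" by (auto simp: Q_def N_def)
          then show "q \<in> cball (\<kappa> y) (2 * R)"
            using yx dist_triangle[of "\<kappa> y" q "\<kappa> x"] by (simp add: dist_commute)
        qed
        ultimately obtain q where q: "q \<in> Q" "f q \<noteq> -\<infinity>"
          using psh_not_MInf_dense[OF psh order_trans[OF sub ch(5)] fy, of Q] ch(4) by auto
        then obtain p' where p': "p' \<in> N \<inter> V" "q = \<kappa> p'" by (auto simp: Q_def)
        then have "p' \<in> D" using fu[of p'] q(2) by (cases "f q") (auto simp: D_def N_def)
        then show "D \<inter> T \<noteq> {}" using p' V by blast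
      qed
    qed
    then show ?thesis using N by blast
  qed
  have "open (closure D)" unfolding open_subopen[of "closure D"] using nb by blast
  then have cl: "openin (top_of_set UNIV) (closure D) \<and> closedin (top_of_set UNIV) (closure D)"
    by (simp add: closed_closedin[symmetric] open_openin[symmetric])
  have con: "connected (UNIV::'x set)" using X by (simp add: compact_complex_manifold_def)
  have "closure D = {} \<or> closure D = UNIV" using con[unfolded connected_clopen, rule_format, OF cl] .
  moreover have "x1 \<in> D" using x1 by (simp add: D_def)
  ultimately show ?thesis unfolding D_def[symmetric] using closure_subset[of D] by auto
qed

lemma compact_X: "compact (UNIV :: 'x set)" using X by (simp add: compact_complex_manifold_def)

lemma finite_parameter: obtains \<nu> x1 where "0 < \<nu>" "\<nu> < c" "u \<nu> x1 \<noteq> -\<infinity>"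
proof -
  obtain l j x where l: "0 < l" "l < c" "x \<in> lb_dom F j" "\<psi> l j x \<noteq> -\<infinity>" using nontrivial by auto
  then have "u l x \<noteq> -\<infinity>" unfolding u_eq[OF l(1-3)] by (cases "\<psi> l j x") auto
  then show ?thesis using that l by blast
qed

lemma u_bounded_at: assumes "0 < l" "l < c" obtains M :: real where "M \<ge> 0" "\<And>x. u l x \<le> ereal M"
  using usc_on_bounded_above[OF u_usc[OF assms] compact_X] u_not_PInf[OF assms] by (metis UNIV_I)

text \<open>Parameters bounded away from \<open>0\<close> are reduced to one of them by \<open>u_decreasing\<close>. For \<open>\<mu> < \<nu>/2\<close>
  concavity gives \<open>u \<mu> \<le> 4M - 2 u \<nu>\<close> with a constant \<open>M\<close>, and the right-hand side is locally integrable;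
  ball averages turn this into a local bound independent of \<open>\<mu>\<close>, and compactness into a global one.\<close>

lemma u_bounded: obtains M :: real where "M \<ge> 0" "\<And>l x. 0 < l \<Longrightarrow> l < c \<Longrightarrow> u l x \<le> ereal M"
proof -
  obtain \<nu> x1 where \<nu>: "0 < \<nu>" "\<nu> < c" and x1: "u \<nu> x1 \<noteq> -\<infinity>" using finite_parameter .
  define \<mu>0 where "\<mu>0 = \<nu> / 2"
  have \<mu>0: "0 < \<mu>0" "\<mu>0 < c" "\<mu>0 < \<nu>" using \<nu> by (auto simp: \<mu>0_def)
  obtain M1 where M1: "M1 \<ge> 0" "\<And>x. u \<nu> x \<le> ereal M1" using u_bounded_at[OF \<nu>] by metis
  obtain M2 where M2: "M2 \<ge> 0" "\<And>x. u \<mu>0 x \<le> ereal M2" using u_bounded_at[OF \<mu>0(1,2)] by metis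
  define M where "M = max M1 M2"
  have M: "M \<ge> 0" "\<And>x. u \<nu> x \<le> ereal M" "\<And>x. u \<mu>0 x \<le> ereal M"
    using M1(1) order_trans[OF M1(2)] order_trans[OF M2(2)] unfolding M_def by simp_all
  \<comment> \<open>Concavity on the segment from \<open>\<mu>\<close> to \<open>\<nu>\<close> through \<open>\<mu>0\<close>, which weights \<open>\<mu>\<close> by at least one half.\<close>
  have conc: "u \<mu> x \<le> ereal (2 * M) + ereal 2 * (ereal M - u \<nu> x)" if \<mu>: "0 < \<mu>" "\<mu> < \<mu>0" for \<mu> x
  proof -
    have \<mu>c: "\<mu> < c" using \<mu> \<mu>0 by simp
    define s where "s = (\<nu> - \<mu>0) / (\<nu> - \<mu>)"
    have s: "1/2 \<le> s" "s < 1" using \<mu> \<nu> by (auto simp: s_def \<mu>0_def field_simps)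
    have "s * \<mu> + (1 - s) * \<nu> = \<mu>0"
    proof -
      have "s * (\<nu> - \<mu>) = \<nu> - \<mu>0" using \<mu> \<mu>0 by (simp add: s_def)
      then show ?thesis by (simp add: algebra_simps)
    qed
    then have "ereal s * u \<mu> x + ereal (1 - s) * u \<nu> x \<le> u \<mu>0 x"
      using u_concave[OF \<mu>(1) \<mu>c \<nu>, of s x] s by simp
    also have "\<dots> \<le> ereal M" by (rule M(3))
    finally have 1: "ereal s * u \<mu> x + ereal (1 - s) * u \<nu> x \<le> ereal M" .
    show ?thesis
    proof (cases "u \<nu> x")
      case PInf then show ?thesis using M(2)[of x] by simp
    next
      case MInf then show ?thesis by simp
    next
      case (real b)
      have bM: "b \<le> M" using M(2)[of x] real by simp
      show ?thesis
      proof (cases "u \<mu> x")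
        case PInf then show ?thesis using u_not_PInf[OF \<mu>(1) \<mu>c] by simp
      next
        case MInf then show ?thesis by simp
      next
        case (real a)
        have "s * a + (1 - s) * b \<le> M" using 1 real \<open>u \<nu> x = ereal b\<close> by simp
        then have "s * a \<le> M + (1 - s) * (- b)" by (simp add: algebra_simps)
        also have "\<dots> \<le> M + (1 - s) * (M - b)" using M(1) s by (intro add_left_mono mult_left_mono) auto
        also have "\<dots> \<le> M + (1/2) * (M - b)" using bM s by (intro add_left_mono mult_right_mono) auto
        finally have 2: "s * a \<le> M + (M - b) / 2" by simp
        have "a \<le> 2 * M + (M - b)"
        proof (cases "a \<le> 0")
          case True then show ?thesis using M(1) bM by linarith
        next
          case False
          then have "(1/2) * a \<le> s * a" using s by (intro mult_right_mono) auto
          then have "(1/2) * a \<le> M + (M - b) / 2" using 2 by (rule order_trans)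
          then show ?thesis by (simp add: field_simps)
        qed
        then show ?thesis using real \<open>u \<nu> x = ereal b\<close> bM by simp
      qed
    qed
  qed
  have local: "\<exists>N K. open N \<and> x \<in> N \<and> (\<forall>\<mu> y. 0 < \<mu> \<longrightarrow> \<mu> < \<mu>0 \<longrightarrow> y \<in> N \<longrightarrow> u \<mu> y \<le> ereal K)" for x
  proof -
    obtain W \<kappa> j R where ch: "(W, \<kappa>) \<in> A" "x \<in> W" "x \<in> lb_dom F j" "R > 0"
      "cball (\<kappa> x) (3 * R) \<subseteq> \<kappa> ` (W \<inter> lb_dom F j)" using chart_at .
    define V where "V = \<kappa> ` (W \<inter> lb_dom F j)"
    define f where "f = (\<lambda>l. \<psi> l j \<circ> inv_into W \<kappa>)"
    define s where "s = \<sigma> j \<circ> inv_into W \<kappa>"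
    have psh: "psh_on (f l) V" if "0 < l" "l < c" for l
      unfolding f_def V_def by (rule PSH_UNIV_D(3)[OF \<psi>_PSH[OF that] ch(1)])
    have fu: "u l (inv_into W \<kappa> q) = f l q - ereal (l * s q)" if "0 < l" "l < c" "q \<in> V" for l q
      using u_eq[OF that(1,2), of "inv_into W \<kappa> q" j] chart_inverse(2)[OF atlas ch(1) that(3)[unfolded V_def]]
      by (simp add: f_def s_def)
    have "continuous_on V s" unfolding s_def V_def
      by (rule continuous_on_compose[OF chart_inverse(3)[OF atlas ch(1)] continuous_on_subset[OF \<sigma>_continuous]])
         (use chart_inverse(2)[OF atlas ch(1)] in blast)
    then have "continuous_on (cball (\<kappa> x) (3 * R)) s" by (rule continuous_on_subset) (use ch(5) in \<open>simp add: V_def\<close>)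
    from compact_imp_bounded[OF compact_continuous_image[OF this compact_cball]]
    obtain B where B: "B > 0" "\<And>q. q \<in> cball (\<kappa> x) (3 * R) \<Longrightarrow> \<bar>s q\<bar> \<le> B"
      unfolding bounded_pos by auto
    have ls: "\<bar>l * s q\<bar> \<le> c * B" if "0 < l" "l < c" "q \<in> cball (\<kappa> x) (3 * R)" for l q
      unfolding abs_mult using that B by (intro mult_mono) auto
    define M0 where "M0 = M + c * B"
    have cB: "c * B > 0" using B c_pos by simp
    have f\<nu>: "f \<nu> q \<le> ereal M0" if q: "q \<in> cball (\<kappa> x) (3 * R)" for q
    proof -
      have "q \<in> V" using q ch(5) by (auto simp: V_def)
      from fu[OF \<nu> this] M(2)[of "inv_into W \<kappa> q"] ls[OF \<nu> q] show ?thesis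
        by (cases "f \<nu> q") (auto simp: M0_def)
    qed
    define N where "N = W \<inter> lb_dom F j \<inter> \<kappa> -` ball (\<kappa> x) R"
    have N: "open N" "x \<in> N" unfolding N_def
      using open_chart_preimage[OF atlas ch(1) open_frame open_ball] ch by auto
    have "x \<in> closure {x. u \<nu> x \<noteq> -\<infinity>}" using closure_finite_locus[OF \<nu> x1] by simp
    then obtain y where y: "u \<nu> y \<noteq> -\<infinity>" "y \<in> N" using N unfolding closure_iff_nhds_not_empty by blast
    have "\<kappa> y \<in> V" "inv_into W \<kappa> (\<kappa> y) = y"
      using y(2) chart_inverse(1)[OF atlas ch(1), of y] by (auto simp: N_def V_def)
    then have fy: "f \<nu> (\<kappa> y) \<noteq> -\<infinity>" using fu[OF \<nu>, of "\<kappa> y"] y(1) by auto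
    have yx: "dist (\<kappa> x) (\<kappa> y) < R" using y(2) by (simp add: N_def)
    have M00: "M0 \<ge> 0" using M(1) cB by (simp add: M0_def)
    have a0: "2 * M + c * B \<ge> 0" using M(1) cB by simp
    obtain K where K: "\<And>g q. psh_on g V \<Longrightarrow>
      (\<And>q. q \<in> cball (\<kappa> x) (3 * R) \<Longrightarrow> g q \<le> ereal (2 * M + c * B) + ereal 2 * (ereal M0 - f \<nu> q)) \<Longrightarrow>
      q \<in> cball (\<kappa> x) (R / 2) \<Longrightarrow> g q \<le> ereal K"
      using psh_family_bounded_by_potential[OF psh[OF \<nu>] ch(5)[folded V_def] ch(4) yx fy M00 f\<nu> a0, of 2] by auto
    define N' where "N' = W \<inter> lb_dom F j \<inter> \<kappa> -` ball (\<kappa> x) (R / 2)"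
    have N': "open N'" "x \<in> N'" unfolding N'_def
      using open_chart_preimage[OF atlas ch(1) open_frame open_ball] ch by auto
    have "u \<mu> p \<le> ereal (K + c * B)" if \<mu>: "0 < \<mu>" "\<mu> < \<mu>0" and p: "p \<in> N'" for \<mu> p
    proof -
      have \<mu>c: "\<mu> < c" using \<mu> \<mu>0 by simp
      have pV: "\<kappa> p \<in> V" "inv_into W \<kappa> (\<kappa> p) = p" "\<kappa> p \<in> cball (\<kappa> x) (R / 2)"
        using p chart_inverse(1)[OF atlas ch(1), of p] by (auto simp: N'_def V_def)
      have "f \<mu> (\<kappa> p) \<le> ereal K"
      proof (rule K[OF psh[OF \<mu>(1) \<mu>c] _ pV(3)])
        fix q assume q: "q \<in> cball (\<kappa> x) (3 * R)"
        then have qV: "q \<in> V" using ch(5) by (auto simp: V_def)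
        have le: "f \<mu> q - ereal (\<mu> * s q) \<le> ereal (2 * M) + ereal 2 * (ereal M - (f \<nu> q - ereal (\<nu> * s q)))"
          using conc[OF \<mu>, of "inv_into W \<kappa> q"] unfolding fu[OF \<mu>(1) \<mu>c qV] fu[OF \<nu> qV] .
        show "f \<mu> q \<le> ereal (2 * M + c * B) + ereal 2 * (ereal M0 - f \<nu> q)"
        proof (cases "f \<nu> q")
          case PInf then show ?thesis using f\<nu>[OF q] by simp
        next
          case MInf then show ?thesis by simp
        next
          case b: (real b)
          show ?thesis
          proof (cases "f \<mu> q")
            case PInf then show ?thesis using le b by simp
          next
            case MInf then show ?thesis by simp
          next
            case a: (real a)
            have "a - \<mu> * s q \<le> 2 * M + 2 * (M - (b - \<nu> * s q))" using le unfolding a b by simp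
            moreover have "\<mu> * s q \<le> c * B" "\<nu> * s q \<le> c * B"
              using ls[OF \<mu>(1) \<mu>c q] ls[OF \<nu> q] by linarith+
            ultimately have "a \<le> 2 * M + c * B + 2 * (M0 - b)" unfolding M0_def by argo
            then show ?thesis unfolding a b by simp
          qed
        qed
      qed
      moreover have "u \<mu> p = f \<mu> (\<kappa> p) - ereal (\<mu> * s (\<kappa> p))" using fu[OF \<mu>(1) \<mu>c pV(1)] pV(2) by simp
      moreover have "\<bar>\<mu> * s (\<kappa> p)\<bar> \<le> c * B" using ls[OF \<mu>(1) \<mu>c, of "\<kappa> p"] pV(3) ch(4) by auto
      ultimately show ?thesis by (cases "f \<mu> (\<kappa> p)") auto
    qed
    then show ?thesis using N' by blast
  qed
  then obtain N K where NK: "\<And>x. open (N x) \<and> x \<in> N x \<and> (\<forall>\<mu> y. 0 < \<mu> \<longrightarrow> \<mu> < \<mu>0 \<longrightarrow> y \<in> N x \<longrightarrow> u \<mu> y \<le> ereal (K x))"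
    by metis
  obtain C where C: "finite C" "UNIV \<subseteq> (\<Union>x\<in>C. N x)"
  proof (rule compactE_image[OF compact_X, of UNIV N])
    show "open (N x)" for x using NK by simp
    show "UNIV \<subseteq> (\<Union>x. N x)" using NK by auto
  qed (use that in auto)
  define K' where "K' = Max (insert ((c / \<mu>0) * M) (insert 0 (K ` C)))"
  have fin: "finite (insert ((c / \<mu>0) * M) (insert 0 (K ` C)))" using C by simp
  show ?thesis
  proof (rule that[of K'])
    show "0 \<le> K'" unfolding K'_def using fin by (intro Max_ge) auto
    fix l x assume l: "0 < l" "l < c"
    show "u l x \<le> ereal K'"
    proof (cases "l < \<mu>0")
      case True
      obtain y where y: "y \<in> C" "x \<in> N y" using C(2) by blast
      then have "u l x \<le> ereal (K y)" using NK l True by blast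
      also have "K y \<le> K'" unfolding K'_def using fin y by (intro Max_ge) auto
      finally show ?thesis by simp
    next
      case False
      then have "u l x \<le> ereal (l / \<mu>0) * u \<mu>0 x" using \<mu>0 l by (intro u_decreasing) auto
      also have "\<dots> \<le> ereal (l / \<mu>0) * ereal M" using M(3) l \<mu>0 by (intro ereal_mult_left_mono) auto
      also have "\<dots> \<le> ereal ((c / \<mu>0) * M)" using l \<mu>0 M(1) by (auto intro!: mult_right_mono divide_right_mono)
      also have "(c / \<mu>0) * M \<le> K'" unfolding K'_def using fin by (intro Max_ge) auto
      finally show ?thesis by simp
    qed
  qed
qed

end

section \<open>The singularity type of the Legendre transform\<close>

lemma ereal_pos_mult_MInf: "a > 0 \<Longrightarrow> ereal a * -\<infinity> = -\<infinity>"
  by simp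

context test_curve_setup
begin

text \<open>The function that represents the singularity type of \<open>\<psi>'\<close>.\<close>

definition g :: "'x \<times> complex \<Rightarrow> ereal" where "g = psi_prime F \<sigma> c \<psi>"

lemma g_eq: "g = usc_reg (UNIV \<times> punctured_disc) (\<lambda>(x, w). SUP l\<in>{0<..<c}. u l x + ereal (l * tpar w))"
  unfolding g_def psi_prime_def u_def ..

lemma le_g:
  assumes l: "0 < l" "l < c" and w: "w \<in> punctured_disc"
  shows "u l x + ereal (l * tpar w) \<le> g (x, w)"
proof -
  have "u l x + ereal (l * tpar w) \<le> (\<lambda>(x, w). SUP l\<in>{0<..<c}. u l x + ereal (l * tpar w)) (x, w)"
    using l by (auto intro: SUP_upper)
  also have "\<dots> \<le> g (x, w)" unfolding g_eq using w by (intro usc_reg_ge) auto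
  finally show ?thesis .
qed

text \<open>Where \<open>u \<nu>\<close> is finite, \<open>u l \<ge> (l/\<nu>) u \<nu>\<close> tends to a limit \<open>\<ge> 0\<close> for \<open>l \<rightarrow> 0\<close>. Such points are dense,
  and the regularisation takes the limit superior along them.\<close>

lemma g_nonneg:
  assumes w: "w \<in> punctured_disc"
  shows "0 \<le> g (x, w)"
proof -
  obtain \<nu> x1 where \<nu>: "0 < \<nu>" "\<nu> < c" and x1: "u \<nu> x1 \<noteq> -\<infinity>" using finite_parameter .
  show ?thesis unfolding g_eq
  proof (rule le_usc_reg)
    fix N :: "('x \<times> complex) set" assume N: "open N" "(x, w) \<in> N"
    obtain N1 N2 where N12: "open N1" "open N2" "(x, w) \<in> N1 \<times> N2" "N1 \<times> N2 \<subseteq> N"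
      using open_prod_elim[OF N] by metis
    have "x \<in> closure {x. u \<nu> x \<noteq> -\<infinity>}" using closure_finite_locus[OF \<nu> x1] by simp
    then obtain y where y: "y \<in> N1" "u \<nu> y \<noteq> -\<infinity>"
      using N12 unfolding closure_iff_nhds_not_empty by blast
    then obtain r where r: "u \<nu> y = ereal r" using u_not_PInf[OF \<nu>] by (cases "u \<nu> y") auto
    have "0 \<le> (SUP l\<in>{0<..<c}. u l y + ereal (l * tpar w))"
    proof (rule ereal_le_epsilon2)
      fix e :: real assume e: "e > 0"
      define l where "l = min \<nu> (e * \<nu> / (\<bar>r\<bar> + 1))"
      have l: "0 < l" "l \<le> \<nu>" using \<nu> e by (auto simp: l_def)
      have "l \<le> e * \<nu> / (\<bar>r\<bar> + 1)" by (simp add: l_def)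
      then have "l * (\<bar>r\<bar> + 1) \<le> e * \<nu>" by (simp add: pos_le_divide_eq)
      then have "l * \<bar>r\<bar> \<le> e * \<nu>" using l by (simp add: distrib_left)
      then have lr: "- e \<le> l / \<nu> * r" using \<nu> l
        by (simp add: field_simps) (smt (verit) mult_minus_right mult_left_mono abs_ge_minus_self)
      have "ereal r \<le> ereal (\<nu> / l) * u l y" using u_decreasing[OF l \<nu>(2), of y] by (simp add: r)
      then have "ereal (l / \<nu> * r) \<le> u l y" using l \<nu> by (cases "u l y") (auto simp: field_simps)
      then have "ereal (- e) \<le> u l y" using lr by (meson ereal_less_eq(3) order_trans)
      moreover have "0 \<le> l * tpar w" using l tpar_nonneg[OF w] by simp
      ultimately have "ereal (- e) \<le> u l y + ereal (l * tpar w)" by (cases "u l y") auto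
      also have "\<dots> \<le> (SUP l\<in>{0<..<c}. u l y + ereal (l * tpar w))" using l \<nu> by (intro SUP_upper) auto
      finally show "0 \<le> (SUP l\<in>{0<..<c}. u l y + ereal (l * tpar w)) + ereal e"
        by (cases "SUP l\<in>{0<..<c}. u l y + ereal (l * tpar w)") auto
    qed
    then show "\<exists>q\<in>N \<inter> UNIV \<times> punctured_disc. 0 \<le> (\<lambda>(x, w). SUP l\<in>{0<..<c}. u l x + ereal (l * tpar w)) q"
      using N12 y w by (intro bexI[of _ "(y, w)"]) auto
  qed
qed

definition grid :: "real \<Rightarrow> nat set" where "grid \<delta> = {k. 1 \<le> k \<and> real k * \<delta> < c}"

text \<open>A finite maximum that dominates \<open>sup\<^sub>l (u l + lt)\<close>. For \<open>l\<close> between \<open>k\<delta>\<close> and \<open>(k + 1)\<delta>\<close> it uses the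
  value at \<open>k\<delta>\<close>, at the cost of a constant \<open>M\<close> in \<open>u\<close> and of \<open>\<delta>\<close> in the slope; the first entry takes
  care of \<open>l < \<delta>\<close>, where \<open>M\<close> bounds \<open>u\<close> itself.\<close>

definition grid_majorant :: "real \<Rightarrow> real \<Rightarrow> 'x \<Rightarrow> real \<Rightarrow> ereal" where
  "grid_majorant M \<delta> x t = max (ereal (M + \<delta> * t))
     (SUP k\<in>grid \<delta>. u (real k * \<delta>) x + ereal (M + (real k + 1) * \<delta> * t))"

lemma finite_grid: assumes "\<delta> > 0" shows "finite (grid \<delta>)"
proof (rule finite_subset)
  show "grid \<delta> \<subseteq> {..nat \<lceil>c / \<delta>\<rceil>}"
  proof
    fix k assume "k \<in> grid \<delta>"
    then have "real k < c / \<delta>" using assms by (simp add: grid_def pos_less_divide_eq)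
    then show "k \<in> {..nat \<lceil>c / \<delta>\<rceil>}" by (simp add: le_nat_iff) linarith
  qed
qed simp

text \<open>Monotonicity of \<open>u l\<close> in \<open>l\<close>, up to a constant: where \<open>u l\<close> is negative, \<open>u \<mu> \<le> (\<mu>/l) u l\<close> is below
  \<open>u l\<close>, and where it is positive it is at most \<open>M\<close>.\<close>

lemma u_le_add:
  assumes M: "M \<ge> 0" "\<And>l x. 0 < l \<Longrightarrow> l < c \<Longrightarrow> u l x \<le> ereal M"
    and l: "0 < l" "l \<le> \<mu>" "\<mu> < c" and q: "\<mu> / l \<le> q + 1" "q \<ge> 0"
  shows "u \<mu> x \<le> u l x + ereal (q * M)"
proof -
  have dec: "u \<mu> x \<le> ereal (\<mu> / l) * u l x" by (rule u_decreasing[OF l])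
  have lc: "l < c" using l by simp
  show ?thesis
  proof (cases "u l x")
    case MInf
    have "\<mu> / l > 0" using l by simp
    from ereal_pos_mult_MInf[OF this] have "ereal (\<mu> / l) * u l x = -\<infinity>" unfolding MInf .
    with dec have "u \<mu> x \<le> -\<infinity>" by (simp only:)
    then show ?thesis by simp
  next
    case PInf then show ?thesis by simp
  next
    case (real r)
    have rM: "r \<le> M" using M(2)[OF l(1) lc, of x] real by simp
    have q1: "\<mu> / l \<ge> 1" using l by simp
    have "\<mu> / l * r \<le> r + q * M"
    proof (cases "r \<ge> 0")
      case True
      have "(\<mu> / l - 1) * r \<le> q * M" using True rM q q1 by (intro mult_mono) auto
      then show ?thesis by (simp add: algebra_simps)
    next
      case False
      then have "(\<mu> / l) * r \<le> 1 * r" using q1 by (intro mult_right_mono_neg) auto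
      moreover have "q * M \<ge> 0" using q M by simp
      ultimately show ?thesis by linarith
    qed
    then have "ereal (\<mu> / l) * u l x \<le> ereal (r + q * M)" by (simp add: real)
    then show ?thesis using dec real by (simp add: order_trans)
  qed
qed

lemma le_grid_majorant:
  assumes M: "M \<ge> 0" "\<And>l x. 0 < l \<Longrightarrow> l < c \<Longrightarrow> u l x \<le> ereal M"
    and \<delta>: "\<delta> > 0" and l: "0 < l" "l < c" and t: "t \<ge> 0"
  shows "u l x + ereal (l * t) \<le> grid_majorant M \<delta> x t"
proof -
  define k where "k = nat \<lfloor>l / \<delta>\<rfloor>"
  have k: "real k * \<delta> \<le> l" "l < (real k + 1) * \<delta>"
  proof -
    have "0 \<le> l / \<delta>" using l \<delta> by simp
    then have "real k = of_int \<lfloor>l / \<delta>\<rfloor>" unfolding k_def by simp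
    then have "real k \<le> l / \<delta>" "l / \<delta> < real k + 1" by linarith+
    then show "real k * \<delta> \<le> l" "l < (real k + 1) * \<delta>" using \<delta> by (simp_all add: field_simps)
  qed
  have lt: "l * t \<le> (real k + 1) * \<delta> * t" using k t by (intro mult_right_mono) auto
  show ?thesis
  proof (cases "k = 0")
    case True
    have "u l x + ereal (l * t) \<le> ereal M + ereal (\<delta> * t)"
      using M(2)[OF l, of x] lt True by (intro add_mono) auto
    then show ?thesis by (simp add: grid_majorant_def le_max_iff_disj)
  next
    case False
    then have k1: "1 \<le> real k" by simp
    then have kd: "0 < real k * \<delta>" using \<delta> by simp
    have "l / (real k * \<delta>) \<le> 1 + 1"
    proof -
      have "1 * \<delta> \<le> real k * \<delta>" using k1 \<delta> by (intro mult_right_mono) auto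
      then have "l \<le> (1 + 1) * (real k * \<delta>)" using k(2) by (simp add: algebra_simps)
      then show ?thesis using kd by (simp add: pos_divide_le_eq)
    qed
    from u_le_add[OF M kd k(1) l(2) this, of x]
    have "u l x + ereal (l * t) \<le> (u (real k * \<delta>) x + ereal M) + ereal ((real k + 1) * \<delta> * t)"
      using lt by (intro add_mono) auto
    also have "\<dots> = u (real k * \<delta>) x + ereal (M + (real k + 1) * \<delta> * t)" by (simp add: add.assoc)
    also have "\<dots> \<le> (SUP k\<in>grid \<delta>. u (real k * \<delta>) x + ereal (M + (real k + 1) * \<delta> * t))"
      by (rule SUP_upper) (use False k l in \<open>auto simp: grid_def\<close>)
    finally show ?thesis by (simp add: grid_majorant_def le_max_iff_disj)
  qed
qed

text \<open>The majorant is upper semicontinuous in both variables, hence not affected by the regularisation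
  in the definition of \<open>g\<close>.\<close>

lemma g_le_grid_majorant:
  assumes M: "M \<ge> 0" "\<And>l x. 0 < l \<Longrightarrow> l < c \<Longrightarrow> u l x \<le> ereal M"
    and \<delta>: "\<delta> > 0" and w: "w \<in> punctured_disc"
  shows "g (x, w) \<le> grid_majorant M \<delta> x (tpar w)"
proof -
  have cont: "continuous_on (UNIV \<times> punctured_disc) (\<lambda>p::'x \<times> complex. a + b * tpar (snd p))" for a b
    by (intro continuous_intros continuous_on_compose2[OF continuous_on_tpar[of punctured_disc]])
       (auto simp: punctured_disc_def)
  have us: "usc_on (UNIV \<times> punctured_disc) (\<lambda>p. u (real k * \<delta>) (fst p) + ereal (M + (real k + 1) * \<delta> * tpar (snd p)))"
    if "k \<in> grid \<delta>" for k
  proof (rule usc_on_add_continuous[OF _ cont])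
    show "usc_on (UNIV \<times> punctured_disc) (\<lambda>p. u (real k * \<delta>) (fst p))"
      by (rule usc_on_compose[OF u_usc]) (use that \<delta> in \<open>auto simp: grid_def intro!: continuous_intros\<close>)
  qed
  have "usc_on (UNIV \<times> punctured_disc) (\<lambda>p. grid_majorant M \<delta> (fst p) (tpar (snd p)))"
    unfolding grid_majorant_def
    by (intro usc_on_max usc_on_SUP_finite finite_grid[OF \<delta>] us usc_on_continuous cont)
  then have "g (x, w) \<le> (\<lambda>p. grid_majorant M \<delta> (fst p) (tpar (snd p))) (x, w)" unfolding g_eq
    by (rule usc_reg_least[rotated])
       (use w in \<open>auto intro!: SUP_least le_grid_majorant[OF M \<delta>] tpar_nonneg\<close>)
  then show ?thesis by simp
qed

text \<open>Between \<open>l'\<close> and \<open>l\<close> an intermediate parameter \<open>m\<close> is chosen, and the grid so fine that \<open>m + \<delta> < l\<close>;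
  the excess slope \<open>\<delta>\<close> of the majorant is then absorbed. If \<open>u m x = -\<infinity>\<close>, only parameters below \<open>m\<close>
  contribute, and \<open>t \<rightarrow> \<infinity>\<close> shows that the transform is \<open>-\<infinity>\<close>. Otherwise take for \<open>t\<close> the negative slope
  of the chord of \<open>l \<mapsto> u l x\<close> over \<open>[l', m]\<close>, or \<open>0\<close> if that chord increases: by concavity the
  graph is below the chord outside \<open>[l', m]\<close>, and within it is controlled by \<open>u_le_add\<close>, so that
  \<open>u \<mu> x + \<mu>t\<close> is bounded by \<open>u l' x + mt\<close> up to a constant for all \<open>\<mu>\<close>.\<close>

lemma legendre_inf_g_le:
  assumes l: "0 < l'" "l' < l" "l < c"
  obtains C :: real where "\<And>x. legendre_inf g l x \<le> u l' x + ereal C"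
proof -
  obtain M where M: "M \<ge> 0" "\<And>l x. 0 < l \<Longrightarrow> l < c \<Longrightarrow> u l x \<le> ereal M" using u_bounded by metis
  define m where "m = (l' + l) / 2"
  have m: "l' < m" "m < l" "0 < m" "m < c" using l by (auto simp: m_def)
  define \<delta> where "\<delta> = (l - m) / 2"
  have \<delta>: "\<delta> > 0" "m + \<delta> < l" using m by (auto simp: \<delta>_def field_simps)
  have l'c: "l' < c" using l by simp
  define C1 where "C1 = (c / l') * M"
  have C1: "C1 \<ge> 0" using M l c_pos by (simp add: C1_def)
  define G where "G = grid_majorant M \<delta>"
  have leG: "legendre_inf g l x \<le> G x t + ereal (- l * t)" if "t \<ge> 0" for x t
  proof -
    have "rot_sup g x t \<le> G x t"
      by (rule rot_sup_le) (use g_le_grid_majorant[OF M \<delta>(1)] that in \<open>auto simp: G_def\<close>)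
    then have "rot_sup g x t + ereal (- l * t) \<le> G x t + ereal (- l * t)" by (rule add_right_mono)
    moreover have "legendre_inf g l x \<le> rot_sup g x t + ereal (- l * t)"
      unfolding legendre_inf_def using that by (intro INF_lower) auto
    ultimately show ?thesis by (rule order_trans[rotated])
  qed
  have Gle: "G x t + ereal (- l * t) \<le> ereal B"
    if "M + \<delta> * t - l * t \<le> B"
      "\<And>k. k \<in> grid \<delta> \<Longrightarrow> u (real k * \<delta>) x + ereal (M + (real k + 1) * \<delta> * t - l * t) \<le> ereal B" for x t B
  proof -
    have "G x t \<le> ereal (B + l * t)" unfolding G_def grid_majorant_def
    proof (intro max.boundedI SUP_least)
      show "ereal (M + \<delta> * t) \<le> ereal (B + l * t)" using that(1) by simp
      fix k assume "k \<in> grid \<delta>"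
      from that(2)[OF this] show "u (real k * \<delta>) x + ereal (M + (real k + 1) * \<delta> * t) \<le> ereal (B + l * t)"
        by (cases "u (real k * \<delta>) x") auto
    qed
    then show ?thesis by (cases "G x t") auto
  qed
  show ?thesis
  proof (rule that[of "C1 + M"])
    fix x
    show "legendre_inf g l x \<le> u l' x + ereal (C1 + M)"
    proof (cases "u m x")
      case PInf then show ?thesis using u_not_PInf[OF m(3,4)] by simp
    next
      case MInf
      have "legendre_inf g l x \<le> ereal B" for B
      proof -
        define t where "t = max 0 ((2 * M - B) / (l - m - \<delta>))"
        have t: "t \<ge> 0" by (simp add: t_def)
        have "(2 * M - B) / (l - m - \<delta>) \<le> t" by (simp add: t_def)
        then have tB: "2 * M - B \<le> t * (l - m - \<delta>)" using \<delta> by (simp add: pos_divide_le_eq)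
        have "G x t + ereal (- l * t) \<le> ereal B"
        proof (rule Gle)
          have "m * t \<ge> 0" using m t by simp
          then show "M + \<delta> * t - l * t \<le> B" using tB M(1) by (simp add: algebra_simps)
          fix k assume k: "k \<in> grid \<delta>"
          then have kd: "0 < real k * \<delta>" "real k * \<delta> < c" using \<delta> by (auto simp: grid_def)
          show "u (real k * \<delta>) x + ereal (M + (real k + 1) * \<delta> * t - l * t) \<le> ereal B"
          proof (cases "m \<le> real k * \<delta>")
            case True
            have "u (real k * \<delta>) x \<le> ereal (real k * \<delta> / m) * u m x" by (rule u_decreasing[OF m(3) True kd(2)])
            also have "\<dots> = -\<infinity>" unfolding MInf by (rule ereal_pos_mult_MInf) (rule divide_pos_pos[OF kd(1) m(3)])
            finally show ?thesis by simp
          next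
            case False
            have "real k * \<delta> * t \<le> m * t" using False t by (intro mult_right_mono) auto
            then have "M + (M + (real k + 1) * \<delta> * t - l * t) \<le> B" using tB by (simp add: algebra_simps)
            moreover have "u (real k * \<delta>) x \<le> ereal M" by (rule M(2)[OF kd])
            ultimately show ?thesis by (cases "u (real k * \<delta>) x") auto
          qed
        qed
        then show ?thesis using leG[OF t] order_trans by blast
      qed
      then have "legendre_inf g l x = -\<infinity>" by (rule ereal_bot)
      then show ?thesis by simp
    next
      case (real r2)
      have "u m x \<le> ereal (m / l') * u l' x" by (rule u_decreasing[OF l(1) _ m(4)]) (use m in simp)
      then have "u l' x \<noteq> -\<infinity>" using real l m by auto
      then obtain r1 where r1: "u l' x = ereal r1" using u_not_PInf[OF l(1) l'c] by (cases "u l' x") auto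
      \<comment> \<open>The slope of the chord from \<open>l'\<close> to \<open>m\<close>; outside \<open>[l', m]\<close> the graph lies below it.\<close>
      define s where "s = (r2 - r1) / (m - l')"
      have s: "s * (m - l') = r2 - r1" using m by (simp add: s_def)
      define t where "t = max 0 (- s)"
      have t: "t \<ge> 0" by (simp add: t_def)
      have right: "u \<mu> x \<le> ereal (r1 + C1)" if \<mu>: "l' \<le> \<mu>" "\<mu> < c" for \<mu>
      proof -
        have "\<mu> / l' \<le> c / l' + 1" using \<mu> l by (simp add: field_simps)
        from u_le_add[OF M l(1) \<mu> this, of x] l c_pos show ?thesis by (simp add: C1_def r1)
      qed
      have left: "u \<mu> x \<le> ereal (r1 + s * (\<mu> - l'))" if \<mu>: "0 < \<mu>" "\<mu> < l'" for \<mu>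
      proof -
        define \<theta> where "\<theta> = (m - l') / (m - \<mu>)"
        have \<theta>: "0 < \<theta>" "\<theta> < 1" using \<mu> m by (auto simp: \<theta>_def)
        have e: "\<theta> * (m - \<mu>) = m - l'" using \<mu> m by (simp add: \<theta>_def)
        then have "\<theta> * \<mu> + (1 - \<theta>) * m = l'" by (simp add: algebra_simps)
        then have 1: "ereal \<theta> * u \<mu> x + ereal (1 - \<theta>) * u m x \<le> u l' x"
          using u_concave[of \<mu> m \<theta> x] \<mu> m \<theta> l'c by simp
        show ?thesis
        proof (cases "u \<mu> x")
          case PInf then show ?thesis using 1 \<theta> real r1 by simp
        next
          case MInf then show ?thesis by simp
        next
          case a: (real a)
          have "\<theta> * a + (1 - \<theta>) * r2 \<le> r1" using 1 unfolding a real r1 by simp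
          moreover have "r2 = r1 + s * (m - l')" using s by simp
          ultimately have "\<theta> * a \<le> r1 - (1 - \<theta>) * (r1 + s * (m - l'))" by simp
          also have "\<dots> = \<theta> * (r1 + s * (\<mu> - l'))"
          proof -
            have "(1 - \<theta>) * (m - l') = \<theta> * (l' - \<mu>)" using e by (simp add: algebra_simps)
            then have "s * ((1 - \<theta>) * (m - l')) = s * (\<theta> * (l' - \<mu>))" by simp
            then show ?thesis by (simp add: algebra_simps)
          qed
          finally have "a \<le> r1 + s * (\<mu> - l')" using \<theta> by simp
          then show ?thesis using a by simp
        qed
      qed
      have far: "u \<mu> x \<le> ereal (r1 + s * (\<mu> - l'))" if \<mu>: "m < \<mu>" "\<mu> < c" for \<mu>
      proof -
        define \<theta> where "\<theta> = (\<mu> - m) / (\<mu> - l')"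
        have \<theta>: "0 < \<theta>" "\<theta> < 1" using \<mu> m by (auto simp: \<theta>_def)
        have e: "\<theta> * (\<mu> - l') = \<mu> - m" using \<mu> m by (simp add: \<theta>_def)
        then have "\<theta> * l' + (1 - \<theta>) * \<mu> = m" by (simp add: algebra_simps)
        then have 1: "ereal \<theta> * u l' x + ereal (1 - \<theta>) * u \<mu> x \<le> u m x"
          using u_concave[of l' \<mu> \<theta> x] \<mu> m \<theta> l'c l(1) by simp
        show ?thesis
        proof (cases "u \<mu> x")
          case PInf then show ?thesis using 1 \<theta> real r1 by simp
        next
          case MInf then show ?thesis by simp
        next
          case a: (real a)
          have "\<theta> * r1 + (1 - \<theta>) * a \<le> r2" using 1 unfolding a real r1 by simp
          moreover have "r2 = r1 + s * (m - l')" using s by simp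
          ultimately have "(1 - \<theta>) * a \<le> r1 + s * (m - l') - \<theta> * r1" by simp
          also have "\<dots> = (1 - \<theta>) * (r1 + s * (\<mu> - l'))"
          proof -
            have "(1 - \<theta>) * (\<mu> - l') = m - l'" using e by (simp add: algebra_simps)
            then have "s * ((1 - \<theta>) * (\<mu> - l')) = s * (m - l')" by simp
            then show ?thesis by (simp add: algebra_simps)
          qed
          finally have "a \<le> r1 + s * (\<mu> - l')" using \<theta> by simp
          then show ?thesis using a by simp
        qed
      qed
      have key: "u \<mu> x + ereal (\<mu> * t) \<le> ereal (r1 + m * t + C1)" if \<mu>: "0 < \<mu>" "\<mu> < c" for \<mu>
      proof (cases "s > 0")
        case True
        then have t0: "t = 0" by (simp add: t_def)
        show ?thesis
        proof (cases "\<mu> < l'")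
          case True
          have "s * (\<mu> - l') \<le> 0" using \<open>s > 0\<close> True by (simp add: mult_nonneg_nonpos)
          then have "ereal (r1 + s * (\<mu> - l')) \<le> ereal (r1 + C1)" using C1 by simp
          with left[OF \<mu>(1) True] have "u \<mu> x \<le> ereal (r1 + C1)" by (rule order_trans)
          then show ?thesis by (simp add: t0)
        next
          case False
          then show ?thesis using right[of \<mu>] \<mu> by (simp add: t0)
        qed
      next
        case False
        then have ts: "s = - t" by (simp add: t_def)
        have chord: "u \<mu> x + ereal (\<mu> * t) \<le> ereal (r1 + m * t + C1)" if "u \<mu> x \<le> ereal (r1 + s * (\<mu> - l'))"
        proof -
          have "r1 + s * (\<mu> - l') + \<mu> * t = r1 + l' * t" by (simp add: ts algebra_simps)
          moreover have "l' * t \<le> m * t" using m t by (intro mult_right_mono) auto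
          ultimately show ?thesis using that C1 by (cases "u \<mu> x") auto
        qed
        consider "\<mu> < l'" | "l' \<le> \<mu>" "\<mu> \<le> m" | "m < \<mu>" by linarith
        then show ?thesis
        proof cases
          case 1 then show ?thesis using chord left \<mu> by blast
        next
          case 2
          have "\<mu> * t \<le> m * t" using 2 t by (intro mult_right_mono) auto
          then show ?thesis using right[OF 2(1) \<mu>(2)] by (cases "u \<mu> x") auto
        next
          case 3 then show ?thesis using chord far \<mu> by blast
        qed
      qed
      \<comment> \<open>The limit \<open>\<mu> \<rightarrow> 0\<close> of the last estimate; needed for the entry of the majorant without \<open>u\<close>.\<close>
      have pos: "0 \<le> r1 + m * t + C1"
      proof (rule ccontr)
        assume "\<not> ?thesis"
        then have e: "r1 + m * t + C1 < 0" by simp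
        define e where "e = - (r1 + m * t + C1)"
        define \<mu> where "\<mu> = min m (e * m / (2 * (\<bar>r2\<bar> + 1)))"
        have e0: "e > 0" using e by (simp add: e_def)
        have \<mu>: "0 < \<mu>" "\<mu> \<le> m" "\<mu> < c" using m e0 by (auto simp: \<mu>_def)
        have "\<mu> \<le> e * m / (2 * (\<bar>r2\<bar> + 1))" by (simp add: \<mu>_def)
        then have "\<mu> * (2 * (\<bar>r2\<bar> + 1)) \<le> e * m" by (simp add: pos_le_divide_eq)
        moreover have "\<mu> * \<bar>r2\<bar> < \<mu> * (2 * (\<bar>r2\<bar> + 1))" using \<mu> by (intro mult_strict_left_mono) auto
        ultimately have lt: "\<mu> * \<bar>r2\<bar> < e * m" by linarith
        have "\<mu> * (- r2) \<le> \<mu> * \<bar>r2\<bar>" using \<mu> by (intro mult_left_mono) auto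
        then have "- e * m < \<mu> * r2" using lt by simp
        then have 1: "- e < \<mu> * r2 / m" using m by (simp add: pos_less_divide_eq)
        have "ereal r2 \<le> ereal (m / \<mu>) * u \<mu> x" using u_decreasing[OF \<mu>(1,2) m(4), of x] by (simp add: real)
        then have "ereal (\<mu> * r2 / m) \<le> u \<mu> x" using \<mu> m by (cases "u \<mu> x") (auto simp: field_simps)
        moreover have "\<mu> * t \<ge> 0" using \<mu> t by simp
        ultimately show False using key[OF \<mu>(1,3)] 1 by (cases "u \<mu> x") (auto simp: e_def)
      qed
      have "G x t + ereal (- l * t) \<le> ereal (r1 + (C1 + M))"
      proof (rule Gle)
        have mt: "(m + \<delta>) * t \<le> l * t" using \<delta> t by (intro mult_right_mono) auto
        then show "M + \<delta> * t - l * t \<le> r1 + (C1 + M)" using pos by (simp add: algebra_simps)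
        fix k assume k: "k \<in> grid \<delta>"
        then have kd: "0 < real k * \<delta>" "real k * \<delta> < c" using \<delta> by (auto simp: grid_def)
        show "u (real k * \<delta>) x + ereal (M + (real k + 1) * \<delta> * t - l * t) \<le> ereal (r1 + (C1 + M))"
          using key[OF kd] mt by (cases "u (real k * \<delta>) x") (auto simp: algebra_simps)
      qed
      then have "legendre_inf g l x \<le> ereal (r1 + (C1 + M))" using leG[OF t] order_trans by blast
      then show ?thesis by (simp add: r1)
    qed
  qed
qed

end

section \<open>Passing between the manifold and its product with the disc\<close>

lemma interior_punctured_disc: "interior punctured_disc = ball 0 1 - {0}"
proof -
  have "interior punctured_disc = interior (cball 0 1) \<inter> interior (- {0::complex})"
    unfolding punctured_disc_def Diff_eq interior_Int ..
  also have "interior (- {0::complex}) = - {0}" by (rule interior_open) auto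
  finally show ?thesis by auto
qed

lemma interior_strip: "interior (UNIV \<times> punctured_disc) = UNIV \<times> (ball 0 1 - {0})"
  by (simp add: interior_Times interior_punctured_disc)

lemma psh_on_add_tpar:
  fixes f :: "'a::complex_normed \<Rightarrow> ereal"
  assumes f: "psh_on f V"
  shows "psh_on (\<lambda>(y, w). f y + ereal (l * tpar w)) (V \<times> (ball 0 1 - {0}))"
  unfolding psh_on_def
proof (intro conjI ballI allI impI)
  have fusc: "usc_on V f" and ffin: "\<And>y. y \<in> V \<Longrightarrow> f y \<noteq> \<infinity>" using f by (auto simp: psh_on_def)
  have usc1: "usc_on (V \<times> (ball 0 1 - {0::complex})) (\<lambda>p. f (fst p))"
    by (rule usc_on_compose[OF fusc]) (auto intro!: continuous_intros)
  have "usc_on (V \<times> (ball 0 1 - {0})) (\<lambda>p. f (fst p) + ereal (l * tpar (snd p)))"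
    by (intro usc_on_add_continuous usc1 continuous_intros
        continuous_on_compose2[OF continuous_on_tpar[of "ball 0 1 - {0}"]]) auto
  then show "usc_on (V \<times> (ball 0 1 - {0})) (\<lambda>(y, w). f y + ereal (l * tpar w))"
    by (simp add: case_prod_unfold)
  show "(case p of (y, w) \<Rightarrow> f y + ereal (l * tpar w)) \<noteq> \<infinity>" if "p \<in> V \<times> (ball 0 1 - {0})" for p
    using that ffin by (cases p) auto
  fix z :: "'a \<times> complex" and v :: "'a \<times> complex"
  assume disc: "\<forall>\<zeta>\<in>cball 0 1. z + \<zeta> *\<^sub>C v \<in> V \<times> (ball 0 1 - {0})"
  obtain y w where z: "z = (y, w)" by (cases z)
  obtain a b where v: "v = (a, b)" by (cases v)
  have nz: "w + \<zeta> * b \<noteq> 0" and inV: "y + \<zeta> *\<^sub>C a \<in> V" if "cmod \<zeta> \<le> 1" for \<zeta>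
    using bspec[OF disc, of \<zeta>] that by (auto simp: z v)
  obtain h S where h: "h holomorphic_on S" "open S" "cball 0 1 \<subseteq> S"
    "\<And>\<zeta>. cmod \<zeta> \<le> 1 \<Longrightarrow> Re (h \<zeta>) = tpar (w + \<zeta> * b)"
    using tpar_harmonic[of w b, OF nz] by metis
  have "circle_mean (\<lambda>p. f (fst p) + ereal (l * tpar (snd p))) z v
     = circle_mean (\<lambda>p. f (fst p)) z v + ereal (Re (of_real l * h 0))"
  proof (rule circle_mean_add_Re_holomorphic[OF usc1])
    show "(\<lambda>\<zeta>. of_real l * h \<zeta>) holomorphic_on S" by (intro holomorphic_intros h)
    show "z + \<zeta> *\<^sub>C v \<in> V \<times> (ball 0 1 - {0})" if "cmod \<zeta> = 1" for \<zeta> using bspec[OF disc, of \<zeta>] that by simp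
    show "l * tpar (snd (z + \<zeta> *\<^sub>C v)) = Re (of_real l * h \<zeta>)" if "cmod \<zeta> = 1" for \<zeta>
      using h(4)[of \<zeta>] that by (simp add: z v)
  qed (use ffin h in auto)
  moreover have "circle_mean (\<lambda>p. f (fst p)) z v = circle_mean f y a"
    by (simp add: circle_mean_def z v)
  moreover have "f y \<le> circle_mean f y a" using f inV by (auto simp: psh_on_def)
  moreover have "Re (h 0) = tpar w" using h(4)[of 0] by simp
  ultimately have "f y + ereal (l * tpar w) \<le> circle_mean (\<lambda>p. f (fst p) + ereal (l * tpar (snd p))) z v"
    by (simp add: add_right_mono)
  then show "(case z of (y, w) \<Rightarrow> f y + ereal (l * tpar w)) \<le> circle_mean (\<lambda>(y, w). f y + ereal (l * tpar w)) z v"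
    by (simp add: z case_prod_unfold)
qed

lemma lb_dom_pullback [simp]: "lb_dom (pullback_lb L) i = lb_dom L i \<times> UNIV"
  and lb_trans_pullback [simp]: "lb_trans (pullback_lb L) i j = lb_trans L i j \<circ> fst"
  by (simp_all add: pullback_lb_def)

lemma times_plane_chart:
  assumes A: "complex_atlas A" and W: "(W, \<kappa>) \<in> A"
  shows "map_prod \<kappa> id ` ((W \<times> UNIV) \<inter> (UNIV \<times> D \<inter> B \<times> UNIV)) = \<kappa> ` (W \<inter> B) \<times> (D :: complex set)"
    and "y \<in> \<kappa> ` (W \<inter> B) \<Longrightarrow> inv_into (W \<times> UNIV) (map_prod \<kappa> id) (y, w :: complex) = (inv_into W \<kappa> y, w)"
proof -
  show "map_prod \<kappa> id ` ((W \<times> UNIV) \<inter> (UNIV \<times> D \<inter> B \<times> UNIV)) = \<kappa> ` (W \<inter> B) \<times> D"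
    by (auto simp: image_iff map_prod_def)
  show "inv_into (W \<times> UNIV) (map_prod \<kappa> id) (y, w) = (inv_into W \<kappa> y, w)" if y: "y \<in> \<kappa> ` (W \<inter> B)"
  proof -
    have inj: "inj_on \<kappa> W" using chart_inverse(1)[OF A W] by (metis inj_onI)
    have injp: "inj_on (map_prod \<kappa> id) (W \<times> (UNIV::complex set))"
      using inj by (auto simp: inj_on_def)
    obtain x where x: "x \<in> W" "y = \<kappa> x" using y by auto
    have "inv_into (W \<times> UNIV) (map_prod \<kappa> id) (map_prod \<kappa> id (x, w)) = (x, w)"
      by (rule inv_into_f_f[OF injp]) (use x in auto)
    then show ?thesis using x chart_inverse(1)[OF A W x(1)] by simp
  qed
qed

abbreviation PSH_disc ::
  "('x::topological_space, 'e::complex_normed) atlas \<Rightarrow> ('i, 'x) line_bundle \<Rightarrow> ('i \<Rightarrow> 'x \<times> complex \<Rightarrow> ereal) set" where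
  "PSH_disc A L \<equiv> PSH (times_plane A) (UNIV \<times> punctured_disc) 1 (pullback_lb L)"

lemma PSH_add_tpar:
  assumes A: "complex_atlas A" and \<gamma>: "\<gamma> \<in> PSH A UNIV 1 L"
  shows "(\<lambda>i (x, w). \<gamma> i x + ereal (l * tpar w)) \<in> PSH_disc A L"
proof -
  note \<gamma>' = PSH_UNIV_D[OF \<gamma>]
  have "metric_on (UNIV \<times> punctured_disc) 1 (pullback_lb L) (\<lambda>i (x, w). \<gamma> i x + ereal (l * tpar w))"
    unfolding metric_on_def
  proof (intro conjI allI ballI)
    fix i j and p :: "'a \<times> complex"
    show "(case p of (x, w) \<Rightarrow> \<gamma> i x + ereal (l * tpar w)) \<noteq> \<infinity>"
      if "p \<in> UNIV \<times> punctured_disc \<inter> lb_dom (pullback_lb L) i"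
      using that metric_on_not_PInf[OF \<gamma>'(1), of "fst p" i] by (cases p) auto
    assume p: "p \<in> UNIV \<times> punctured_disc \<inter> lb_dom (pullback_lb L) i \<inter> lb_dom (pullback_lb L) j"
    obtain x w where xw: "p = (x, w)" by (cases p)
    have "\<gamma> i x = \<gamma> j x + ereal (1 * ln ((cmod (lb_trans L i j x))\<^sup>2))"
      by (rule metric_on_transition[OF \<gamma>'(1)]) (use p xw in auto)
    then show "(case p of (x, w) \<Rightarrow> \<gamma> i x + ereal (l * tpar w))
      = (case p of (x, w) \<Rightarrow> \<gamma> j x + ereal (l * tpar w)) + ereal (1 * ln ((cmod (lb_trans (pullback_lb L) i j p))\<^sup>2))"
      by (simp add: xw ac_simps)
  qed
  moreover have "usc_on (UNIV \<times> punctured_disc \<inter> lb_dom (pullback_lb L) i) (\<lambda>(x, w). \<gamma> i x + ereal (l * tpar w))" for i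
  proof -
    have "usc_on (lb_dom L i \<times> punctured_disc) (\<lambda>p. \<gamma> i (fst p) + ereal (l * tpar (snd p)))"
      by (intro usc_on_add_continuous usc_on_compose[OF \<gamma>'(2)] continuous_intros
          continuous_on_compose2[OF continuous_on_tpar[of punctured_disc]]) (auto simp: punctured_disc_def)
    moreover have "UNIV \<times> punctured_disc \<inter> lb_dom (pullback_lb L) i = lb_dom L i \<times> punctured_disc" by auto
    ultimately show ?thesis by (simp add: case_prod_unfold)
  qed
  moreover have "psh_fun (times_plane A) (interior (UNIV \<times> punctured_disc) \<inter> lb_dom (pullback_lb L) i)
      (\<lambda>(x, w). \<gamma> i x + ereal (l * tpar w))" for i
    unfolding psh_fun_def
  proof (clarify)
    fix W' \<kappa>' assume "(W', \<kappa>') \<in> times_plane A"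
    then obtain W \<kappa> where W: "(W, \<kappa>) \<in> A" "W' = W \<times> UNIV" "\<kappa>' = map_prod \<kappa> id"
      by (auto simp: times_plane_def)
    have im: "\<kappa>' ` (W' \<inter> (interior (UNIV \<times> punctured_disc) \<inter> lb_dom (pullback_lb L) i))
        = \<kappa> ` (W \<inter> lb_dom L i) \<times> (ball 0 1 - {0})"
      unfolding W(2,3) interior_strip lb_dom_pullback by (rule times_plane_chart(1)[OF A W(1)])
    have "psh_on (\<lambda>(y, w). (\<gamma> i \<circ> inv_into W \<kappa>) y + ereal (l * tpar w)) (\<kappa> ` (W \<inter> lb_dom L i) \<times> (ball 0 1 - {0}))"
      by (rule psh_on_add_tpar[OF \<gamma>'(3)[OF W(1)]])
    then show "psh_on ((\<lambda>(x, w). \<gamma> i x + ereal (l * tpar w)) \<circ> inv_into W' \<kappa>')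
        (\<kappa>' ` (W' \<inter> (interior (UNIV \<times> punctured_disc) \<inter> lb_dom (pullback_lb L) i)))"
      unfolding im
    proof (rule psh_on_cong[THEN iffD1, rotated])
      fix p assume "p \<in> \<kappa> ` (W \<inter> lb_dom L i) \<times> (ball 0 1 - {0::complex})"
      then obtain y w where p: "p = (y, w)" "y \<in> \<kappa> ` (W \<inter> lb_dom L i)" by auto
      show "(case p of (y, w) \<Rightarrow> (\<gamma> i \<circ> inv_into W \<kappa>) y + ereal (l * tpar w))
        = ((\<lambda>(x, w). \<gamma> i x + ereal (l * tpar w)) \<circ> inv_into W' \<kappa>') p"
        unfolding W(2,3) p(1) o_apply times_plane_chart(2)[OF A W(1) p(2)] by simp
    qed
  qed
  ultimately show ?thesis unfolding PSH_def by blast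
qed

lemma PSH_product_D:
  assumes A: "complex_atlas A" and \<gamma>: "\<gamma> \<in> PSH_disc A L"
  shows "usc_on (lb_dom L i \<times> punctured_disc) (\<gamma> i)"
    and "x \<in> lb_dom L i \<Longrightarrow> w \<in> punctured_disc \<Longrightarrow> \<gamma> i (x, w) \<noteq> \<infinity>"
    and "x \<in> lb_dom L i \<Longrightarrow> x \<in> lb_dom L j \<Longrightarrow> w \<in> punctured_disc \<Longrightarrow>
      \<gamma> i (x, w) = \<gamma> j (x, w) + ereal (ln ((cmod (lb_trans L i j x))\<^sup>2))"
    and "(W, \<kappa>) \<in> A \<Longrightarrow> psh_on (\<lambda>p. \<gamma> i (inv_into W \<kappa> (fst p), snd p)) (\<kappa> ` (W \<inter> lb_dom L i) \<times> (ball 0 1 - {0}))"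
proof -
  have eq: "UNIV \<times> punctured_disc \<inter> lb_dom (pullback_lb L) i = lb_dom L i \<times> punctured_disc" by auto
  have m: "metric_on (UNIV \<times> punctured_disc) 1 (pullback_lb L) \<gamma>"
    and u: "usc_on (UNIV \<times> punctured_disc \<inter> lb_dom (pullback_lb L) i) (\<gamma> i)"
    and p: "psh_fun (times_plane A) (interior (UNIV \<times> punctured_disc) \<inter> lb_dom (pullback_lb L) i) (\<gamma> i)"
    using \<gamma> unfolding PSH_def by blast+
  show "usc_on (lb_dom L i \<times> punctured_disc) (\<gamma> i)" using u unfolding eq .
  show "\<gamma> i (x, w) \<noteq> \<infinity>" if "x \<in> lb_dom L i" "w \<in> punctured_disc"
    by (rule metric_on_not_PInf[OF m]) (use that in auto)
  show "\<gamma> i (x, w) = \<gamma> j (x, w) + ereal (ln ((cmod (lb_trans L i j x))\<^sup>2))"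
    if "x \<in> lb_dom L i" "x \<in> lb_dom L j" "w \<in> punctured_disc"
    using metric_on_transition[OF m, of "(x, w)" i j] that by simp
  show "psh_on (\<lambda>p. \<gamma> i (inv_into W \<kappa> (fst p), snd p)) (\<kappa> ` (W \<inter> lb_dom L i) \<times> (ball 0 1 - {0}))"
    if W: "(W, \<kappa>) \<in> A"
  proof -
    have "(W \<times> UNIV, map_prod \<kappa> id) \<in> times_plane A" using W by (force simp: times_plane_def)
    then have "psh_on (\<gamma> i \<circ> inv_into (W \<times> UNIV) (map_prod \<kappa> id))
        (map_prod \<kappa> id ` ((W \<times> UNIV) \<inter> (interior (UNIV \<times> punctured_disc) \<inter> lb_dom (pullback_lb L) i)))"
      using p unfolding psh_fun_def by blast
    then have "psh_on (\<gamma> i \<circ> inv_into (W \<times> UNIV) (map_prod \<kappa> id)) (\<kappa> ` (W \<inter> lb_dom L i) \<times> (ball 0 1 - {0}))"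
      unfolding interior_strip lb_dom_pullback times_plane_chart(1)[OF A W] .
    then show ?thesis
    proof (rule psh_on_cong[THEN iffD1, rotated])
      fix p assume "p \<in> \<kappa> ` (W \<inter> lb_dom L i) \<times> (ball 0 1 - {0::complex})"
      then obtain y w where p: "p = (y, w)" "y \<in> \<kappa> ` (W \<inter> lb_dom L i)" by auto
      show "(\<gamma> i \<circ> inv_into (W \<times> UNIV) (map_prod \<kappa> id)) p = \<gamma> i (inv_into W \<kappa> (fst p), snd p)"
        unfolding p(1) o_apply times_plane_chart(2)[OF A W p(2)] by simp
    qed
  qed
qed

lemma PSH_product_in_chart:
  fixes i
  assumes A: "complex_atlas A" and \<gamma>: "\<gamma> \<in> PSH_disc A L" and W: "(W, \<kappa>) \<in> A"
  defines "V \<equiv> \<kappa> ` (W \<inter> lb_dom L i)" and "f \<equiv> \<lambda>p. \<gamma> i (inv_into W \<kappa> (fst p), snd p)"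
  shows "psh_on f (V \<times> (ball 0 1 - {0}))" "usc_on (V \<times> punctured_disc) f"
    and "p \<in> V \<times> punctured_disc \<Longrightarrow> f p \<noteq> \<infinity>"
    and "rot_sup f y t = rot_sup (\<gamma> i) (inv_into W \<kappa> y) t"
proof -
  note \<gamma>' = PSH_product_D[OF A \<gamma>]
  have inv: "inv_into W \<kappa> y \<in> lb_dom L i" if "y \<in> V" for y
    using chart_inverse(2)[OF A W] that unfolding V_def by blast
  show "psh_on f (V \<times> (ball 0 1 - {0}))" unfolding f_def V_def by (rule \<gamma>'(4)[OF W])
  show "usc_on (V \<times> punctured_disc) f" unfolding f_def
  proof (rule usc_on_compose[OF \<gamma>'(1)])
    show "continuous_on (V \<times> punctured_disc) (\<lambda>p. (inv_into W \<kappa> (fst p), snd p))"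
      unfolding V_def
      by (intro continuous_intros continuous_on_compose2[OF chart_inverse(3)[OF A W]]) auto
  qed (use inv in auto)
  show "f p \<noteq> \<infinity>" if "p \<in> V \<times> punctured_disc"
    unfolding f_def by (rule \<gamma>'(2)) (use that inv in auto)
  show "rot_sup f y t = rot_sup (\<gamma> i) (inv_into W \<kappa> y) t" by (simp add: rot_sup_def f_def)
qed

lemma legendre_inf_le_add:
  assumes le: "\<And>w. w \<in> punctured_disc \<Longrightarrow> f (x, w) \<le> h (x, w) + ereal d"
  shows "legendre_inf f l x \<le> legendre_inf h l x + ereal d"
proof -
  have "legendre_inf f l x + ereal (- d) \<le> rot_sup h x t + ereal (- l * t)" if t: "t \<ge> 0" for t
  proof -
    have "rot_sup f x t \<le> rot_sup h x t + ereal d"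
    proof (rule rot_sup_le)
      fix w assume w: "w \<in> punctured_disc" "tpar w = t"
      have "f (x, w) \<le> h (x, w) + ereal d" by (rule le[OF w(1)])
      also have "\<dots> \<le> rot_sup h x t + ereal d" using le_rot_sup[OF w(1), of h x] w(2) by (intro add_right_mono) simp
      finally show "f (x, w) \<le> rot_sup h x t + ereal d" .
    qed (rule t)
    moreover have "legendre_inf f l x \<le> rot_sup f x t + ereal (- l * t)"
      unfolding legendre_inf_def using t by (intro INF_lower) auto
    ultimately have "legendre_inf f l x \<le> (rot_sup h x t + ereal d) + ereal (- l * t)"
      by (meson add_right_mono order_trans)
    then show ?thesis by (cases "legendre_inf f l x"; cases "rot_sup h x t") auto
  qed
  then have "legendre_inf f l x + ereal (- d) \<le> legendre_inf h l x"
    unfolding legendre_inf_def[of h] by (intro INF_greatest) auto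
  then show ?thesis by (cases "legendre_inf f l x"; cases "legendre_inf h l x") auto
qed

text \<open>The transition functions do not depend on \<open>w\<close>, so they pass through the transform; positivity is
  Kiselman's principle in each chart.\<close>

lemma PSH_legendre_inf:
  assumes A: "complex_atlas A" and L: "holomorphic_line_bundle A L"
    and \<gamma>: "\<gamma> \<in> PSH_disc A L"
  shows "(\<lambda>i. legendre_inf (\<gamma> i) l) \<in> PSH A UNIV 1 L"
proof -
  note \<gamma>' = PSH_product_D[OF A \<gamma>]
  have op: "open (lb_dom L i)" for i using L by (simp add: holomorphic_line_bundle_def)
  have fin: "legendre_inf (\<gamma> i) l x \<noteq> \<infinity>" if x: "x \<in> lb_dom L i" for i x
  proof -
    have "rot_sup (\<gamma> i) x 0 \<noteq> \<infinity>"
      by (rule rot_sup_not_PInf[OF \<gamma>'(1) _ x]) (use \<gamma>'(2) in auto)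
    moreover have "legendre_inf (\<gamma> i) l x \<le> rot_sup (\<gamma> i) x 0 + ereal (- l * 0)"
      unfolding legendre_inf_def by (intro INF_lower) auto
    ultimately show ?thesis by auto
  qed
  have "metric_on UNIV 1 L (\<lambda>i. legendre_inf (\<gamma> i) l)"
    unfolding metric_on_def
  proof (intro conjI allI ballI)
    fix i j x
    show "legendre_inf (\<gamma> i) l x \<noteq> \<infinity>" if "x \<in> UNIV \<inter> lb_dom L i" using fin that by simp
    assume x: "x \<in> UNIV \<inter> lb_dom L i \<inter> lb_dom L j"
    define d where "d = ln ((cmod (lb_trans L i j x))\<^sup>2)"
    have eq: "\<gamma> i (x, w) = \<gamma> j (x, w) + ereal d" if "w \<in> punctured_disc" for w
      unfolding d_def by (rule \<gamma>'(3)) (use x that in auto)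
    have 1: "legendre_inf (\<gamma> i) l x \<le> legendre_inf (\<gamma> j) l x + ereal d"
      by (rule legendre_inf_le_add) (simp add: eq)
    have 2: "legendre_inf (\<gamma> j) l x \<le> legendre_inf (\<gamma> i) l x + ereal (- d)"
    proof (rule legendre_inf_le_add)
      fix w assume "w \<in> punctured_disc"
      from eq[OF this] show "\<gamma> j (x, w) \<le> \<gamma> i (x, w) + ereal (- d)" by (cases "\<gamma> j (x, w)") auto
    qed
    show "legendre_inf (\<gamma> i) l x = legendre_inf (\<gamma> j) l x + ereal (1 * ln ((cmod (lb_trans L i j x))\<^sup>2))"
      using 1 2 unfolding d_def[symmetric]
      by (cases "legendre_inf (\<gamma> i) l x"; cases "legendre_inf (\<gamma> j) l x") auto
  qed
  moreover have "usc_on (UNIV \<inter> lb_dom L i) (legendre_inf (\<gamma> i) l)" for i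
    using usc_on_legendre_inf[OF \<gamma>'(1)] by simp
  moreover have "psh_fun A (interior UNIV \<inter> lb_dom L i) (legendre_inf (\<gamma> i) l)" for i
    unfolding psh_fun_def
  proof (clarify)
    fix W \<kappa> assume W: "(W, \<kappa>) \<in> A"
    note c = PSH_product_in_chart[OF A \<gamma> W, where i = i]
    have "psh_on (legendre_inf (\<lambda>p. \<gamma> i (inv_into W \<kappa> (fst p), snd p)) l) (\<kappa> ` (W \<inter> lb_dom L i))"
      by (rule psh_on_legendre_inf[OF open_chart_image[OF A W op] c(1-3)])
    moreover have "legendre_inf (\<lambda>p. \<gamma> i (inv_into W \<kappa> (fst p), snd p)) l = legendre_inf (\<gamma> i) l \<circ> inv_into W \<kappa>"
      by (simp add: fun_eq_iff legendre_inf_def c(4))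
    ultimately show "psh_on (legendre_inf (\<gamma> i) l \<circ> inv_into W \<kappa>) (\<kappa> ` (W \<inter> (interior UNIV \<inter> lb_dom L i)))"
      by simp
  qed
  ultimately show ?thesis unfolding PSH_def by blast
qed

lemma rot_sup_three_circles_PSH:
  assumes A: "complex_atlas A"
    and \<gamma>: "\<gamma> \<in> PSH_disc A L"
    and x: "x \<in> lb_dom L i" and t: "0 \<le> t1" "t1 \<le> t" "t \<le> t2"
    and le: "rot_sup (\<gamma> i) x t1 \<le> ereal (a + b * t1)" "rot_sup (\<gamma> i) x t2 \<le> ereal (a + b * t2)"
  shows "rot_sup (\<gamma> i) x t \<le> ereal (a + b * t)"
proof -
  obtain W \<kappa> where W: "(W, \<kappa>) \<in> A" "x \<in> W" using atlas_covers[OF A] .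
  note c = PSH_product_in_chart[OF A \<gamma> W(1), where i = i]
  have eq: "rot_sup (\<lambda>p. \<gamma> i (inv_into W \<kappa> (fst p), snd p)) (\<kappa> x) s = rot_sup (\<gamma> i) x s" for s
    unfolding c(4) chart_inverse(1)[OF A W] ..
  have "\<kappa> x \<in> \<kappa> ` (W \<inter> lb_dom L i)" using W x by blast
  show ?thesis by (rule rot_sup_three_circles[OF c(1-3) \<open>\<kappa> x \<in> _\<close> t, unfolded eq, OF _ le])
qed

section \<open>Legendre transform and maximal envelope\<close>

text \<open>The hypothesis \<open>cmp\<close> is convexity of \<open>\<Gamma>\<close> on \<open>[0,\<infinity>)\<close>. A finite value at an interior point makes
  \<open>\<Gamma>\<close> real, and the linear bound \<open>p + ct\<close> limits the slope of a supporting line, as \<open>t \<rightarrow> \<infinity>\<close> shows.\<close>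

lemma convex_supporting_line:
  fixes \<Gamma> :: "real \<Rightarrow> ereal"
  assumes cmp: "\<And>t1 t t2 a b. 0 \<le> t1 \<Longrightarrow> t1 \<le> t \<Longrightarrow> t \<le> t2 \<Longrightarrow> \<Gamma> t1 \<le> ereal (a + b * t1) \<Longrightarrow>
      \<Gamma> t2 \<le> ereal (a + b * t2) \<Longrightarrow> \<Gamma> t \<le> ereal (a + b * t)"
    and up: "\<And>t. t \<ge> 0 \<Longrightarrow> \<Gamma> t \<le> ereal (p + c * t)"
    and t0: "t0 > 0" and G0: "\<Gamma> t0 = ereal G0"
  obtains b where "b \<le> c" "\<And>t. t \<ge> 0 \<Longrightarrow> ereal (G0 + b * (t - t0)) \<le> \<Gamma> t"
proof -
  \<comment> \<open>A value \<open>-\<infinity>\<close> would propagate to \<open>t0\<close> through lines that descend steeply enough.\<close>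
  have fin: "\<Gamma> t \<noteq> -\<infinity>" if t: "t \<ge> 0" for t
  proof
    assume inf: "\<Gamma> t = -\<infinity>"
    define t' where "t' = (if t < t0 then t0 + 1 else 0)"
    have tt: "t' \<ge> 0" "t' \<noteq> t0" "t < t0 \<Longrightarrow> t0 < t'" "t0 < t \<Longrightarrow> t' < t0" using t0 t by (auto simp: t'_def)
    have tn: "t \<noteq> t0" using inf G0 by auto
    define B where "B = p + c * t'"
    define m where "m = (B - (G0 - 1)) / (t' - t0)"
    define a where "a = B - m * t'"
    have mm: "m * (t' - t0) = B - (G0 - 1)" using tt(2) by (simp add: m_def)
    have 1: "\<Gamma> t' \<le> ereal (a + m * t')" using up[OF tt(1)] by (simp add: a_def B_def)
    have 2: "\<Gamma> t \<le> ereal (a + m * t)" using inf by simp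
    have "\<Gamma> t0 \<le> ereal (a + m * t0)"
    proof (cases "t < t0")
      case True then show ?thesis using cmp[of t t0 t' a m] 1 2 tt t by auto
    next
      case False then show ?thesis using cmp[of t' t0 t a m] 1 2 tt t tn by auto
    qed
    moreover have "a + m * t0 = G0 - 1" using mm by (simp add: a_def algebra_simps)
    ultimately show False using G0 by simp
  qed
  define f where "f = (\<lambda>t. real_of_ereal (\<Gamma> t))"
  have \<Gamma>f: "\<Gamma> t = ereal (f t)" if "t \<ge> 0" for t
    using fin[OF that] up[OF that] by (cases "\<Gamma> t") (auto simp: f_def)
  have conv: "convex_on {0..} f"
  proof (rule convex_on_linorderI)
    fix s x y :: real assume s: "0 < s" "s < 1" and xy: "x \<in> {0..}" "y \<in> {0..}" "x < y"
    define m where "m = (f y - f x) / (y - x)"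
    define a where "a = f x - m * x"
    have m: "m * (y - x) = f y - f x" using xy by (simp add: m_def)
    define z where "z = (1 - s) * x + s * y"
    have z: "z = x + s * (y - x)" by (simp add: z_def algebra_simps)
    have zx: "x \<le> z" unfolding z using s xy by simp
    have "s * (y - x) \<le> 1 * (y - x)" using s xy by (intro mult_right_mono) auto
    then have zy: "z \<le> y" unfolding z by simp
    have "a + m * y = f y" using m by (simp add: a_def algebra_simps)
    then have "\<Gamma> z \<le> ereal (a + m * z)" using xy zx zy by (intro cmp[of x z y]) (auto simp: \<Gamma>f a_def)
    moreover have "a + m * z = (1 - s) * f x + s * f y"
    proof -
      have "a + m * z = f x + s * (m * (y - x))" by (simp add: a_def z algebra_simps)
      then show ?thesis unfolding m by (simp add: algebra_simps)
    qed
    moreover have "z \<ge> 0" using zx xy by simp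
    ultimately show "f ((1 - s) *\<^sub>R x + s *\<^sub>R y) \<le> (1 - s) * f x + s * f y"
      by (simp add: \<Gamma>f z_def)
  qed simp
  define b where "b = Inf ((\<lambda>t. (f t0 - f t) / (t0 - t)) ` ({t0<..} \<inter> {0..}))"
  have "t0 \<in> interior {0..}" using t0 by simp
  from convex_le_Inf_differential[OF conv this]
  have sup: "f t \<ge> f t0 + b * (t - t0)" if "t \<ge> 0" for t using that by (simp add: b_def)
  have f0: "f t0 = G0" using G0 \<Gamma>f[of t0] t0 by simp
  have "b \<le> c"
  proof (rule ccontr)
    assume "\<not> b \<le> c"
    then have bc: "b - c > 0" by simp
    define t where "t = max 0 ((p - G0 + b * t0) / (b - c) + 1)"
    have t: "t \<ge> 0" "(p - G0 + b * t0) / (b - c) < t" by (auto simp: t_def)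
    then have "p - G0 + b * t0 < t * (b - c)" using bc by (simp add: pos_divide_less_eq)
    moreover have "f t \<le> p + c * t" using up[OF t(1)] \<Gamma>f[OF t(1)] by simp
    ultimately show False using sup[OF t(1)] f0 by (simp add: algebra_simps)
  qed
  then show ?thesis using that[of b] sup \<Gamma>f f0 by auto
qed

locale envelope_setup = test_curve_setup A F \<sigma> \<psi> c
  for A :: "('x::t2_space, complex^'n) atlas" and F :: "('j, 'x) line_bundle"
    and \<sigma> :: "'j \<Rightarrow> 'x \<Rightarrow> real" and \<psi> :: "real \<Rightarrow> 'j \<Rightarrow> 'x \<Rightarrow> ereal" and c :: real +
  fixes L :: "('i, 'x) line_bundle" and \<phi> :: "'i \<Rightarrow> 'x \<Rightarrow> real"
  assumes L: "holomorphic_line_bundle A L"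
    and \<phi>_PSH: "(\<lambda>i x. ereal (\<phi> i x)) \<in> PSH A UNIV 1 L"
begin

text \<open>The metrics whose regularised supremum is \<open>\<phi>\<^sub>l\<close>.\<close>

definition competitors :: "real \<Rightarrow> ('i \<Rightarrow> 'x \<Rightarrow> ereal) set" where
  "competitors l = {\<gamma> \<in> PSH A UNIV 1 L. metric_le UNIV L \<gamma> (\<lambda>i x. ereal (\<phi> i x)) \<and>
     (\<exists>C::real. metric_le UNIV L \<gamma> (\<lambda>i x. ereal (\<phi> i x) + u l x + ereal C))}"

definition env_curve :: "real \<Rightarrow> 'i \<Rightarrow> 'x \<Rightarrow> ereal" where "env_curve = envelope_curve A L F \<phi> \<sigma> c \<psi>"

text \<open>The Legendre transform before regularisation in \<open>x\<close>.\<close>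

definition raw_transform :: "real \<Rightarrow> 'i \<Rightarrow> 'x \<Rightarrow> ereal" where "raw_transform t i x = (SUP l. env_curve l i x + ereal (t * l))"

text \<open>The metrics whose regularised supremum is the maximal envelope on the product.\<close>

definition product_competitors :: "('i \<Rightarrow> 'x \<times> complex \<Rightarrow> ereal) set" where
  "product_competitors = {\<gamma> \<in> PSH_disc A L.
     metric_le (UNIV \<times> punctured_disc) (pullback_lb L) \<gamma> (\<lambda>i (x, w). ereal (\<phi> i x + c * tpar w)) \<and>
     (\<exists>C::real. metric_le (UNIV \<times> punctured_disc) (pullback_lb L) \<gamma>
        (\<lambda>i p. (case p of (x, w) \<Rightarrow> ereal (\<phi> i x) + g (x, w)) + ereal C))}"

lemma env_curve_nonpos: "l \<le> 0 \<Longrightarrow> env_curve l i x = ereal (\<phi> i x)"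
  by (simp add: env_curve_def envelope_curve_def)

lemma env_curve_ge: "l \<ge> c \<Longrightarrow> env_curve l i x = -\<infinity>"
  using c_pos by (simp add: env_curve_def envelope_curve_def)

lemma env_curve_eq: "0 < l \<Longrightarrow> l < c \<Longrightarrow> env_curve l i = usc_reg (lb_dom L i) (\<lambda>x. SUP \<gamma>\<in>competitors l. \<gamma> i x)"
  by (simp add: env_curve_def envelope_curve_def maximal_envelope_def sup_star_def competitors_def u_def)

lemma legendre_transform_eq: "legendre_transform A L F \<phi> \<sigma> c \<psi> t i = usc_reg (lb_dom L i) (raw_transform t i)"
proof -
  have "(SUP \<gamma>\<in>range (\<lambda>l::real. \<lambda>i x. env_curve l i x + ereal (t * l)). \<gamma> i x) = raw_transform t i x" for x
    unfolding raw_transform_def by (simp add: image_image)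
  then show ?thesis by (simp add: legendre_transform_def sup_star_def env_curve_def fun_eq_iff)
qed

lemma product_envelope_eq:
  "product_envelope A L F \<phi> \<sigma> c \<psi> i = usc_reg (lb_dom L i \<times> punctured_disc) (\<lambda>p. SUP \<gamma>\<in>product_competitors. \<gamma> i p)"
proof -
  have eq: "UNIV \<times> punctured_disc \<inter> lb_dom (pullback_lb L) i = lb_dom L i \<times> punctured_disc" by auto
  show ?thesis unfolding product_envelope_def maximal_envelope_def sup_star_def eq product_competitors_def g_def ..
qed

lemma competitorsD:
  assumes "\<gamma> \<in> competitors l"
  shows "\<gamma> \<in> PSH A UNIV 1 L" "x \<in> lb_dom L i \<Longrightarrow> \<gamma> i x \<le> ereal (\<phi> i x)"
    "\<exists>C. \<forall>i. \<forall>x\<in>lb_dom L i. \<gamma> i x \<le> ereal (\<phi> i x) + u l x + ereal C"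
  using assms unfolding competitors_def metric_le_def by auto

lemma competitorsI:
  assumes "\<gamma> \<in> PSH A UNIV 1 L" "\<And>i x. x \<in> lb_dom L i \<Longrightarrow> \<gamma> i x \<le> ereal (\<phi> i x)"
    "\<And>i x. x \<in> lb_dom L i \<Longrightarrow> \<gamma> i x \<le> ereal (\<phi> i x) + u l x + ereal C"
  shows "\<gamma> \<in> competitors l"
  using assms unfolding competitors_def metric_le_def by (auto intro!: exI[of _ C])

lemma product_competitorsD:
  assumes "\<gamma> \<in> product_competitors"
  shows "\<gamma> \<in> PSH_disc A L"
    and "x \<in> lb_dom L i \<Longrightarrow> w \<in> punctured_disc \<Longrightarrow> \<gamma> i (x, w) \<le> ereal (\<phi> i x + c * tpar w)"
    and "\<exists>C. \<forall>i. \<forall>x\<in>lb_dom L i. \<forall>w\<in>punctured_disc. \<gamma> i (x, w) \<le> ereal (\<phi> i x) + g (x, w) + ereal C"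
proof -
  have P: "\<gamma> \<in> PSH_disc A L"
    and 1: "metric_le (UNIV \<times> punctured_disc) (pullback_lb L) \<gamma> (\<lambda>i (x, w). ereal (\<phi> i x + c * tpar w))"
    and 2: "\<exists>C::real. metric_le (UNIV \<times> punctured_disc) (pullback_lb L) \<gamma>
        (\<lambda>i p. (case p of (x, w) \<Rightarrow> ereal (\<phi> i x) + g (x, w)) + ereal C)"
    using assms unfolding product_competitors_def by blast+
  show "\<gamma> \<in> PSH_disc A L" by (rule P)
  show "\<gamma> i (x, w) \<le> ereal (\<phi> i x + c * tpar w)" if "x \<in> lb_dom L i" "w \<in> punctured_disc"
    using 1[unfolded metric_le_def, rule_format, of "(x, w)" i] that by simp
  obtain C where C: "metric_le (UNIV \<times> punctured_disc) (pullback_lb L) \<gamma>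
        (\<lambda>i p. (case p of (x, w) \<Rightarrow> ereal (\<phi> i x) + g (x, w)) + ereal C)" using 2 by blast
  have "\<gamma> i (x, w) \<le> ereal (\<phi> i x) + g (x, w) + ereal C" if "x \<in> lb_dom L i" "w \<in> punctured_disc" for i x w
    using C[unfolded metric_le_def, rule_format, of "(x, w)" i] that by simp
  then show "\<exists>C. \<forall>i. \<forall>x\<in>lb_dom L i. \<forall>w\<in>punctured_disc. \<gamma> i (x, w) \<le> ereal (\<phi> i x) + g (x, w) + ereal C"
    by blast
qed

lemma product_competitorsI:
  assumes "\<gamma> \<in> PSH_disc A L"
    and "\<And>i x w. x \<in> lb_dom L i \<Longrightarrow> w \<in> punctured_disc \<Longrightarrow> \<gamma> i (x, w) \<le> ereal (\<phi> i x + c * tpar w)"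
    and "\<And>i x w. x \<in> lb_dom L i \<Longrightarrow> w \<in> punctured_disc \<Longrightarrow> \<gamma> i (x, w) \<le> ereal (\<phi> i x) + g (x, w) + ereal C"
  shows "\<gamma> \<in> product_competitors"
proof -
  have "metric_le (UNIV \<times> punctured_disc) (pullback_lb L) \<gamma> (\<lambda>i (x, w). ereal (\<phi> i x + c * tpar w))"
    unfolding metric_le_def using assms(2) by auto
  moreover have "metric_le (UNIV \<times> punctured_disc) (pullback_lb L) \<gamma>
      (\<lambda>i p. (case p of (x, w) \<Rightarrow> ereal (\<phi> i x) + g (x, w)) + ereal C)"
    unfolding metric_le_def using assms(3) by auto
  ultimately show ?thesis using assms(1) unfolding product_competitors_def by blast
qed

lemma competitor_add_tpar:
  assumes l: "0 < l" "l < c" and \<gamma>: "\<gamma> \<in> competitors l"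
  shows "(\<lambda>i (x, w). \<gamma> i x + ereal (l * tpar w)) \<in> product_competitors"
proof -
  obtain C where C: "\<And>i x. x \<in> lb_dom L i \<Longrightarrow> \<gamma> i x \<le> ereal (\<phi> i x) + u l x + ereal C"
    using competitorsD(3)[OF \<gamma>] by blast
  show ?thesis
  proof (rule product_competitorsI[where C = C])
    show "(\<lambda>i (x, w). \<gamma> i x + ereal (l * tpar w)) \<in> PSH_disc A L"
      by (rule PSH_add_tpar[OF atlas competitorsD(1)[OF \<gamma>]])
    fix i x w assume x: "x \<in> lb_dom L i" and w: "w \<in> punctured_disc"
    have "l * tpar w \<le> c * tpar w" using l tpar_nonneg[OF w] by (intro mult_right_mono) auto
    then show "(case (x, w) of (x, w) \<Rightarrow> \<gamma> i x + ereal (l * tpar w)) \<le> ereal (\<phi> i x + c * tpar w)"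
      using competitorsD(2)[OF \<gamma> x] by (cases "\<gamma> i x") auto
    have "\<gamma> i x + ereal (l * tpar w) \<le> (ereal (\<phi> i x) + u l x + ereal C) + ereal (l * tpar w)"
      by (rule add_right_mono[OF C[OF x]])
    also have "\<dots> = ereal (\<phi> i x) + (u l x + ereal (l * tpar w)) + ereal C" by (simp add: ac_simps)
    also have "\<dots> \<le> ereal (\<phi> i x) + g (x, w) + ereal C"
      by (intro add_right_mono add_left_mono le_g l w)
    finally show "(case (x, w) of (x, w) \<Rightarrow> \<gamma> i x + ereal (l * tpar w)) \<le> ereal (\<phi> i x) + g (x, w) + ereal C"
      by simp
  qed
qed

lemma \<phi>_in_product_competitors: "(\<lambda>i (x, w). ereal (\<phi> i x)) \<in> product_competitors"
proof (rule product_competitorsI[where C = 0])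
  show "(\<lambda>i (x, w). ereal (\<phi> i x)) \<in> PSH_disc A L"
    using PSH_add_tpar[OF atlas \<phi>_PSH, of 0] by simp
  fix i x w assume w: "w \<in> punctured_disc"
  show "(case (x, w) of (x, w) \<Rightarrow> ereal (\<phi> i x)) \<le> ereal (\<phi> i x + c * tpar w)"
    using c_pos tpar_nonneg[OF w] by simp
  show "(case (x, w) of (x, w) \<Rightarrow> ereal (\<phi> i x)) \<le> ereal (\<phi> i x) + g (x, w) + ereal 0"
    using add_left_mono[OF g_nonneg[OF w, of x], of "ereal (\<phi> i x)"] by simp
qed

text \<open>The competitors \<open>\<gamma> + l t\<close> and \<open>\<phi>\<close> put every term of the supremum below the envelope, which is
  upper semicontinuous and therefore survives both regularisations in \<open>x\<close>.\<close>

lemma transform_le_product_envelope: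
  assumes x: "x \<in> lb_dom L i" and w: "w \<in> punctured_disc"
  shows "usc_reg (lb_dom L i) (raw_transform (tpar w) i) x \<le> usc_reg (lb_dom L i \<times> punctured_disc) (\<lambda>p. SUP \<gamma>\<in>product_competitors. \<gamma> i p) (x, w)"
proof -
  define P where "P = usc_reg (lb_dom L i \<times> punctured_disc) (\<lambda>p. SUP \<gamma>\<in>product_competitors. \<gamma> i p)"
  define t where "t = tpar w"
  have t: "t \<ge> 0" using tpar_nonneg[OF w] by (simp add: t_def)
  have le_P: "\<gamma> i (y, w) \<le> P (y, w)" if "\<gamma> \<in> product_competitors" "y \<in> lb_dom L i" for \<gamma> y
  proof -
    have "\<gamma> i (y, w) \<le> (SUP \<gamma>\<in>product_competitors. \<gamma> i (y, w))" using that by (intro SUP_upper)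
    also have "\<dots> \<le> P (y, w)" unfolding P_def using that w by (intro usc_reg_ge) auto
    finally show ?thesis .
  qed
  have Pusc: "usc_on (lb_dom L i) (\<lambda>y. P (y, w))"
    by (rule usc_on_compose[of "lb_dom L i \<times> punctured_disc"])
       (use w in \<open>auto simp: P_def intro!: usc_on_usc_reg continuous_intros\<close>)
  have env_le: "env_curve l i y + ereal (t * l) \<le> P (y, w)" if y: "y \<in> lb_dom L i" for l y
  proof -
    consider "l \<le> 0" | "0 < l" "l < c" | "c \<le> l" by linarith
    then show ?thesis
    proof cases
      case 1
      have "t * l \<le> 0" using t 1 by (simp add: mult_nonneg_nonpos)
      then have "env_curve l i y + ereal (t * l) \<le> ereal (\<phi> i y)" by (simp add: env_curve_nonpos[OF 1])
      also have "\<dots> \<le> P (y, w)" using le_P[OF \<phi>_in_product_competitors y] by simp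
      finally show ?thesis .
    next
      case 2
      have "env_curve l i y \<le> P (y, w) + ereal (- (t * l))" unfolding env_curve_eq[OF 2]
      proof (rule usc_reg_least[OF y])
        show "usc_on (lb_dom L i) (\<lambda>y. P (y, w) + ereal (- (t * l)))"
          by (rule usc_on_add_continuous[OF Pusc]) (intro continuous_intros)
        fix z assume z: "z \<in> lb_dom L i"
        show "(SUP \<gamma>\<in>competitors l. \<gamma> i z) \<le> P (z, w) + ereal (- (t * l))"
        proof (rule SUP_least)
          fix \<gamma> assume "\<gamma> \<in> competitors l"
          from le_P[OF competitor_add_tpar[OF 2 this] z]
          show "\<gamma> i z \<le> P (z, w) + ereal (- (t * l))"
            by (cases "\<gamma> i z"; cases "P (z, w)") (auto simp: t_def mult.commute)
        qed
      qed
      then show ?thesis by (cases "env_curve l i y"; cases "P (y, w)") auto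
    next
      case 3 then show ?thesis by (simp add: env_curve_ge)
    qed
  qed
  have "usc_reg (lb_dom L i) (raw_transform t i) x \<le> P (x, w)"
    by (rule usc_reg_least[OF x Pusc]) (auto simp: raw_transform_def intro!: SUP_least env_le)
  then show ?thesis by (simp add: P_def t_def)
qed

lemma \<phi>_le_raw_transform: "ereal (\<phi> i x) \<le> raw_transform t i x"
proof -
  have "env_curve 0 i x + ereal (t * 0) \<le> raw_transform t i x" unfolding raw_transform_def by (rule SUP_upper) simp
  then show ?thesis by (simp add: env_curve_nonpos)
qed

text \<open>Only parameters \<open>l\<close> between \<open>0\<close> and \<open>c\<close> contribute: those above \<open>c\<close> give \<open>-\<infinity>\<close>, and the
  nonpositive ones give at most \<open>\<phi>\<close>.\<close>

lemma raw_transform_Lipschitz: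
  assumes t: "t \<ge> 0" "t' \<ge> 0"
  shows "raw_transform t' i x \<le> raw_transform t i x + ereal (c * \<bar>t' - t\<bar>)"
  unfolding raw_transform_def[of t']
proof (rule SUP_least)
  fix l :: real
  have c0: "c * \<bar>t' - t\<bar> \<ge> 0" using c_pos by simp
  consider "l \<le> 0" | "0 < l" "l < c" | "c \<le> l" by linarith
  then show "env_curve l i x + ereal (t' * l) \<le> raw_transform t i x + ereal (c * \<bar>t' - t\<bar>)"
  proof cases
    case 1
    have "t' * l \<le> 0" using t 1 by (simp add: mult_nonneg_nonpos)
    then have "env_curve l i x + ereal (t' * l) \<le> ereal (\<phi> i x) + ereal 0" by (simp add: env_curve_nonpos[OF 1])
    also have "\<dots> \<le> raw_transform t i x + ereal (c * \<bar>t' - t\<bar>)" using c0 by (intro add_mono \<phi>_le_raw_transform) auto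
    finally show ?thesis .
  next
    case 2
    have "l * (t' - t) \<le> l * \<bar>t' - t\<bar>" using 2 by (intro mult_left_mono) auto
    also have "\<dots> \<le> c * \<bar>t' - t\<bar>" using 2 by (intro mult_right_mono) auto
    finally have "l * (t' - t) \<le> c * \<bar>t' - t\<bar>" .
    then have "env_curve l i x + ereal (t' * l) \<le> (env_curve l i x + ereal (t * l)) + ereal (c * \<bar>t' - t\<bar>)"
      by (cases "env_curve l i x") (auto simp: algebra_simps)
    also have "\<dots> \<le> raw_transform t i x + ereal (c * \<bar>t' - t\<bar>)"
      unfolding raw_transform_def by (intro add_right_mono SUP_upper) simp
    finally show ?thesis .
  next
    case 3 then show ?thesis by (simp add: env_curve_ge)
  qed
qed

text \<open>The transform is regularised in \<open>x\<close> for each \<open>t\<close> separately, the envelope in both variables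
  jointly. The Lipschitz bound in \<open>t\<close>, uniform in \<open>x\<close>, makes the two agree.\<close>

lemma usc_on_legendre_transform:
  "usc_on (lb_dom L i \<times> punctured_disc) (\<lambda>(x, w). usc_reg (lb_dom L i) (raw_transform (tpar w) i) x)"
proof (rule usc_onI)
  fix p a assume p: "p \<in> lb_dom L i \<times> punctured_disc"
    and a: "(case p of (x, w) \<Rightarrow> usc_reg (lb_dom L i) (raw_transform (tpar w) i) x) < a"
  obtain x w where xw: "p = (x, w)" "x \<in> lb_dom L i" "w \<in> punctured_disc" using p by auto
  obtain r where r: "usc_reg (lb_dom L i) (raw_transform (tpar w) i) x < ereal r" "ereal r < a"
    using ereal_dense2[of _ a] a xw by auto
  obtain r' where r': "r < r'" "ereal r' < a" using ereal_dense2[OF r(2)] by auto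
  define \<eta> where "\<eta> = (r' - r) / c"
  have \<eta>: "\<eta> > 0" "c * \<eta> = r' - r" using r' c_pos by (auto simp: \<eta>_def)
  obtain N where N: "open N" "x \<in> N" "\<And>y. y \<in> N \<Longrightarrow> y \<in> lb_dom L i \<Longrightarrow> raw_transform (tpar w) i y < ereal r"
    using usc_reg_lessE[OF r(1)] by metis
  have "continuous_on punctured_disc tpar" by (rule continuous_on_tpar) (simp add: punctured_disc_def)
  then obtain N2 where N2: "open N2" "N2 \<inter> punctured_disc = tpar -` ball (tpar w) \<eta> \<inter> punctured_disc"
    unfolding continuous_on_open_invariant using open_ball by metis
  have wN2: "w \<in> N2" using N2(2) xw \<eta> by auto
  have "usc_reg (lb_dom L i) (raw_transform (tpar w') i) y < a" if y: "y \<in> N" and w': "w' \<in> N2" "w' \<in> punctured_disc" for y w'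
  proof -
    have "w' \<in> tpar -` ball (tpar w) \<eta>" using N2(2) w' by blast
    then have "\<bar>tpar w' - tpar w\<bar> < \<eta>" by (simp add: dist_real_def abs_minus_commute)
    then have ce: "c * \<bar>tpar w' - tpar w\<bar> \<le> c * \<eta>" using c_pos by (intro mult_left_mono) auto
    have "usc_reg (lb_dom L i) (raw_transform (tpar w') i) y \<le> ereal r'"
    proof (rule usc_reg_bounded[OF N(1) y])
      fix z assume z: "z \<in> N" "z \<in> lb_dom L i"
      have "raw_transform (tpar w') i z \<le> raw_transform (tpar w) i z + ereal (c * \<bar>tpar w' - tpar w\<bar>)"
        using tpar_nonneg w' xw by (intro raw_transform_Lipschitz) auto
      also have "\<dots> \<le> ereal r + ereal (c * \<eta>)" using N(3)[OF z] ce by (intro add_mono) auto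
      also have "\<dots> = ereal r'" using \<eta> by simp
      finally show "raw_transform (tpar w') i z \<le> ereal r'" .
    qed
    then show ?thesis using r'(2) by simp
  qed
  then show "\<exists>N. open N \<and> p \<in> N \<and> (\<forall>q\<in>N \<inter> lb_dom L i \<times> punctured_disc.
      (case q of (x, w) \<Rightarrow> usc_reg (lb_dom L i) (raw_transform (tpar w) i) x) < a)"
    using N N2(1) wN2 xw by (intro exI[of _ "N \<times> N2"]) (auto intro: open_Times)
qed

text \<open>Let \<open>b\<close> be the slope of a supporting line at \<open>t0\<close> of the circle suprema \<open>\<Gamma>\<close> of \<open>\<gamma>\<close>. If \<open>\<Gamma> t0\<close> exceeds
  \<open>\<phi>\<close>, then \<open>0 < b \<le> c\<close>. For \<open>l' < l < b\<close> the inverse Legendre transform of \<open>\<gamma>\<close> at \<open>l\<close> competes for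
  \<open>\<phi>\<^sub>l\<^sub>'\<close>, and its value at \<open>x\<close> is at least the intercept \<open>\<Gamma> t0 - b t0\<close> of the supporting line; \<open>l' \<rightarrow> b\<close>
  yields the claim.\<close>

lemma product_competitor_le_transform:
  assumes \<gamma>: "\<gamma> \<in> product_competitors" and x: "x \<in> lb_dom L i" and w: "w \<in> punctured_disc"
  shows "\<gamma> i (x, w) \<le> raw_transform (tpar w) i x"
proof -
  note \<gamma>P = product_competitorsD(1)[OF \<gamma>]
  define \<Gamma> where "\<Gamma> = rot_sup (\<gamma> i) x"
  define t0 where "t0 = tpar w"
  have t0: "t0 \<ge> 0" using tpar_nonneg[OF w] by (simp add: t0_def)
  have up: "rot_sup (\<gamma> j) y t \<le> ereal (\<phi> j y + c * t)" if "t \<ge> 0" "y \<in> lb_dom L j" for t j y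
    by (rule rot_sup_le) (use product_competitorsD(2)[OF \<gamma>] that in auto)
  have le\<Gamma>: "\<gamma> i (x, w) \<le> \<Gamma> t0" using le_rot_sup[OF w, of "\<gamma> i" x] by (simp add: \<Gamma>_def t0_def)
  have "\<Gamma> t0 \<le> raw_transform t0 i x"
  proof (cases "\<Gamma> t0 \<le> ereal (\<phi> i x)")
    case True
    then show ?thesis using \<phi>_le_raw_transform order_trans by blast
  next
    case False
    then obtain G0 where G0: "\<Gamma> t0 = ereal G0" "G0 > \<phi> i x"
      using up[OF t0 x] by (cases "\<Gamma> t0") (auto simp: \<Gamma>_def)
    have "t0 \<noteq> 0" using up[OF _ x, of 0] G0 by (auto simp: \<Gamma>_def)
    then have t0p: "t0 > 0" using t0 by simp
    obtain b where b: "b \<le> c" "\<And>t. t \<ge> 0 \<Longrightarrow> ereal (G0 + b * (t - t0)) \<le> \<Gamma> t"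
    proof (rule convex_supporting_line[of \<Gamma> "\<phi> i x" c t0 G0])
      show "\<Gamma> t \<le> ereal (a + m * t)" if "0 \<le> t1" "t1 \<le> t" "t \<le> t2" "\<Gamma> t1 \<le> ereal (a + m * t1)"
        "\<Gamma> t2 \<le> ereal (a + m * t2)" for t1 t t2 a m
        using rot_sup_three_circles_PSH[OF atlas \<gamma>P x that(1-3)] that(4,5) by (simp add: \<Gamma>_def)
    qed (use up x t0p G0 in \<open>auto simp: \<Gamma>_def\<close>)
    have "ereal (G0 - b * t0) \<le> \<Gamma> 0" using b(2)[of 0] by simp
    also have "\<dots> \<le> ereal (\<phi> i x)" using up[OF _ x, of 0] by (simp add: \<Gamma>_def)
    finally have "b * t0 > 0" using G0 by simp
    then have bp: "b > 0" using t0p by (simp add: zero_less_mult_iff)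
    have low: "ereal (G0 - b * t0 + l' * t0) \<le> raw_transform t0 i x" if l': "0 < l'" "l' < b" for l'
    proof -
      define l where "l = (l' + b) / 2"
      have l: "l' < l" "l < b" "l < c" "l' < c" using l' b(1) by (auto simp: l_def)
      define \<delta> where "\<delta> = (\<lambda>i. legendre_inf (\<gamma> i) l)"
      obtain C0 where C0: "\<And>i x w. x \<in> lb_dom L i \<Longrightarrow> w \<in> punctured_disc \<Longrightarrow>
          \<gamma> i (x, w) \<le> ereal (\<phi> i x) + g (x, w) + ereal C0" using product_competitorsD(3)[OF \<gamma>] by blast
      obtain C where C: "\<And>x. legendre_inf g l x \<le> u l' x + ereal C"
        using legendre_inf_g_le[OF l'(1) l(1,3)] by metis
      have \<delta>: "\<delta> \<in> competitors l'"
      proof (rule competitorsI[where C = "C0 + C"])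
        show "\<delta> \<in> PSH A UNIV 1 L" unfolding \<delta>_def by (rule PSH_legendre_inf[OF atlas L \<gamma>P])
        fix j y assume y: "y \<in> lb_dom L j"
        have "\<delta> j y \<le> rot_sup (\<gamma> j) y 0 + ereal (- l * 0)"
          unfolding \<delta>_def legendre_inf_def by (intro INF_lower) auto
        then show "\<delta> j y \<le> ereal (\<phi> j y)" using up[OF _ y, of 0] by (auto intro: order_trans)
        have "\<delta> j y \<le> legendre_inf g l y + ereal (\<phi> j y + C0)"
          unfolding \<delta>_def
        proof (rule legendre_inf_le_add)
          fix w assume "w \<in> punctured_disc"
          from C0[OF y this] show "\<gamma> j (y, w) \<le> g (y, w) + ereal (\<phi> j y + C0)"
            by (cases "g (y, w)") (auto simp: algebra_simps)
        qed
        also have "\<dots> \<le> (u l' y + ereal C) + ereal (\<phi> j y + C0)" by (intro add_right_mono C)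
        also have "\<dots> = ereal (\<phi> j y) + u l' y + ereal (C0 + C)" by (cases "u l' y") auto
        finally show "\<delta> j y \<le> ereal (\<phi> j y) + u l' y + ereal (C0 + C)" .
      qed
      have "ereal (G0 - b * t0) \<le> \<delta> i x" unfolding \<delta>_def legendre_inf_def
      proof (rule INF_greatest)
        fix t :: real assume "t \<in> {0..}"
        then have t: "t \<ge> 0" by simp
        have "l * t \<le> b * t" using l t by (intro mult_right_mono) auto
        then have "G0 - b * t0 + l * t \<le> G0 + b * (t - t0)" by (simp add: algebra_simps)
        then have "ereal (G0 - b * t0 + l * t) \<le> \<Gamma> t" using b(2)[OF t] by (meson ereal_less_eq(3) order_trans)
        then show "ereal (G0 - b * t0) \<le> rot_sup (\<gamma> i) x t + ereal (- l * t)"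
          unfolding \<Gamma>_def by (cases "rot_sup (\<gamma> i) x t") auto
      qed
      also have "\<dots> \<le> (SUP \<gamma>\<in>competitors l'. \<gamma> i x)" using \<delta> by (rule SUP_upper)
      also have "\<dots> \<le> env_curve l' i x" unfolding env_curve_eq[OF l'(1) l(4)] by (rule usc_reg_ge[OF x])
      finally have "ereal (G0 - b * t0) + ereal (t0 * l') \<le> env_curve l' i x + ereal (t0 * l')" by (rule add_right_mono)
      also have "\<dots> \<le> raw_transform t0 i x" unfolding raw_transform_def by (intro SUP_upper) simp
      finally show ?thesis by (simp add: mult.commute)
    qed
    have "ereal G0 \<le> raw_transform t0 i x"
    proof (rule ereal_le_epsilon2)
      fix e :: real assume e: "e > 0"
      define l' where "l' = max (b / 2) (b - e / t0)"
      have l': "0 < l'" "l' < b" using bp e t0p by (auto simp: l'_def)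
      have "b - e / t0 \<le> l'" by (simp add: l'_def)
      then have "(b - e / t0) * t0 \<le> l' * t0" using t0p by (intro mult_right_mono) auto
      then have "b * t0 - e \<le> l' * t0" using t0p by (simp add: algebra_simps)
      then have "G0 \<le> (G0 - b * t0 + l' * t0) + e" by simp
      then have "ereal G0 \<le> ereal (G0 - b * t0 + l' * t0) + ereal e" by simp
      also have "\<dots> \<le> raw_transform t0 i x + ereal e" by (intro add_right_mono low l')
      finally show "ereal G0 \<le> raw_transform t0 i x + ereal e" .
    qed
    then show ?thesis by (simp add: G0)
  qed
  then show ?thesis using le\<Gamma> unfolding t0_def by (rule order_trans[rotated])
qed

lemma product_envelope_le_transform:
  assumes x: "x \<in> lb_dom L i" and w: "w \<in> punctured_disc"
  shows "usc_reg (lb_dom L i \<times> punctured_disc) (\<lambda>p. SUP \<gamma>\<in>product_competitors. \<gamma> i p) (x, w) \<le> usc_reg (lb_dom L i) (raw_transform (tpar w) i) x"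
proof -
  have "(SUP \<gamma>\<in>product_competitors. \<gamma> i (y, v)) \<le> usc_reg (lb_dom L i) (raw_transform (tpar v) i) y"
    if "y \<in> lb_dom L i" "v \<in> punctured_disc" for y v
  proof (rule SUP_least)
    fix \<gamma> assume "\<gamma> \<in> product_competitors"
    from product_competitor_le_transform[OF this that] have "\<gamma> i (y, v) \<le> raw_transform (tpar v) i y" .
    also have "\<dots> \<le> usc_reg (lb_dom L i) (raw_transform (tpar v) i) y" by (rule usc_reg_ge[OF that(1)])
    finally show "\<gamma> i (y, v) \<le> usc_reg (lb_dom L i) (raw_transform (tpar v) i) y" .
  qed
  then have "usc_reg (lb_dom L i \<times> punctured_disc) (\<lambda>p. SUP \<gamma>\<in>product_competitors. \<gamma> i p) (x, w)
     \<le> (\<lambda>(x, w). usc_reg (lb_dom L i) (raw_transform (tpar w) i) x) (x, w)"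
    using x w by (intro usc_reg_least[OF _ usc_on_legendre_transform]) auto
  then show ?thesis by simp
qed

end

theorem theorem1p6:
  fixes A :: "('x::t2_space, complex^'n) atlas"
    and L :: "('i, 'x) line_bundle" and F :: "('j, 'x) line_bundle"
    and \<phi> :: "'i \<Rightarrow> 'x \<Rightarrow> real" and \<sigma> :: "'j \<Rightarrow> 'x \<Rightarrow> real"
    and \<psi> :: "real \<Rightarrow> 'j \<Rightarrow> 'x \<Rightarrow> ereal" and c :: real
  assumes "compact_complex_manifold A"
    and "holomorphic_line_bundle A L" and "big A L"
    and "smooth_metric A L \<phi>" and "(\<lambda>i x. ereal (\<phi> i x)) \<in> PSH A UNIV 1 L"
    and "holomorphic_line_bundle A F" and "smooth_metric A F \<sigma>"
    and "test_curve A F c \<psi>"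
    and nontrivial: "\<exists>l\<in>{0<..<c}. \<exists>j. \<exists>x\<in>lb_dom F j. \<psi> l j x \<noteq> -\<infinity>"
  shows "\<forall>i. \<forall>x\<in>lb_dom L i. \<forall>w\<in>punctured_disc.
           legendre_transform A L F \<phi> \<sigma> c \<psi> (tpar w) i x
           = product_envelope A L F \<phi> \<sigma> c \<psi> i (x, w)"
proof (intro allI ballI)
  fix i x w assume x: "x \<in> lb_dom L i" and w: "w \<in> punctured_disc"
  interpret envelope_setup A F \<sigma> \<psi> c L \<phi>
    using assms by unfold_locales
  show "legendre_transform A L F \<phi> \<sigma> c \<psi> (tpar w) i x = product_envelope A L F \<phi> \<sigma> c \<psi> i (x, w)"
    unfolding legendre_transform_eq product_envelope_eq
    by (rule antisym[OF transform_le_product_envelope[OF x w] product_envelope_le_transform[OF x w]])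
qed

end
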